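(* Let $M$ be a Riemann surface, let $h:M\to Q^5$ be a full superhorizontal holomorphic map and let $F:M\to S^6$ be the corresponding almost complex map, $F=\mathrm i\,\overline H\times H/|H|^2$ where $H$ is any nowhere zero local section of $h$. Let $f=\mathrm{span}\{F\}$. Then $\varphi=G^{(-i)}(f)\oplus f\oplus G^{(i)}(f)$ is a harmonic map into $G_2/\mathrm{SO}(4)$ for $i=1,2,3$. Further, $\varphi$ is strongly conformal (i.e. $s(\varphi)=1$) for $i=1,3$, but $s(\varphi)=3$ for $i=2$.
   Context: $\mathbb{O}$ is the algebra of octonions, $\mathrm{Im}\,\mathbb{O}\cong\mathbb{R}^7$ its imaginary part with the standard Euclidean inner product $(\cdot,\cdot)$ and vector product $v\times w=$ imaginary part of $v\cdot w$; both are extended complex-bilinearly to $\mathbb{C}^7=\mathrm{Im}\,\mathbb{O}\otimes\mathbb{C}$. Orthogonality in $\mathbb{C}^7$ and $|\cdot|$ are with respect to the Hermitian inner product $(v,\overline w)$. A real 3-dimensional subspace of $\mathrm{Im}\,\mathbb{O}$ is associative if it is the imaginary part of a subalgebra isomorphic to the quaternions; $G_2/\mathrm{SO}(4)$, $G_2=\mathrm{Aut}(\mathbb{O})$, is the symmetric space of all associative 3-dimensional subspaces (identified with their complexifications). A Riemann surface is a connected (not necessarily compact) one-dimensional complex manifold. $Q^5\subset\mathbb{CP}^6$ is the quadric of 1-dimensional isotropic subspaces of $\mathbb{C}^7$ (those on which $(\cdot,\cdot)$ vanishes). A holomorphic map $h:M\to Q^5$ is full if its image lies in no proper projective subspace of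 $\mathbb{CP}^6$; a full holomorphic map $h$ is superhorizontal if any local holomorphic section $H$ of $h$ (as a line subbundle of $M\times\mathbb{C}^7$) satisfies $H\times H'=0$, where $H'=\partial H/\partial z$. $S^6$ is the unit sphere in $\mathrm{Im}\,\mathbb{O}$ with almost complex structure $J_Fv=F\times v$; a map $M\to S^6$ is almost complex if its differential intertwines the complex structure of $M$ with $J$. By a theorem of Bryant, for any full superhorizontal holomorphic map $h:M\to Q^5$ from a Riemann surface $M$, the map $F=\mathrm i\,\overline H\times H/|H|^2$ (where $H$ is any nowhere zero local section of $h$) is well defined, almost complex (hence harmonic), full and superminimal, and $h=G^{(-3)}(f)$ where $f=\mathrm{span}\{F\}$. Maps into Grassmannians of $\mathbb{C}^7$ are identified with subbundles of $M\times\mathbb{C}^7$. For a subbundle $\varphi$ and local complex coordinate $z$, $A'_\varphi(v)=\pi_{\varphi^\perp}(\partial_zv)$, $A''_\varphi(v)=\pi_{\varphi^\perp}(\partial_{\bar z}v)$ ($v\in\Gamma(\varphi)$; $\pi_V$ = orthogonal projection onto $V$). If $\varphi$ is harmonic, $G'(\varphi)$, $G''(\varphi)$ are the images of $A'_\varphi$, $A''_\varphi$, extended to subbundles over the isolated points where the rank drops; $G^{(0)}(\varphi)=\varphi$, $G^{(i)}(\varphi)=G'(G^{(i-1)}(\varphi))$, $G^{(-i)}(\varphi)=G''(G^{(-i+1)}(\varphi))$ for $i\ge1$. $\varphi$ is strongly conformal if $G'(\varphi)\perp G''(\varphi)$. With $\iota=\pi_\varphi-\pi_{\varphi^\perp}$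 and $A^\varphi_z=\frac12\iota^{-1}\partial_z\iota$ (so $A^\varphi_z=-(A'_\varphi\oplus A'_{\varphi^\perp})$), $s(\varphi)$ is the least positive integer $s$ such that $(A^\varphi_z)^{2s}\bigl((-1)^{s-1}\varphi\bigr)=0$, where $-\varphi$ denotes $\varphi^\perp$; it is defined for non-constant nilconformal harmonic maps, i.e. when $A^\varphi_z$ is nilpotent. *)

theory Defs
  imports "HOL-Analysis.Analysis"
begin

section \<open>Octonions and the vector product\<close>

text \<open>
  Cayley--Dickson doubling, twice, starting from the complex numbers. The vector space structure
  and the Euclidean inner product are those of the library's product types.
\<close>

type_synonym quat = "complex \<times> complex"
type_synonym octonion = "quat \<times> quat"

definition qmul :: "quat \<Rightarrow> quat \<Rightarrow> quat" where
  "qmul x y = (fst x * fst y - cnj (snd y) * snd x, snd y * fst x + snd x * cnj (fst y))"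

definition qcnj :: "quat \<Rightarrow> quat" where
  "qcnj x = (cnj (fst x), - snd x)"

definition omul :: "octonion \<Rightarrow> octonion \<Rightarrow> octonion" where
  "omul x y = (qmul (fst x) (fst y) - qmul (qcnj (snd y)) (snd x),
               qmul (snd y) (fst x) + qmul (snd x) (qcnj (fst y)))"

text \<open>
  The imaginary part drops the real coordinate \<open>Re (fst (fst x))\<close>; the other seven
  coordinates identify the imaginary octonions isometrically with \<^typ>\<open>real^7\<close>.
\<close>

definition oct_im :: "octonion \<Rightarrow> real^7" where
  "oct_im x = vector [Im (fst (fst x)), Re (snd (fst x)), Im (snd (fst x)),
                      Re (fst (snd x)), Im (fst (snd x)), Re (snd (snd x)), Im (snd (snd x))]"

definition oct_of_im :: "real^7 \<Rightarrow> octonion" where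
  "oct_of_im v = ((Complex 0 (v$1), Complex (v$2) (v$3)),
                  (Complex (v$4) (v$5), Complex (v$6) (v$7)))"

definition rcross :: "real^7 \<Rightarrow> real^7 \<Rightarrow> real^7" where
  "rcross v w = oct_im (omul (oct_of_im v) (oct_of_im w))"

definition re_vec :: "complex^7 \<Rightarrow> real^7" where
  "re_vec v = (\<chi> k. Re (v $ k))"

definition im_vec :: "complex^7 \<Rightarrow> real^7" where
  "im_vec v = (\<chi> k. Im (v $ k))"

definition cvec :: "real^7 \<Rightarrow> complex^7" where
  "cvec v = (\<chi> k. complex_of_real (v $ k))"

definition conj_vec :: "complex^7 \<Rightarrow> complex^7" where
  "conj_vec v = (\<chi> k. cnj (v $ k))"

definition ccross :: "complex^7 \<Rightarrow> complex^7 \<Rightarrow> complex^7" where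
  "ccross v w =
     cvec (rcross (re_vec v) (re_vec w) - rcross (im_vec v) (im_vec w)) +
     \<i> *s cvec (rcross (re_vec v) (im_vec w) + rcross (im_vec v) (re_vec w))"

definition cdot :: "complex^7 \<Rightarrow> complex^7 \<Rightarrow> complex" where
  "cdot v w = (\<Sum>k\<in>UNIV. v $ k * w $ k)"

definition herm :: "complex^7 \<Rightarrow> complex^7 \<Rightarrow> complex" where
  "herm v w = cdot v (conj_vec w)"


section \<open>Subspaces of \<open>\<complex>\<^sup>7\<close>, the quadric, and \<open>G\<^sub>2/SO(4)\<close>\<close>

text \<open>
  Complex subspaces, spans and dimensions are the library's \<^const>\<open>vec.subspace\<close>,
  \<^const>\<open>vec.span\<close>, \<^const>\<open>vec.dim\<close>; the unqualified notions are the real ones.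
\<close>

definition ocompl :: "(complex^7) set \<Rightarrow> (complex^7) set" where
  "ocompl W = {v. \<forall>w\<in>W. herm v w = 0}"

definition oproj :: "(complex^7) set \<Rightarrow> complex^7 \<Rightarrow> complex^7" where
  "oproj W v = (THE u. u \<in> W \<and> v - u \<in> ocompl W)"

definition projm :: "(complex^7) set \<Rightarrow> complex^7^7" where
  "projm W = matrix (oproj W)"

definition quadric5 :: "(complex^7) set set" where
  "quadric5 = {L. vec.subspace L \<and> vec.dim L = 1 \<and> (\<forall>v\<in>L. \<forall>w\<in>L. cdot v w = 0)}"

definition associative_subspace :: "(real^7) set \<Rightarrow> bool" where
  "associative_subspace W \<longleftrightarrow>
     subspace W \<and> dim W = 3 \<and>
     (\<exists>A \<psi>. subspace A \<and> (\<forall>x\<in>A. \<forall>y\<in>A. omul x y \<in> A) \<and>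
            linear \<psi> \<and> bij_betw \<psi> (UNIV :: quat set) A \<and>
            (\<forall>x y. \<psi> (qmul x y) = omul (\<psi> x) (\<psi> y)) \<and>
            W = oct_im ` A)"

definition complexify :: "(real^7) set \<Rightarrow> (complex^7) set" where
  "complexify W = {v. re_vec v \<in> W \<and> im_vec v \<in> W}"

definition G2_SO4 :: "(complex^7) set set" where
  "G2_SO4 = complexify ` {W. associative_subspace W}"


section \<open>Riemann surfaces and calculus in charts\<close>

text \<open>
  A chart is a pair of its domain and its coordinate function. No countability axiom is
  imposed: it is automatic for Riemann surfaces.
\<close>

type_synonym 'm chart = "'m set \<times> ('m \<Rightarrow> complex)"

definition in_chart :: "'m chart \<Rightarrow> ('m \<Rightarrow> 'b) \<Rightarrow> complex \<Rightarrow> 'b" where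
  "in_chart c f = f \<circ> inv_into (fst c) (snd c)"

definition riemann_surface :: "'m::t2_space chart set \<Rightarrow> bool" where
  "riemann_surface \<A> \<longleftrightarrow>
     connected (UNIV :: 'm set) \<and> (\<Union>c\<in>\<A>. fst c) = UNIV \<and>
     (\<forall>c\<in>\<A>. open (fst c) \<and> open (snd c ` fst c) \<and>
        homeomorphism (fst c) (snd c ` fst c) (snd c) (inv_into (fst c) (snd c))) \<and>
     (\<forall>c\<in>\<A>. \<forall>d\<in>\<A>. in_chart c (snd d) holomorphic_on snd c ` (fst c \<inter> fst d))"

primrec Ck_on :: "nat \<Rightarrow> (complex \<Rightarrow> 'b::real_normed_vector) \<Rightarrow> complex set \<Rightarrow> bool" where
  "Ck_on 0 f U \<longleftrightarrow> continuous_on U f"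
| "Ck_on (Suc n) f U \<longleftrightarrow>
     (\<forall>x\<in>U. f differentiable at x) \<and> (\<forall>v. Ck_on n (\<lambda>x. frechet_derivative f (at x) v) U)"

definition smooth_map :: "'m chart set \<Rightarrow> 'm set \<Rightarrow> ('m \<Rightarrow> 'b::real_normed_vector) \<Rightarrow> bool" where
  "smooth_map \<A> U f \<longleftrightarrow> (\<forall>c\<in>\<A>. \<forall>n. Ck_on n (in_chart c f) (snd c ` (U \<inter> fst c)))"

definition holomorphic_map :: "'m chart set \<Rightarrow> 'm set \<Rightarrow> ('m \<Rightarrow> complex^7) \<Rightarrow> bool" where
  "holomorphic_map \<A> U H \<longleftrightarrow>
     (\<forall>c\<in>\<A>. \<forall>k. in_chart c (\<lambda>p. H p $ k) holomorphic_on snd c ` (U \<inter> fst c))"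

text \<open>The Wirtinger derivatives, entrywise on vectors and matrices.\<close>

definition dz :: "'m chart \<Rightarrow> ('m \<Rightarrow> complex) \<Rightarrow> 'm \<Rightarrow> complex" where
  "dz c f p = (let D = frechet_derivative (in_chart c f) (at (snd c p)) in (D 1 - \<i> * D \<i>) / 2)"

definition dzbar :: "'m chart \<Rightarrow> ('m \<Rightarrow> complex) \<Rightarrow> 'm \<Rightarrow> complex" where
  "dzbar c f p = (let D = frechet_derivative (in_chart c f) (at (snd c p)) in (D 1 + \<i> * D \<i>) / 2)"

definition dz_vec :: "'m chart \<Rightarrow> ('m \<Rightarrow> complex^7) \<Rightarrow> 'm \<Rightarrow> complex^7" where
  "dz_vec c v p = (\<chi> k. dz c (\<lambda>q. v q $ k) p)"

definition dzbar_vec :: "'m chart \<Rightarrow> ('m \<Rightarrow> complex^7) \<Rightarrow> 'm \<Rightarrow> complex^7" where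
  "dzbar_vec c v p = (\<chi> k. dzbar c (\<lambda>q. v q $ k) p)"

definition dz_mat :: "'m chart \<Rightarrow> ('m \<Rightarrow> complex^7^7) \<Rightarrow> 'm \<Rightarrow> complex^7^7" where
  "dz_mat c T p = (\<chi> j. dz_vec c (\<lambda>q. T q $ j) p)"

definition dzbar_mat :: "'m chart \<Rightarrow> ('m \<Rightarrow> complex^7^7) \<Rightarrow> 'm \<Rightarrow> complex^7^7" where
  "dzbar_mat c T p = (\<chi> j. dzbar_vec c (\<lambda>q. T q $ j) p)"


section \<open>Subbundles and harmonic maps\<close>

text \<open>
  Smooth subbundles of \<open>M \<times> \<complex>\<^sup>7\<close> are smooth maps into Grassmannians. A Grassmannian is
  regarded as a submanifold of the space of matrices, a subspace being identified with the
  orthogonal projection onto it.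
\<close>

definition subbundle :: "'m chart set \<Rightarrow> ('m \<Rightarrow> (complex^7) set) \<Rightarrow> bool" where
  "subbundle \<A> \<phi> \<longleftrightarrow>
     (\<forall>p. vec.subspace (\<phi> p)) \<and> (\<exists>k. \<forall>p. vec.dim (\<phi> p) = k) \<and>
     smooth_map \<A> UNIV (\<lambda>p. projm (\<phi> p))"

definition local_section :: "('m \<Rightarrow> (complex^7) set) \<Rightarrow> 'm set \<Rightarrow> ('m \<Rightarrow> complex^7) \<Rightarrow> bool" where
  "local_section \<phi> U v \<longleftrightarrow> (\<forall>q\<in>U. v q \<in> \<phi> q)"

definition tangent_vectors :: "'b::real_normed_vector set \<Rightarrow> 'b \<Rightarrow> 'b set" where
  "tangent_vectors S x =
     {X. \<exists>\<gamma> :: real \<Rightarrow> 'b. \<gamma> 0 = x \<and> (\<forall>t. \<gamma> t \<in> S) \<and> (\<gamma> has_vector_derivative X) (at 0)}"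

text \<open>
  Harmonicity of a map into a submanifold \<open>N\<close> of a Grassmannian, for the metric induced by the
  real part of the trace form (which is \<open>inner\<close> on \<^typ>\<open>complex^7^7\<close>): the tension field, i.e. the
  component tangent to \<open>N\<close> of the Laplacian of the embedded map, vanishes. As \<open>M\<close> is a surface,
  the Laplacian of any conformal metric is a positive multiple of \<open>\<partial>\<^sup>2/\<partial>z\<partial>\<zeta>\<close> where \<open>\<zeta>\<close> is the
  conjugate of the coordinate \<open>z\<close>, so no metric on \<open>M\<close> has to be chosen. On the \<open>G\<^sub>2\<close>-orbit \<^const>\<open>G2_SO4\<close> the
  induced metric is \<open>G\<^sub>2\<close>-invariant, hence is the symmetric space metric up to a constant.
\<close>

definition harmonic_into ::
    "'m chart set \<Rightarrow> (complex^7) set set \<Rightarrow> ('m \<Rightarrow> (complex^7) set) \<Rightarrow> bool" where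
  "harmonic_into \<A> N \<phi> \<longleftrightarrow>
     (\<forall>p. \<phi> p \<in> N) \<and> smooth_map \<A> UNIV (\<lambda>p. projm (\<phi> p)) \<and>
     (\<forall>c\<in>\<A>. \<forall>p\<in>fst c. \<forall>X\<in>tangent_vectors (projm ` N) (projm (\<phi> p)).
        X \<bullet> dzbar_mat c (dz_mat c (\<lambda>q. projm (\<phi> q))) p = 0)"


section \<open>Gauss bundles, strong conformality, and \<open>s(\<phi>)\<close>\<close>

definition A1 :: "'m chart \<Rightarrow> ('m \<Rightarrow> (complex^7) set) \<Rightarrow> ('m \<Rightarrow> complex^7) \<Rightarrow> 'm \<Rightarrow> complex^7" where
  "A1 c \<phi> v p = oproj (ocompl (\<phi> p)) (dz_vec c v p)"

definition A2 :: "'m chart \<Rightarrow> ('m \<Rightarrow> (complex^7) set) \<Rightarrow> ('m \<Rightarrow> complex^7) \<Rightarrow> 'm \<Rightarrow> complex^7" where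
  "A2 c \<phi> v p = oproj (ocompl (\<phi> p)) (dzbar_vec c v p)"

text \<open>
  Changing the coordinate only rescales \<^const>\<open>A1\<close> and \<^const>\<open>A2\<close>, so all charts around a point give
  the same image.
\<close>

definition A1_image :: "'m::topological_space chart set \<Rightarrow> ('m \<Rightarrow> (complex^7) set) \<Rightarrow> 'm \<Rightarrow> (complex^7) set" where
  "A1_image \<A> \<phi> p =
     {A1 c \<phi> v p | c v. c \<in> \<A> \<and> p \<in> fst c \<and>
        (\<exists>U. open U \<and> p \<in> U \<and> smooth_map \<A> U v \<and> local_section \<phi> U v)}"

definition A2_image :: "'m::topological_space chart set \<Rightarrow> ('m \<Rightarrow> (complex^7) set) \<Rightarrow> 'm \<Rightarrow> (complex^7) set" where
  "A2_image \<A> \<phi> p =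
     {A2 c \<phi> v p | c v. c \<in> \<A> \<and> p \<in> fst c \<and>
        (\<exists>U. open U \<and> p \<in> U \<and> smooth_map \<A> U v \<and> local_section \<phi> U v)}"

text \<open>
  The extension of the image over isolated points is unique, by continuity; it exists when
  \<open>\<phi>\<close> is harmonic.
\<close>

definition gauss1 ::
    "'m::topological_space chart set \<Rightarrow> ('m \<Rightarrow> (complex^7) set) \<Rightarrow> 'm \<Rightarrow> (complex^7) set" where
  "gauss1 \<A> \<phi> =
     (THE \<psi>. subbundle \<A> \<psi> \<and> (\<forall>p. \<not> p islimpt {q. A1_image \<A> \<phi> q \<noteq> \<psi> q}))"

definition gauss2 ::
    "'m::topological_space chart set \<Rightarrow> ('m \<Rightarrow> (complex^7) set) \<Rightarrow> 'm \<Rightarrow> (complex^7) set" where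
  "gauss2 \<A> \<phi> =
     (THE \<psi>. subbundle \<A> \<psi> \<and> (\<forall>p. \<not> p islimpt {q. A2_image \<A> \<phi> q \<noteq> \<psi> q}))"

definition strongly_conformal ::
    "'m::topological_space chart set \<Rightarrow> ('m \<Rightarrow> (complex^7) set) \<Rightarrow> bool" where
  "strongly_conformal \<A> \<phi> \<longleftrightarrow>
     (\<forall>p. \<forall>u\<in>gauss1 \<A> \<phi> p. \<forall>v\<in>gauss2 \<A> \<phi> p. herm u v = 0)"

definition cartan_embed :: "('m \<Rightarrow> (complex^7) set) \<Rightarrow> 'm \<Rightarrow> complex^7^7" where
  "cartan_embed \<phi> p = projm (\<phi> p) - projm (ocompl (\<phi> p))"

definition Az :: "'m chart \<Rightarrow> ('m \<Rightarrow> (complex^7) set) \<Rightarrow> 'm \<Rightarrow> complex^7^7" where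
  "Az c \<phi> p = (1/2) *\<^sub>R (matrix_inv (cartan_embed \<phi> p) ** dz_mat c (cartan_embed \<phi>) p)"

definition nonconstant :: "('m \<Rightarrow> (complex^7) set) \<Rightarrow> bool" where
  "nonconstant \<phi> \<longleftrightarrow> (\<exists>p q. \<phi> p \<noteq> \<phi> q)"

definition nilconformal :: "'m chart set \<Rightarrow> ('m \<Rightarrow> (complex^7) set) \<Rightarrow> bool" where
  "nilconformal \<A> \<phi> \<longleftrightarrow>
     (\<forall>c\<in>\<A>. \<forall>p\<in>fst c. \<exists>n. \<forall>v. ((\<lambda>x. Az c \<phi> p *v x) ^^ n) v = 0)"

definition s_number :: "'m chart set \<Rightarrow> ('m \<Rightarrow> (complex^7) set) \<Rightarrow> nat" where
  "s_number \<A> \<phi> =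
     (LEAST s. 0 < s \<and>
        (\<forall>c\<in>\<A>. \<forall>p\<in>fst c. \<forall>v\<in>(if even (s - 1) then \<phi> p else ocompl (\<phi> p)).
           ((\<lambda>x. Az c \<phi> p *v x) ^^ (2 * s)) v = 0))"


section \<open>Superhorizontal maps into the quadric and almost complex maps to \<open>S\<^sup>6\<close>\<close>

definition holomorphic_to_quadric ::
    "'m::topological_space chart set \<Rightarrow> ('m \<Rightarrow> (complex^7) set) \<Rightarrow> bool" where
  "holomorphic_to_quadric \<A> h \<longleftrightarrow>
     (\<forall>p. h p \<in> quadric5) \<and>
     (\<forall>p. \<exists>U H. open U \<and> p \<in> U \<and> holomorphic_map \<A> U H \<and>
        local_section h U H \<and> (\<forall>q\<in>U. H q \<noteq> 0))"

definition full_map :: "('m \<Rightarrow> (complex^7) set) \<Rightarrow> bool" where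
  "full_map h \<longleftrightarrow> (\<forall>W. vec.subspace W \<and> (\<forall>p. h p \<subseteq> W) \<longrightarrow> W = UNIV)"

definition superhorizontal ::
    "'m::topological_space chart set \<Rightarrow> ('m \<Rightarrow> (complex^7) set) \<Rightarrow> bool" where
  "superhorizontal \<A> h \<longleftrightarrow>
     (\<forall>U H. open U \<and> holomorphic_map \<A> U H \<and> local_section h U H \<longrightarrow>
        (\<forall>c\<in>\<A>. \<forall>p\<in>U \<inter> fst c. ccross (H p) (dz_vec c H p) = 0))"

text \<open>
  The equation also expresses that its right-hand side is a real vector; that \<open>F\<close> then takes
  values in the unit sphere and is almost complex is Bryant's theorem.
\<close>

definition bryant_map ::
    "'m::topological_space chart set \<Rightarrow> ('m \<Rightarrow> (complex^7) set) \<Rightarrow> ('m \<Rightarrow> real^7) \<Rightarrow> bool" where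
  "bryant_map \<A> h F \<longleftrightarrow>
     (\<forall>U H. open U \<and> smooth_map \<A> U H \<and> local_section h U H \<and> (\<forall>q\<in>U. H q \<noteq> 0) \<longrightarrow>
        (\<forall>p\<in>U. cvec (F p) =
           (\<i> / complex_of_real ((norm (H p))\<^sup>2)) *s ccross (conj_vec (H p)) (H p)))"

definition bundle_sum3 ::
    "('m \<Rightarrow> (complex^7) set) \<Rightarrow> ('m \<Rightarrow> (complex^7) set) \<Rightarrow> ('m \<Rightarrow> (complex^7) set)
       \<Rightarrow> 'm \<Rightarrow> (complex^7) set" where
  "bundle_sum3 \<alpha> \<beta> \<gamma> p = {u + v + w | u v w. u \<in> \<alpha> p \<and> v \<in> \<beta> p \<and> w \<in> \<gamma> p}"

end

theory Submission
  imports Defs "HOL-Complex_Analysis.Conformal_Mappings"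
begin

text \<open>
  The harmonic sequence of \<open>f\<close> splits \<open>M \<times> \<complex>\<^sup>7\<close> into seven orthogonal lines \<open>f\<^sub>j\<close>,
  \<open>-3 \<le> j \<le> 3\<close>, with \<open>f\<^sub>-\<^sub>3 = h\<close>, \<open>f\<^sub>0 = f\<close> and \<open>f\<^sub>-\<^sub>j\<close> conjugate to \<open>f\<^sub>j\<close>. Superhorizontality forces
  the derivative \<open>\<partial>P\<close> of every sum \<open>P\<close> of the orthogonal projections onto these lines to have degree one in
  this grading, with entries between \<open>f\<^sub>j\<close> and \<open>f\<^sub>j\<^sub>+\<^sub>1\<close> exactly where one of the two lines
  belongs to the image of \<open>P\<close>. Hence the second derivative \<open>\<partial>\<partial>P\<close> with respect to \<open>z\<close> and its
  conjugate commutes with \<open>P\<close>, which is harmonicity, and the Gauss bundles and the powers of \<open>A\<^sub>z\<close> are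
  found by counting degrees.

  The lines come from a local holomorphic section \<open>H\<close> of \<open>h\<close>: \<open>f\<^sub>-\<^sub>2\<close> is the part of \<open>H'\<close>
  orthogonal to \<open>H\<close>, extended over the isolated zeros of \<open>H \<and> H'\<close>, and
  \<open>f\<^sub>-\<^sub>1 = h \<times> f\<^sub>2\<close>. Each \<open>f\<^sub>j\<close> with \<open>j \<noteq> 0\<close> is an eigenline of \<open>F \<times> _\<close> with eigenvalue \<open>\<plusminus>\<i>\<close>,
  and so spans an associative subspace together with its conjugate and \<open>f\<close>. The map from
  \<open>f\<^sub>j\<close> to \<open>f\<^sub>j\<^sub>+\<^sub>1\<close> can only degenerate identically if \<open>h\<close> lies in a plane; otherwise its zeros are
  isolated.
\<close>

section \<open>Vector products in \<open>\<complex>\<^sup>7\<close>\<close>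

text \<open>Three obstacles shape the argument. Sections of the lines exist only locally and up to
  factors, so the grading is recorded by projection matrices, which are global and smooth.
  Gram-Schmidt for \<open>H\<close> and \<open>H'\<close> fails where they are dependent; dividing
  \<open>H'\<close> by its coordinate of least vanishing order gives a substitute \<open>K\<close>,
  and continuity carries identities over the exceptional point. The tangent space of
  \<open>G2_SO4\<close> is never computed: a Laplacian commuting with the projection is orthogonal
  to all tangent vectors of the Grassmannian. Degree one is read off from the bilinear pairings of
  the derivative of one frame vector with another. Derivatives of the vectors of index -3 and -2 are
  annihilated by \<open>ccross H\<close>, whose kernel is isotropic; conjugation and holomorphy
  handle the indices 3 and 2; constancy of the inner products makes the pairings skew and yields the
  rest. Membership in {-2, 0, 2} alternates along the seven indices, so all six arrows survive and
  powers of \<open>Az\<close> die only at the end of the sequence. For {-1, 0, 1} and {-3, 0, 3},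
  two successive steps starting in the set never both cross its boundary.\<close>

lemma exhaust_7:
  fixes x :: 7
  shows "x = 1 \<or> x = 2 \<or> x = 3 \<or> x = 4 \<or> x = 5 \<or> x = 6 \<or> x = 7"
proof (induct x)
  case (of_int z)
  hence "z = 0 \<or> z = 1 \<or> z = 2 \<or> z = 3 \<or> z = 4 \<or> z = 5 \<or> z = 6" by simp arith
  then show ?case by auto
qed

lemma forall_7: "(\<forall>i::7. P i) \<longleftrightarrow> P 1 \<and> P 2 \<and> P 3 \<and> P 4 \<and> P 5 \<and> P 6 \<and> P 7"
  by (metis exhaust_7)

lemma UNIV_7: "UNIV = {1::7, 2, 3, 4, 5, 6, 7}"
  using exhaust_7 by auto

lemma sum_7: "sum f (UNIV::7 set) = f 1 + f 2 + f 3 + f 4 + f 5 + f 6 + f 7"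
  unfolding UNIV_7 by (simp add: ac_simps)

lemma vector_7 [simp]:
  "(vector [a,b,c,d,e,f,g] :: 'a::zero^7) $ 1 = a"
  "(vector [a,b,c,d,e,f,g] :: 'a^7) $ 2 = b"
  "(vector [a,b,c,d,e,f,g] :: 'a^7) $ 3 = c"
  "(vector [a,b,c,d,e,f,g] :: 'a^7) $ 4 = d"
  "(vector [a,b,c,d,e,f,g] :: 'a^7) $ 5 = e"
  "(vector [a,b,c,d,e,f,g] :: 'a^7) $ 6 = f"
  "(vector [a,b,c,d,e,f,g] :: 'a^7) $ 7 = g"
  unfolding vector_def by auto

lemma rcross_nth:
  "rcross v w $ 1 = v$2 * w$3 - v$3 * w$2 + v$4 * w$5 - v$5 * w$4 + v$7 * w$6 - v$6 * w$7"
  "rcross v w $ 2 = v$3 * w$1 - v$1 * w$3 + v$4 * w$6 - v$6 * w$4 + v$5 * w$7 - v$7 * w$5"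
  "rcross v w $ 3 = v$1 * w$2 - v$2 * w$1 + v$4 * w$7 - v$7 * w$4 + v$6 * w$5 - v$5 * w$6"
  "rcross v w $ 4 = v$5 * w$1 - v$1 * w$5 + v$6 * w$2 - v$2 * w$6 + v$7 * w$3 - v$3 * w$7"
  "rcross v w $ 5 = v$1 * w$4 - v$4 * w$1 + v$7 * w$2 - v$2 * w$7 + v$3 * w$6 - v$6 * w$3"
  "rcross v w $ 6 = v$1 * w$7 - v$7 * w$1 + v$2 * w$4 - v$4 * w$2 + v$5 * w$3 - v$3 * w$5"
  "rcross v w $ 7 = v$6 * w$1 - v$1 * w$6 + v$2 * w$5 - v$5 * w$2 + v$3 * w$4 - v$4 * w$3"
  unfolding rcross_def oct_im_def omul_def qmul_def qcnj_def oct_of_im_def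
  by (simp_all add: algebra_simps)

text \<open>The complex bilinear extension has the same integer structure constants as the real
  product, so the basic identities below are polynomial identities checked coordinatewise.\<close>

lemma ccross_nth:
  "ccross v w $ 1 = v$2 * w$3 - v$3 * w$2 + v$4 * w$5 - v$5 * w$4 + v$7 * w$6 - v$6 * w$7"
  "ccross v w $ 2 = v$3 * w$1 - v$1 * w$3 + v$4 * w$6 - v$6 * w$4 + v$5 * w$7 - v$7 * w$5"
  "ccross v w $ 3 = v$1 * w$2 - v$2 * w$1 + v$4 * w$7 - v$7 * w$4 + v$6 * w$5 - v$5 * w$6"
  "ccross v w $ 4 = v$5 * w$1 - v$1 * w$5 + v$6 * w$2 - v$2 * w$6 + v$7 * w$3 - v$3 * w$7"
  "ccross v w $ 5 = v$1 * w$4 - v$4 * w$1 + v$7 * w$2 - v$2 * w$7 + v$3 * w$6 - v$6 * w$3"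
  "ccross v w $ 6 = v$1 * w$7 - v$7 * w$1 + v$2 * w$4 - v$4 * w$2 + v$5 * w$3 - v$3 * w$5"
  "ccross v w $ 7 = v$6 * w$1 - v$1 * w$6 + v$2 * w$5 - v$5 * w$2 + v$3 * w$4 - v$4 * w$3"
    unfolding ccross_def cvec_def re_vec_def im_vec_def
  by (simp_all add: rcross_nth complex_eq_iff algebra_simps)


lemma cvec_nth [simp]: "cvec v $ k = complex_of_real (v $ k)"
  by (simp add: cvec_def)

lemma conj_vec_nth [simp]: "conj_vec v $ k = cnj (v $ k)"
  by (simp add: conj_vec_def)

lemma cdot_7: "cdot v w = v$1*w$1 + v$2*w$2 + v$3*w$3 + v$4*w$4 + v$5*w$5 + v$6*w$6 + v$7*w$7"
  by (simp add: cdot_def sum_7)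

lemma ccross_add_left: "ccross (u + v) w = ccross u w + ccross v w"
  and ccross_add_right: "ccross w (u + v) = ccross w u + ccross w v"
  and ccross_diff_right: "ccross w (u - v) = ccross w u - ccross w v"
  and ccross_minus_right: "ccross w (- u) = - ccross w u"
  and ccross_scale_left: "ccross (a *s u) w = a *s ccross u w"
  and ccross_scale_right: "ccross w (a *s u) = a *s ccross w u"
  by (simp_all add: vec_eq_iff forall_7 ccross_nth algebra_simps)

lemma ccross_zero [simp]: "ccross 0 w = 0" "ccross w 0 = 0" "ccross w w = 0"
  by (simp_all add: vec_eq_iff forall_7 ccross_nth algebra_simps)

lemma ccross_commute: "ccross v w = - ccross w v"
  by (simp add: vec_eq_iff forall_7 ccross_nth algebra_simps)

lemma conj_vec_ccross: "conj_vec (ccross v w) = ccross (conj_vec v) (conj_vec w)"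
  by (simp add: vec_eq_iff forall_7 ccross_nth)

lemma ccross_cvec: "ccross (cvec v) (cvec w) = cvec (rcross v w)"
  by (simp add: vec_eq_iff forall_7 ccross_nth rcross_nth)

lemma cdot_add_left: "cdot (u + v) w = cdot u w + cdot v w"
  and cdot_add_right: "cdot w (u + v) = cdot w u + cdot w v"
  and cdot_diff_left: "cdot (u - v) w = cdot u w - cdot v w"
  and cdot_diff_right: "cdot w (u - v) = cdot w u - cdot w v"
  and cdot_minus_right: "cdot w (- u) = - cdot w u"
  and cdot_scale_left: "cdot (a *s u) w = a * cdot u w"
  and cdot_scale_right: "cdot w (a *s u) = a * cdot w u"
  by (simp_all add: cdot_7 algebra_simps)

lemma cdot_zero [simp]: "cdot 0 w = 0" "cdot w 0 = 0"
  by (simp_all add: cdot_7)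

lemma cdot_commute: "cdot v w = cdot w v"
  by (simp add: cdot_7 algebra_simps)

lemma cdot_conj: "cdot (conj_vec v) (conj_vec w) = cnj (cdot v w)"
  by (simp add: cdot_7)

lemma cdot_conj_left: "cdot (conj_vec v) w = cnj (cdot v (conj_vec w))"
  by (simp add: cdot_7)

lemma conj_vec_simps [simp]:
  "conj_vec (conj_vec v) = v" "conj_vec 0 = 0" "conj_vec (cvec x) = cvec x"
  "conj_vec v = 0 \<longleftrightarrow> v = 0"
  by (auto simp: vec_eq_iff)

lemma conj_vec_add: "conj_vec (v + w) = conj_vec v + conj_vec w"
  and conj_vec_diff: "conj_vec (v - w) = conj_vec v - conj_vec w"
  and conj_vec_scale: "conj_vec (a *s v) = cnj a *s conj_vec v"
  by (simp_all add: vec_eq_iff)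

lemma herm_self: "herm v v = complex_of_real ((norm v)\<^sup>2)"
proof -
  have "(norm v)\<^sup>2 = (\<Sum>k\<in>UNIV. (norm (v $ k))\<^sup>2)"
    by (simp add: norm_vec_def L2_set_def sum_nonneg)
  then show ?thesis
    by (simp add: herm_def cdot_def complex_norm_square del: of_real_power)
qed

lemma herm_self_eq_0 [simp]: "herm v v = 0 \<longleftrightarrow> v = 0"
  by (simp add: herm_self)

lemma cdot_ccross_rotate: "cdot u (ccross v w) = cdot v (ccross w u)"
  by (simp add: cdot_7 ccross_nth algebra_simps)

lemma cdot_ccross_self [simp]: "cdot u (ccross u w) = 0" "cdot u (ccross w u) = 0"
  by (simp_all add: cdot_7 ccross_nth algebra_simps)

text \<open>Polarisation of \<open>ccross_ccross_same\<close>, hence the linearised alternative law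
  of the octonions. It takes the place of the triple product expansion known from three
  dimensions.\<close>

lemma ccross_ccross:
  "ccross u (ccross v w) =
     cdot u w *s v + cdot v w *s u - (2 * cdot u v) *s w - ccross v (ccross u w)"
  by (simp add: vec_eq_iff forall_7 ccross_nth cdot_7; simp add: algebra_simps)

lemma ccross_ccross_same: "ccross u (ccross u w) = cdot u w *s u - cdot u u *s w"
  by (simp add: vec_eq_iff forall_7 ccross_nth cdot_7; simp add: algebra_simps)

text \<open>With structure constants, smoothness and the product rule for vector products become
  statements on finite sums of products.\<close>

lemma ccross_expand: "\<exists>K. \<forall>u v k. ccross u v $ k = (\<Sum>i\<in>UNIV. u $ i * (\<Sum>j\<in>UNIV. K i j k * v $ j))"
proof (intro exI allI)
  fix u v k
  show "ccross u v $ k = (\<Sum>i\<in>UNIV. u $ i * (\<Sum>j\<in>UNIV. (\<lambda>i j k. ccross (axis i 1) (axis j 1) $ k) i j k * v $ j))"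
  proof -
  have 1: "ccross (\<Sum>i\<in>I. a i *s x i) w = (\<Sum>i\<in>I. a i *s ccross (x i) w)" if "finite I" for I :: "7 set" and a x w
    using that by (induction I rule: finite_induct) (simp_all add: ccross_add_left ccross_scale_left)
  have 2: "ccross w (\<Sum>i\<in>I. a i *s x i) = (\<Sum>i\<in>I. a i *s ccross w (x i))" if "finite I" for I :: "7 set" and a x w
    using that by (induction I rule: finite_induct) (simp_all add: ccross_add_right ccross_scale_right)
  have "ccross u v = ccross (\<Sum>i\<in>UNIV. u $ i *s axis i 1) (\<Sum>j\<in>UNIV. v $ j *s axis j 1)"
    by (simp add: basis_expansion)
  also have "\<dots> = (\<Sum>i\<in>UNIV. u $ i *s ccross (axis i 1) (\<Sum>j\<in>UNIV. v $ j *s axis j 1))"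
    by (rule 1) simp
  finally have "ccross u v = (\<Sum>i\<in>UNIV. u $ i *s (\<Sum>j\<in>UNIV. v $ j *s ccross (axis i 1) (axis j 1)))"
    by (simp add: 2)
  then show ?thesis by (simp add: mult.commute[of "v $ _"])
  qed
qed

lemma rcross_add_left: "rcross (u + v) w = rcross u w + rcross v w"
  and rcross_add_right: "rcross w (u + v) = rcross w u + rcross w v"
  and rcross_scale_left: "rcross (a *\<^sub>R u) w = a *\<^sub>R rcross u w"
  and rcross_scale_right: "rcross w (a *\<^sub>R u) = a *\<^sub>R rcross w u"
  by (simp_all add: vec_eq_iff forall_7 rcross_nth algebra_simps)

lemma rcross_self [simp]: "rcross w w = 0"
  by (simp add: vec_eq_iff forall_7 rcross_nth)

lemma rcross_commute: "rcross v w = - rcross w v"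
  by (simp add: vec_eq_iff forall_7 rcross_nth algebra_simps)

lemma inner_rcross_self [simp]: "u \<bullet> rcross u w = 0" "u \<bullet> rcross w u = 0"
  by (simp_all add: inner_vec_def sum_7 rcross_nth algebra_simps)

lemma rcross_rcross_same: "rcross u (rcross u w) = (u \<bullet> w) *\<^sub>R u - (u \<bullet> u) *\<^sub>R w"
  by (simp add: vec_eq_iff forall_7 rcross_nth inner_vec_def sum_7; simp add: algebra_simps)

lemma inner_rcross_rotate: "u \<bullet> rcross v w = v \<bullet> rcross w u"
  by (simp add: inner_vec_def sum_7 rcross_nth algebra_simps)

section \<open>Quaternion subalgebras and associative subspaces\<close>

definition octo :: "real \<Rightarrow> real^7 \<Rightarrow> octonion" where
  "octo r v = ((complex_of_real r, 0), 0) + oct_of_im v"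

lemma omul_octo:
  "omul (octo r v) (octo s w) = octo (r * s - v \<bullet> w) (r *\<^sub>R w + s *\<^sub>R v + rcross v w)"
  unfolding octo_def omul_def qmul_def qcnj_def oct_of_im_def
  by (simp add: rcross_nth inner_vec_def sum_7 complex_eq_iff; simp add: algebra_simps)

lemma oct_im_octo [simp]: "oct_im (octo r v) = v"
  by (simp add: octo_def oct_im_def oct_of_im_def vec_eq_iff forall_7)

lemma octo_eq_iff [simp]: "octo r v = octo s w \<longleftrightarrow> r = s \<and> v = w"
proof -
  have "Re (fst (fst (octo r v))) = r" for r v
    by (simp add: octo_def oct_of_im_def)
  then show ?thesis
    by (metis oct_im_octo)
qed

lemma octo_add: "octo r v + octo s w = octo (r + s) (v + w)"
  and octo_scale: "a *\<^sub>R octo r v = octo (a * r) (a *\<^sub>R v)"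
  by (simp_all add: octo_def oct_of_im_def complex_eq_iff algebra_simps prod_eq_iff)

lemma octo_zero: "octo 0 0 = 0"
  by (simp add: octo_def oct_of_im_def complex_eq_iff prod_eq_iff)

text \<open>\<open>X\<close>, \<open>Y\<close> and their product \<open>Z\<close> multiply like the
  quaternion units, so together with 1 they span a quaternion subalgebra; \<open>\<psi>\<close>
  matches them with the units in the order imposed by \<open>qmul\<close>.\<close>

lemma associative_span:
  assumes X: "X \<bullet> X = 1" and Y: "Y \<bullet> Y = 1" and XY: "X \<bullet> Y = 0"
  shows "associative_subspace (span {X, Y, rcross X Y})"
proof -
  define Z where "Z = rcross X Y"
  have XZ: "X \<bullet> Z = 0" "Y \<bullet> Z = 0"
    by (simp_all add: Z_def)
  have cXZ: "rcross X Z = - Y"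
    by (simp add: Z_def rcross_rcross_same X XY)
  have cYZ: "rcross Y Z = X"
    unfolding Z_def by (subst rcross_commute[of X Y])
      (simp add: rcross_scale_right[of _ "-1", simplified] rcross_rcross_same Y XY inner_commute)
  have ZZ: "Z \<bullet> Z = 1"
    using inner_rcross_rotate[of Z X Y] cYZ X by (simp add: Z_def)
  have indep: "independent {X, Y, Z}"
    using X Y ZZ XY XZ
    by (intro pairwise_orthogonal_independent)
      (auto simp: pairwise_def orthogonal_def inner_commute)
  have dist: "X \<noteq> Y" "X \<noteq> Z" "Y \<noteq> Z"
    using X Y ZZ XY XZ by (auto simp: inner_commute)
  have dim: "dim (span {X, Y, Z}) = 3"
    using dim_eq_card_independent[OF indep] dist by simp
  have YX: "Y \<bullet> X = 0" "Z \<bullet> X = 0" "Z \<bullet> Y = 0"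
    using XY XZ by (simp_all add: inner_commute)
  have cZX: "rcross X Y = Z" "rcross Y X = - Z" "rcross Z X = Y" "rcross Z Y = - X"
    using cXZ cYZ rcross_commute[of Z X] rcross_commute[of Z Y] rcross_commute[of Y X]
    by (simp_all add: Z_def)
  define \<psi> where "\<psi> = (\<lambda>x::quat. octo (Re (fst x))
      (Im (fst x) *\<^sub>R X + Re (snd x) *\<^sub>R Y + Im (snd x) *\<^sub>R Z))"
  define A where "A = {octo r v |r v. v \<in> span {X, Y, Z}}"
  have span: "v \<in> span {X, Y, Z} \<longleftrightarrow> (\<exists>a b c. v = a *\<^sub>R X + b *\<^sub>R Y + c *\<^sub>R Z)" for v
    by (auto simp: span_insert span_empty algebra_simps eq_diff_eq)
  have lin: "linear \<psi>"
    by (rule linearI) (simp_all add: \<psi>_def octo_add octo_scale algebra_simps)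
  have mult: "\<psi> (qmul x y) = omul (\<psi> x) (\<psi> y)" for x y
    by (simp add: \<psi>_def omul_octo qmul_def inner_simps X Y ZZ XY XZ YX rcross_add_left rcross_add_right
        rcross_scale_left rcross_scale_right cXZ cYZ cZX; simp add: algebra_simps)
  have inj: "inj \<psi>"
  proof (subst linear_injective_0[OF lin], intro allI impI)
    fix x assume "\<psi> x = 0"
    then have 0: "Re (fst x) = 0" "Im (fst x) *\<^sub>R X + Re (snd x) *\<^sub>R Y + Im (snd x) *\<^sub>R Z = 0"
      by (simp_all add: \<psi>_def flip: octo_zero)
    from arg_cong[OF 0(2), of "\<lambda>v. v \<bullet> X"] arg_cong[OF 0(2), of "\<lambda>v. v \<bullet> Y"]
      arg_cong[OF 0(2), of "\<lambda>v. v \<bullet> Z"]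
    show "x = 0"
      using 0(1) X Y ZZ XY XZ by (simp add: inner_simps inner_commute prod_eq_iff complex_eq_iff)
  qed
  have range: "range \<psi> = A"
  proof (intro set_eqI iffI)
    fix y assume "y \<in> range \<psi>"
    then show "y \<in> A" by (auto simp: A_def \<psi>_def span) blast
  next
    fix y assume "y \<in> A"
    then obtain r a b c where "y = octo r (a *\<^sub>R X + b *\<^sub>R Y + c *\<^sub>R Z)"
      by (auto simp: A_def span)
    then have "y = \<psi> (Complex r a, Complex b c)" by (simp add: \<psi>_def)
    then show "y \<in> range \<psi>" by blast
  qed
  have "subspace A"
    using linear_subspace_image[OF lin subspace_UNIV] range by simp
  moreover have "omul x y \<in> A" if "x \<in> A" "y \<in> A" for x y
    using that mult[symmetric] unfolding range[symmetric] by auto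
  moreover have "bij_betw \<psi> UNIV A"
    using inj range by (simp add: bij_betw_def)
  moreover have "span {X, Y, Z} = oct_im ` A"
    by (force simp: A_def image_iff)
  ultimately show ?thesis
    unfolding associative_subspace_def Z_def[symmetric]
    using dim lin mult by (intro conjI subspace_span exI[of _ A] exI[of _ \<psi>]) auto
qed

section \<open>Complexification of real subspaces\<close>

lemma vec_decompose: "v = cvec (re_vec v) + \<i> *s cvec (im_vec v)"
  by (simp add: vec_eq_iff re_vec_def im_vec_def complex_eq_iff)

lemma re_im_vec_linear [simp]:
  "re_vec (v + w) = re_vec v + re_vec w" "im_vec (v + w) = im_vec v + im_vec w"
  "re_vec (a *s v) = Re a *\<^sub>R re_vec v - Im a *\<^sub>R im_vec v"
  "im_vec (a *s v) = Re a *\<^sub>R im_vec v + Im a *\<^sub>R re_vec v"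
  "re_vec 0 = 0" "im_vec 0 = 0" "re_vec (cvec x) = x" "im_vec (cvec x) = 0"
  "re_vec (conj_vec v) = re_vec v" "im_vec (conj_vec v) = - im_vec v"
  by (simp_all add: vec_eq_iff re_vec_def im_vec_def)

lemma cvec_simps:
  "cvec (x + y) = cvec x + cvec y" "cvec (r *\<^sub>R x) = complex_of_real r *s cvec x"
  "cvec (- x) = - cvec x" "cvec 0 = 0"
  by (simp_all add: vec_eq_iff)

lemma cvec_inject [simp]: "cvec x = cvec y \<longleftrightarrow> x = y"
  by (simp add: vec_eq_iff)

lemma complexify_subspace:
  assumes "subspace W"
  shows "vec.subspace (complexify W)"
  using assms by (auto simp: vec.subspace_def complexify_def
      intro!: subspace_add subspace_diff subspace_scale subspace_0)

lemma complexify_span: "complexify (span S) = vec.span (cvec ` S)"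
proof
  have *: "cvec x \<in> vec.span (cvec ` S)" if "x \<in> span S" for x
    using that
  proof (induction rule: span_induct_alt)
    case base
    show ?case by (simp add: cvec_simps vec.span_zero)
  next
    case (step r x y)
    then show ?case
      unfolding cvec_simps by (intro vec.span_add vec.span_scale) (simp_all add: vec.span_base)
  qed
  show "complexify (span S) \<subseteq> vec.span (cvec ` S)"
  proof
    fix v assume "v \<in> complexify (span S)"
    then have "cvec (re_vec v) + \<i> *s cvec (im_vec v) \<in> vec.span (cvec ` S)"
      by (intro vec.span_add vec.span_scale *) (auto simp: complexify_def)
    then show "v \<in> vec.span (cvec ` S)"
      by (simp flip: vec_decompose)
  qed
  show "vec.span (cvec ` S) \<subseteq> complexify (span S)"
    by (intro vec.span_minimal complexify_subspace)
      (auto simp: complexify_def span_base span_zero)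
qed

text \<open>The real and imaginary parts of an eigenvector of \<open>x \<times> _\<close> are orthogonal, of the same length, and
  have cross product proportional to \<open>x\<close>.\<close>

lemma span_eigenvector_in_G2_SO4:
  assumes s: "s\<^sup>2 = 1" and e0: "e \<noteq> 0"
    and eig: "ccross (cvec x) e = (complex_of_real s * \<i>) *s e"
  shows "vec.span {conj_vec e, cvec x, e} \<in> G2_SO4"
proof -
  define a b where "a = re_vec e" and "b = im_vec e"
  have e: "e = cvec a + \<i> *s cvec b"
    unfolding a_def b_def by (rule vec_decompose)
  have ss: "s * s = 1" using s by (simp add: power2_eq_square)
  have "cvec (rcross x a) + \<i> *s cvec (rcross x b) = (complex_of_real s * \<i>) *s e"
    using eig unfolding e by (simp add: ccross_add_right ccross_scale_right ccross_cvec)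
  \<comment> \<open>Real and imaginary parts of the eigenvalue equation: \<open>rcross x\<close>
    acts on \<open>a\<close> and \<open>b\<close> as a quarter turn.\<close>
  from arg_cong[OF this, of re_vec] arg_cong[OF this, of im_vec]
  have xa: "rcross x a = (- s) *\<^sub>R b" and xb: "rcross x b = s *\<^sub>R a"
    by (simp_all add: a_def b_def)
  have s0: "s \<noteq> 0" using ss by auto
  have ax: "x \<bullet> a = 0" "x \<bullet> b = 0"
    using inner_rcross_self(1)[of x b] inner_rcross_self(1)[of x a] xa xb s0 by simp_all
  have ab: "a \<bullet> b = 0"
    using inner_rcross_self(2)[of a x] xa s0 by simp
  have bb: "b \<bullet> b = a \<bullet> a"
    using inner_rcross_rotate[of b a x] xa xb rcross_commute[of a x] s0 by simp
  have aa: "a \<bullet> a \<noteq> 0"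
    using e0 bb by (auto simp: e cvec_simps)
  have "rcross a b = (- s * (a \<bullet> a)) *\<^sub>R x"
  proof -
    have "(- s) *\<^sub>R rcross a b = rcross a (rcross x a)"
      by (simp only: xa rcross_scale_right)
    also have "\<dots> = - rcross a (rcross a x)"
      by (simp add: rcross_commute[of x a] rcross_scale_right[of _ "-1", simplified])
    also have "\<dots> = (a \<bullet> a) *\<^sub>R x"
      using ax by (simp add: rcross_rcross_same inner_commute)
    finally have "(- s) *\<^sub>R ((- s) *\<^sub>R rcross a b) = (- s * (a \<bullet> a)) *\<^sub>R x" by simp
    then show ?thesis
      using ss by (simp only: scaleR_scaleR minus_mult_minus scaleR_one)
  qed
  \<comment> \<open>\<open>b\<close> has the length of \<open>a\<close>, so one factor normalises
    both. The third vector of the orthonormal triple is then \<open>- s\<close> times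
    \<open>x\<close>.\<close>
  define r where "r = 1 / norm a"
  have r2: "r * r * (a \<bullet> a) = 1" and r0: "r \<noteq> 0"
    using aa by (simp_all add: r_def dot_square_norm power2_eq_square)
  have cr: "rcross (r *\<^sub>R a) (r *\<^sub>R b) = (- s) *\<^sub>R x"
  proof -
    have "r * (r * (s * (a \<bullet> a))) = s * (r * r * (a \<bullet> a))" by (simp only: ac_simps)
    then have "r * (r * (s * (a \<bullet> a))) = s" using r2 by simp
    then show ?thesis
      using \<open>rcross a b = _\<close> by (simp add: rcross_scale_left rcross_scale_right)
  qed
  have "associative_subspace (span {r *\<^sub>R a, r *\<^sub>R b, (- s) *\<^sub>R x})"
    using associative_span[of "r *\<^sub>R a" "r *\<^sub>R b"] r2 bb ab cr by simp
  then have "complexify (span {r *\<^sub>R a, r *\<^sub>R b, (- s) *\<^sub>R x}) \<in> G2_SO4"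
    by (auto simp: G2_SO4_def)
  moreover have "complexify (span {r *\<^sub>R a, r *\<^sub>R b, (- s) *\<^sub>R x}) = vec.span {conj_vec e, cvec x, e}"
  proof -
    have ce: "conj_vec e = cvec a - \<i> *s cvec b"
      by (simp add: vec_eq_iff e)
    have eqs: "cvec (r *\<^sub>R a) = (complex_of_real r / 2) *s (conj_vec e + e)"
      "cvec (r *\<^sub>R b) = (\<i> * complex_of_real r / 2) *s (conj_vec e - e)"
      "cvec ((- s) *\<^sub>R x) = complex_of_real (- s) *s cvec x"
    proof -
      have "conj_vec e + e = 2 *s cvec a" "conj_vec e - e = (- 2 * \<i>) *s cvec b"
        unfolding ce by (subst e, simp add: vec_eq_iff)+
      then show "cvec (r *\<^sub>R a) = (complex_of_real r / 2) *s (conj_vec e + e)"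
        "cvec (r *\<^sub>R b) = (\<i> * complex_of_real r / 2) *s (conj_vec e - e)"
        by (simp_all only: vector_smult_assoc, simp_all add: cvec_simps vec_eq_iff complex_eq_iff)
    qed (simp add: cvec_simps vec_eq_iff)
    have eqs': "cvec x = complex_of_real (- s) *s cvec ((- s) *\<^sub>R x)"
      "e = (1 / complex_of_real r) *s (cvec (r *\<^sub>R a) + \<i> *s cvec (r *\<^sub>R b))"
      "conj_vec e = (1 / complex_of_real r) *s (cvec (r *\<^sub>R a) - \<i> *s cvec (r *\<^sub>R b))"
      subgoal using arg_cong[OF ss, of complex_of_real] by (simp add: vector_smult_assoc cvec_simps)
      subgoal using r0 by (subst e) (simp add: vec_eq_iff field_simps)
      subgoal using r0 by (subst ce) (simp add: vec_eq_iff field_simps)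
      done
    let ?S = "cvec ` {r *\<^sub>R a, r *\<^sub>R b, (- s) *\<^sub>R x}"
    have "cvec (r *\<^sub>R a) \<in> vec.span {conj_vec e, cvec x, e}"
      "cvec (r *\<^sub>R b) \<in> vec.span {conj_vec e, cvec x, e}"
      "cvec ((- s) *\<^sub>R x) \<in> vec.span {conj_vec e, cvec x, e}"
      unfolding eqs by (intro vec.span_scale vec.span_add vec.span_diff vec.span_base; simp)+
    moreover have "(1 / complex_of_real r) *s (cvec (r *\<^sub>R a) + \<i> *s cvec (r *\<^sub>R b)) \<in> vec.span ?S"
      "(1 / complex_of_real r) *s (cvec (r *\<^sub>R a) - \<i> *s cvec (r *\<^sub>R b)) \<in> vec.span ?S"
      "complex_of_real (- s) *s cvec ((- s) *\<^sub>R x) \<in> vec.span ?S"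
      by (intro vec.span_scale vec.span_add vec.span_diff vec.span_base; simp)+
    then have "cvec x \<in> vec.span ?S" "e \<in> vec.span ?S" "conj_vec e \<in> vec.span ?S"
      by (simp_all only: eqs'[symmetric])
    ultimately show ?thesis
      unfolding complexify_span
      by (intro antisym vec.span_minimal vec.subspace_span) auto
  qed
  ultimately show ?thesis by simp
qed

section \<open>The \<open>G\<^sub>2\<close>-frame of an isotropic line\<close>

definition bryant_vec :: "complex^7 \<Rightarrow> complex^7" where
  "bryant_vec H = (\<i> / complex_of_real ((norm H)\<^sup>2)) *s ccross (conj_vec H) H"

lemma cdot_conj_self: "cdot v (conj_vec v) = complex_of_real ((norm v)\<^sup>2)"
  using herm_self[of v] by (simp add: herm_def)

lemma cdot_conj_self_eq_0 [simp]: "cdot v (conj_vec v) = 0 \<longleftrightarrow> v = 0" "cdot (conj_vec v) v = 0 \<longleftrightarrow> v = 0"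
  by (simp_all add: cdot_conj_self cdot_commute[of "conj_vec v"])

text \<open>For isotropic \<open>H\<close>, applying \<open>ccross H\<close> twice to
  \<open>v\<close> leaves \<open>cdot H v\<close> times \<open>H\<close>; in the linearised identity
  for \<open>v\<close>, \<open>w\<close>, \<open>H\<close> only a multiple of
  \<open>cdot v w\<close> times \<open>H\<close> survives. So the annihilator of \<open>H\<close> is
  isotropic.\<close>

lemma ccross_annihilator:
  assumes "H \<noteq> 0" "cdot H H = 0" "ccross H v = 0"
  shows ccross_annihilator_orth: "cdot H v = 0"
    and ccross_annihilator_isotropic: "ccross H w = 0 \<Longrightarrow> cdot v w = 0"
proof -
  have *: "cdot H v = 0" if "ccross H v = 0" for v
    using ccross_ccross_same[of H v] that assms by simp
  then show "cdot H v = 0" using assms by blast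
  assume w: "ccross H w = 0"
  show "cdot v w = 0"
    using ccross_ccross[of v w H] *[OF w] *[OF assms(3)] w assms
      ccross_commute[of w H] ccross_commute[of v H]
    by (simp add: cdot_commute)
qed

text \<open>\<open>H\<close> and \<open>E\<close> are going to span the lines of index \<open>-3\<close> and \<open>-2\<close> of the harmonic sequence. As its
  lines are weight spaces of a Cartan subalgebra of \<open>\<gg>\<^sub>2\<close>, vector products of these two
  and of their conjugates span the other ones.\<close>

locale g2_pair =
  fixes H E :: "complex^7"
  assumes H0: "H \<noteq> 0" and E0: "E \<noteq> 0" and H_isotropic: "cdot H H = 0" and HE: "ccross H E = 0"
    and EH: "cdot E (conj_vec H) = 0"
begin

definition G where "G = ccross H (conj_vec E)"
definition B where "B = bryant_vec H"

text \<open>On the annihilator of \<open>H\<close>, \<open>ccross B\<close> is \<open>- \<i>\<close>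
  times the reflection in the Hermitian complement of \<open>H\<close>: eigenvalue
  \<open>\<i>\<close> on \<open>H\<close> itself and \<open>- \<i>\<close> on annihilated vectors
  orthogonal to \<open>H\<close>.\<close>

lemma bryant_cross:
  assumes "ccross H v = 0"
  shows "ccross B v = - \<i> *s (v - (cdot v (conj_vec H) / cdot H (conj_vec H) * 2) *s H)"
proof -
  have "cdot H v = 0"
    using ccross_annihilator_orth[OF H0 H_isotropic assms] .
  then have "ccross v (ccross (conj_vec H) H)
      = cdot (conj_vec H) H *s v - (2 * cdot v (conj_vec H)) *s H"
    using ccross_ccross[of v "conj_vec H" H] assms ccross_commute[of v H]
    by (simp add: cdot_commute)
  then have "ccross (ccross (conj_vec H) H) v
      = (2 * cdot v (conj_vec H)) *s H - cdot (conj_vec H) H *s v"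
    by (simp add: ccross_commute[of _ v])
  then have eq: "ccross B v = (\<i> / cdot H (conj_vec H)) *s
      ((2 * cdot v (conj_vec H)) *s H - cdot H (conj_vec H) *s v)"
    by (simp add: B_def bryant_vec_def ccross_scale_left cdot_conj_self cdot_commute[of "conj_vec H"])
  have "cdot H (conj_vec H) \<noteq> 0"
    using H0 by simp
  then show ?thesis
    unfolding eq by (simp add: vec_eq_iff field_simps del: cdot_conj_self_eq_0)
qed

lemma B_real: "conj_vec B = B"
  by (simp add: B_def bryant_vec_def conj_vec_scale conj_vec_ccross ccross_commute[of H] vec_eq_iff)

lemma BH: "ccross B H = \<i> *s H"
  using bryant_cross[of H] H0 by (simp add: vec_eq_iff)

lemma BE: "ccross B E = - \<i> *s E"
  using bryant_cross[OF HE] EH by simp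

lemma B_dot:
  assumes "ccross B v = a *s v" "a \<noteq> 0"
  shows "cdot B v = 0"
  using cdot_ccross_self(1)[of B v] assms by (simp add: cdot_scale_right)

text \<open>\<open>ccross B\<close> squares to -1 on \<open>H\<close> by \<open>BH\<close>, and to
  \<open>- cdot B B\<close> by the double product formula.\<close>

lemma BB: "cdot B B = 1"
  using ccross_ccross_same[of B H] H0 B_dot[OF BH]
  by (auto simp: BH ccross_scale_right vec_eq_iff)

lemma HEc: "cdot H (conj_vec E) = 0"
  using EH cdot_conj_left[of E H] by (simp add: cdot_commute)

lemma HEdot: "cdot H E = 0"
  using ccross_annihilator_orth[OF H0 H_isotropic HE] .

lemma HG: "ccross H G = 0"
  by (simp add: G_def ccross_ccross_same H_isotropic HEc)

text \<open>Cyclic symmetry of the triple product turns this into a multiple of the pairing of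
  \<open>B\<close> with the conjugate of \<open>E\<close>, which vanishes because \<open>E\<close>
  is an eigenvector of \<open>ccross B\<close> and \<open>B\<close> is real.\<close>

lemma GH: "cdot G (conj_vec H) = 0"
proof -
  have "cdot (conj_vec E) B = 0"
    using B_dot[OF BE] B_real cdot_conj[of E B] by (simp add: cdot_commute)
  then have "cdot (conj_vec E) (ccross (conj_vec H) H) = 0"
    using H0 by (simp add: B_def bryant_vec_def cdot_scale_right)
  then show ?thesis
    unfolding G_def using cdot_ccross_rotate[of "conj_vec H" H "conj_vec E"]
      cdot_ccross_rotate[of H "conj_vec E" "conj_vec H"] by (simp add: cdot_commute)
qed

lemma GE: "cdot G (conj_vec E) = 0"
  unfolding G_def by (subst cdot_commute) simp

text \<open>Multiplication by the conjugate of \<open>H\<close> recovers \<open>E\<close> from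
  \<open>G\<close> up to conjugation and a non-zero factor; hence
  \<open>G \<noteq> 0\<close>.\<close>

lemma HcG: "ccross (conj_vec H) G = (- 2 * cdot H (conj_vec H)) *s conj_vec E"
  using ccross_ccross[of "conj_vec H" H "conj_vec E"] HEc HEdot HE cdot_conj[of H E] conj_vec_ccross[of H E]
  by (simp add: G_def cdot_commute)

lemma G0: "G \<noteq> 0"
proof
  assume "G = 0"
  with HcG H0 E0 show False by simp
qed

lemma BG: "ccross B G = - \<i> *s G"
  using bryant_cross[OF HG] GH by simp

text \<open>The value 0 beyond index 3 allows shifted indices without range conditions. Negating the
  index is complex conjugation, the middle vector being real.\<close>

definition frame :: "int \<Rightarrow> complex^7" where
  "frame j = (if j = -3 then H else if j = -2 then E else if j = -1 then G else if j = 0 then B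
     else if j = 1 then conj_vec G else if j = 2 then conj_vec E else if j = 3 then conj_vec H else 0)"

lemma index_cases:
  fixes j :: int
  shows "j = -3 \<or> j = -2 \<or> j = -1 \<or> j = 0 \<or> j = 1 \<or> j = 2 \<or> j = 3 \<or> \<bar>j\<bar> > 3"
  by arith

lemma conj_frame: "conj_vec (frame j) = frame (- j)"
  using index_cases[of j] by (auto simp: frame_def B_real)

lemma frame_eq_0_iff: "frame j = 0 \<longleftrightarrow> \<bar>j\<bar> > 3"
  using BB H0 E0 G0 index_cases[of j] by (auto simp: frame_def)

text \<open>The vectors of negative index are annihilated by \<open>H\<close>, which gives isotropy;
  they are eigenvectors of \<open>ccross B\<close> with non-zero eigenvalue, which gives
  orthogonality to \<open>B\<close>.\<close>

lemma frame_isotropic: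
  assumes "j < 0" "k \<le> 0" shows "cdot (frame j) (frame k) = 0"
proof -
  have "ccross H (frame j) = 0" "\<exists>a. a \<noteq> 0 \<and> ccross B (frame j) = a *s frame j" if "j < 0" for j
    using index_cases[of j] that HE HG BH BE BG
    by (auto simp: frame_def intro: exI[of _ \<i>] exI[of _ "-\<i>"])
  then show ?thesis
    using ccross_annihilator_isotropic[OF H0 H_isotropic, of "frame j" "frame k"] assms
      B_dot[of "frame j"] by (cases "k = 0") (auto simp: frame_def[of 0] cdot_commute)
qed

text \<open>Only the indices \<open>j\<close> and \<open>- j\<close> are paired by
  \<open>cdot\<close>; through \<open>conj_frame\<close> this is Hermitian orthogonality of the
  frame. Indices of equal sign reduce to isotropy, after conjugation if positive.\<close>

lemma frame_orth:
  assumes "j + k \<noteq> 0"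
  shows "cdot (frame j) (frame k) = 0"
proof -
  have *: "cdot (frame j) (frame k) = 0" if "j < 0" "k > 0" "j + k \<noteq> 0" for j k
    using index_cases[of j] index_cases[of k] that EH GH GE HEc cdot_conj_left[of G H]
      cdot_conj_left[of G E] by (auto simp: frame_def cdot_commute)
  show ?thesis
  proof (cases "j < 0"; cases "k < 0")
    assume "\<not> j < 0" "\<not> k < 0"
    then have "cnj (cdot (frame (-j)) (frame (-k))) = 0"
      using assms frame_isotropic[of "-j" "-k"] frame_isotropic[of "-k" "-j"]
      by (cases "j = 0") (auto simp: cdot_commute)
    then show ?thesis
      by (simp add: cdot_conj[symmetric] conj_frame)
  qed (use assms * [of j k] *[of k j] frame_isotropic[of j k] frame_isotropic[of k j] in
     \<open>cases "j = 0"; cases "k = 0"; auto simp: cdot_commute\<close>)+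
qed

lemma frame_self: "\<bar>j\<bar> \<le> 3 \<Longrightarrow> cdot (frame j) (frame (- j)) \<noteq> 0"
  using frame_eq_0_iff[of j] by (simp add: conj_frame[symmetric])

text \<open>This triple product is non-zero, which later makes the arrow from index -1 to index 0
  non-zero wherever the derivative of \<open>H\<close> is.\<close>

lemma E_cross_G: "cdot (conj_vec H) (ccross E G) = 2 * cdot H (conj_vec H) * cdot E (conj_vec E)"
  using cdot_ccross_rotate[of "conj_vec H" E G] cdot_ccross_rotate[of E G "conj_vec H"]
    HcG ccross_commute[of G "conj_vec H"]
  by (simp add: cdot_scale_right cdot_minus_right)

end

section \<open>Smooth functions and Wirtinger derivatives\<close>

lemma frechet_derivative_eqI: "(f has_derivative D) (at x) \<Longrightarrow> frechet_derivative f (at x) = D"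
  using frechet_derivative_at by metis

lemma Ck_on_SucD:
  assumes "Ck_on (Suc n) f U"
  shows "x \<in> U \<Longrightarrow> (f has_derivative frechet_derivative f (at x)) (at x)"
    and "Ck_on n (\<lambda>x. frechet_derivative f (at x) v) U"
  using assms by (auto simp: frechet_derivative_works[symmetric])

lemma Ck_on_cong:
  assumes "open U" "\<And>x. x \<in> U \<Longrightarrow> f x = g x" "Ck_on n f U"
  shows "Ck_on n g U"
  using assms
proof (induction n arbitrary: f g)
  case 0
  have "continuous_on U f" using 0(3) by simp
  then show ?case
    unfolding Ck_on.simps by (rule continuous_on_eq) (rule 0(2))
next
  case (Suc n)
  have D: "(g has_derivative frechet_derivative f (at x)) (at x)" if "x \<in> U" for x
    by (rule has_derivative_transform_within_open[OF Ck_on_SucD(1)[OF Suc.prems(3) that] Suc.prems(1) that])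
      (rule Suc.prems(2))
  moreover have "Ck_on n (\<lambda>x. frechet_derivative g (at x) v) U" for v
  proof (rule Suc.IH[OF Suc.prems(1) _ Ck_on_SucD(2)[OF Suc.prems(3)]])
    fix x assume "x \<in> U"
    then show "frechet_derivative f (at x) v = frechet_derivative g (at x) v"
      using frechet_derivative_eqI[OF D] by simp
  qed
  ultimately show ?case unfolding Ck_on.simps differentiable_def by blast
qed

lemma Ck_on_SucI:
  assumes "open U" "\<And>x. x \<in> U \<Longrightarrow> (f has_derivative D x) (at x)" "\<And>v. Ck_on n (\<lambda>x. D x v) U"
  shows "Ck_on (Suc n) f U"
  using assms(2) frechet_derivative_eqI[OF assms(2)] Ck_on_cong[OF assms(1) _ assms(3)]
  by (auto simp: differentiable_def)

lemma Ck_on_Suc_imp: "Ck_on (Suc n) f U \<Longrightarrow> Ck_on n f U"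
proof (induction n arbitrary: f)
  case 0
  then show ?case
    by (auto intro!: differentiable_imp_continuous_on differentiable_at_imp_differentiable_on)
next
  case (Suc n)
  then show ?case by simp
qed

lemma Ck_on_const: "Ck_on n (\<lambda>x. a) U"
  by (induction n arbitrary: a) auto

lemma Ck_on_add:
  assumes "open U" "Ck_on n f U" "Ck_on n g U"
  shows "Ck_on n (\<lambda>x. f x + g x) U"
  using assms(2,3)
proof (induction n arbitrary: f g)
  case 0
  then show ?case by (auto intro: continuous_on_add)
next
  case (Suc n)
  show ?case
    by (rule Ck_on_SucI[OF assms(1) has_derivative_add[OF Ck_on_SucD(1)[OF Suc.prems(1)] Ck_on_SucD(1)[OF Suc.prems(2)]]])
      (auto intro!: Suc.IH Ck_on_SucD(2) Suc.prems simp del: Ck_on.simps)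
qed

lemma Ck_on_sum:
  assumes "open U" "\<And>i. i \<in> I \<Longrightarrow> Ck_on n (f i) U"
  shows "Ck_on n (\<lambda>x. \<Sum>i\<in>I. f i x) U"
  using assms(2) by (induction I rule: infinite_finite_induct) (auto intro: Ck_on_const Ck_on_add assms(1))

lemma Ck_on_bounded_linear:
  assumes "bounded_linear L" "open U" "Ck_on n f U"
  shows "Ck_on n (\<lambda>x. L (f x)) U"
  using assms(3)
proof (induction n arbitrary: f)
  case 0
  then show ?case
    using bounded_linear.continuous_on[OF assms(1)] by auto
next
  case (Suc n)
  show ?case
    by (rule Ck_on_SucI[OF assms(2) bounded_linear.has_derivative[OF assms(1) Ck_on_SucD(1)[OF Suc.prems]]])
      (auto intro!: Suc.IH Ck_on_SucD(2) Suc.prems simp del: Ck_on.simps)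
qed

lemma Ck_on_mult:
  fixes f g :: "complex \<Rightarrow> 'a::real_normed_algebra"
  assumes "open U" "Ck_on n f U" "Ck_on n g U"
  shows "Ck_on n (\<lambda>x. f x * g x) U"
  using assms(2,3)
proof (induction n arbitrary: f g)
  case 0
  then show ?case by (auto intro: continuous_on_mult)
next
  case (Suc n)
  show ?case
    by (rule Ck_on_SucI[OF assms(1) has_derivative_mult[OF Ck_on_SucD(1)[OF Suc.prems(1)] Ck_on_SucD(1)[OF Suc.prems(2)]]];
        (assumption | intro Ck_on_add assms(1) Suc.IH Ck_on_SucD(2)[OF Suc.prems(1)] Ck_on_SucD(2)[OF Suc.prems(2)]
         Ck_on_Suc_imp[OF Suc.prems(1)] Ck_on_Suc_imp[OF Suc.prems(2)]))
qed

lemma Ck_on_inverse: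
  fixes f :: "complex \<Rightarrow> 'a::real_normed_div_algebra"
  assumes "open U" "Ck_on n f U" "\<And>x. x \<in> U \<Longrightarrow> f x \<noteq> 0"
  shows "Ck_on n (\<lambda>x. inverse (f x)) U"
  using assms(2)
proof (induction n)
  case 0
  then show ?case using assms(3) by (auto intro: continuous_on_inverse)
next
  case (Suc n)
  have "Ck_on n (\<lambda>x. inverse (f x)) U"
    using Suc Ck_on_Suc_imp by blast
  then have ck: "Ck_on n (\<lambda>x. - (inverse (f x) * frechet_derivative f (at x) v * inverse (f x))) U" for v
    by (intro Ck_on_bounded_linear[OF bounded_linear_minus[OF bounded_linear_ident]] Ck_on_mult assms(1)
        Ck_on_SucD(2)[OF Suc.prems])
  show ?case
    by (rule Ck_on_SucI[OF assms(1) Deriv.has_derivative_inverse[OF assms(3) Ck_on_SucD(1)[OF Suc.prems]]];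
        (assumption | rule ck))
qed

lemma Ck_on_vec:
  fixes f :: "complex \<Rightarrow> 'a::real_normed_vector^'n"
  assumes "open U"
  shows "Ck_on n f U \<longleftrightarrow> (\<forall>i. Ck_on n (\<lambda>x. f x $ i) U)"
proof safe
  fix i assume "Ck_on n f U"
  then show "Ck_on n (\<lambda>x. f x $ i) U"
    by (rule Ck_on_bounded_linear[OF bounded_linear_vec_nth assms])
next
  have bl: "bounded_linear (axis i :: 'a \<Rightarrow> 'a^'n)" for i
    by (rule bounded_linear_intro[where K = 1])
      (auto simp: vec_eq_iff axis_def norm_vec_def L2_set_def if_distrib[of norm]
         if_distrib[of "\<lambda>x. x\<^sup>2"] cong: if_cong)
  assume "\<forall>i. Ck_on n (\<lambda>x. f x $ i) U"
  then have "Ck_on n (\<lambda>x. \<Sum>i\<in>UNIV. axis i (f x $ i)) U"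
    by (intro Ck_on_sum assms Ck_on_bounded_linear[OF bl]) auto
  moreover have "(\<lambda>x. \<Sum>i\<in>UNIV. axis i (f x $ i)) = f"
    by (auto simp: fun_eq_iff vec_eq_iff axis_def)
  ultimately show "Ck_on n f U" by simp
qed

lemma Ck_on_holomorphic:
  assumes "open U" "f holomorphic_on U"
  shows "Ck_on n f U"
  using assms(2)
proof (induction n arbitrary: f)
  case 0
  then show ?case by (simp add: holomorphic_on_imp_continuous_on)
next
  case (Suc n)
  show ?case
  proof (rule Ck_on_SucI[OF assms(1)])
    show "(f has_derivative (*) (deriv f x)) (at x)" if "x \<in> U" for x
      using holomorphic_derivI[OF Suc.prems assms(1) that] by (simp add: has_field_derivative_def)
    show "Ck_on n (\<lambda>x. deriv f x * v) U" for v
      by (intro Suc.IH holomorphic_intros holomorphic_deriv Suc.prems assms(1))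
  qed
qed

lemma Ck_on_subset: "Ck_on n f U \<Longrightarrow> V \<subseteq> U \<Longrightarrow> Ck_on n f V"
  by (induction n arbitrary: f) (auto intro: continuous_on_subset)

section \<open>Symmetry of second derivatives\<close>

lemma has_real_derivative_line:
  fixes g :: "complex \<Rightarrow> real"
  assumes "g differentiable at (c + s *\<^sub>R v)"
  shows "((\<lambda>s. g (c + s *\<^sub>R v)) has_real_derivative frechet_derivative g (at (c + s *\<^sub>R v)) v) (at s)"
proof -
  let ?D = "frechet_derivative g (at (c + s *\<^sub>R v))"
  have g: "(g has_derivative ?D) (at (c + s *\<^sub>R v))"
    using assms frechet_derivative_works by blast
  have "((\<lambda>s. c + s *\<^sub>R v) has_derivative (\<lambda>h. h *\<^sub>R v)) (at s)"
    by (auto intro!: derivative_eq_intros)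
  from has_derivative_compose[OF this g]
  have "((\<lambda>s. g (c + s *\<^sub>R v)) has_derivative (\<lambda>h. ?D (h *\<^sub>R v))) (at s)" by simp
  moreover have "(\<lambda>h. ?D (h *\<^sub>R v)) = (*) (?D v)"
    using has_derivative_linear[OF g] by (auto simp: linear_scale)
  ultimately show ?thesis by (simp add: has_field_derivative_def)
qed

text \<open>Two applications of the mean value theorem: along \<open>v\<close> to the difference of
  \<open>g\<close> over two parallel segments, then along \<open>w\<close> to the derivative in
  direction \<open>v\<close>. The left-hand side is symmetric in \<open>v\<close> and
  \<open>w\<close>.\<close>

lemma mixed_difference:
  fixes g :: "complex \<Rightarrow> real"
  assumes g: "Ck_on 2 g U" and U: "ball x \<delta> \<subseteq> U" and t: "t > 0" "t * (norm v + norm w) < \<delta>"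
  shows "\<exists>y\<in>ball x \<delta>. g (x + t *\<^sub>R w + t *\<^sub>R v) - g (x + t *\<^sub>R v) - (g (x + t *\<^sub>R w) - g x) =
    t * t * frechet_derivative (\<lambda>y. frechet_derivative g (at y) v) (at y) w"
proof -
  have in_ball: "x + r *\<^sub>R w + s *\<^sub>R v \<in> ball x \<delta>" if "0 \<le> r" "r \<le> t" "0 \<le> s" "s \<le> t" for r s
  proof -
    have "norm (r *\<^sub>R w + s *\<^sub>R v) \<le> r * norm w + s * norm v"
      using that by (intro order.trans[OF norm_triangle_ineq]) simp
    also have "\<dots> \<le> t * norm w + t * norm v"
      using that by (intro add_mono mult_right_mono) auto
    finally show ?thesis
      using t by (simp add: dist_norm algebra_simps norm_minus_commute)
  qed
  let ?D = "\<lambda>y. frechet_derivative g (at y) v"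
  have g': "g differentiable at y" "?D differentiable at y" if "y \<in> ball x \<delta>" for y
    using g U that by (auto simp: numeral_2_eq_2)
  define \<phi> where "\<phi> s = g (x + t *\<^sub>R w + s *\<^sub>R v) - g (x + 0 *\<^sub>R w + s *\<^sub>R v)" for s
  have "\<exists>s. 0 < s \<and> s < t \<and> \<phi> t - \<phi> 0 =
      (t - 0) * (?D (x + t *\<^sub>R w + s *\<^sub>R v) - ?D (x + 0 *\<^sub>R w + s *\<^sub>R v))"
    unfolding \<phi>_def
    by (intro MVT2 DERIV_diff has_real_derivative_line g' in_ball t) (use t in auto)
  then obtain s where s: "0 < s" "s < t"
    "\<phi> t - \<phi> 0 = t * (?D (x + t *\<^sub>R w + s *\<^sub>R v) - ?D (x + 0 *\<^sub>R w + s *\<^sub>R v))" by auto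
  have "\<exists>r. 0 < r \<and> r < t \<and> ?D (x + s *\<^sub>R v + t *\<^sub>R w) - ?D (x + s *\<^sub>R v + 0 *\<^sub>R w) =
      (t - 0) * frechet_derivative ?D (at (x + s *\<^sub>R v + r *\<^sub>R w)) w"
  proof (intro MVT2 has_real_derivative_line g' t)
    fix r assume "0 \<le> r" "r \<le> t"
    then show "x + s *\<^sub>R v + r *\<^sub>R w \<in> ball x \<delta>"
      using in_ball[of r s] s by (simp add: algebra_simps)
  qed
  then obtain r where r: "0 < r" "r < t" "?D (x + s *\<^sub>R v + t *\<^sub>R w) - ?D (x + s *\<^sub>R v + 0 *\<^sub>R w) =
      t * frechet_derivative ?D (at (x + s *\<^sub>R v + r *\<^sub>R w)) w" by auto
  show ?thesis
  proof (rule bexI)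
    show "g (x + t *\<^sub>R w + t *\<^sub>R v) - g (x + t *\<^sub>R v) - (g (x + t *\<^sub>R w) - g x) =
        t * t * frechet_derivative ?D (at (x + r *\<^sub>R w + s *\<^sub>R v)) w"
      using s r by (simp add: \<phi>_def algebra_simps)
    show "x + r *\<^sub>R w + s *\<^sub>R v \<in> ball x \<delta>"
      using s r by (intro in_ball) auto
  qed
qed

text \<open>By \<open>mixed_difference\<close> the two iterated derivatives take a common value at
  two points arbitrarily close to \<open>x\<close>; continuity of both at \<open>x\<close> excludes
  a gap of \<open>2 * e\<close>.\<close>

lemma symmetric_second_derivative_real:
  fixes g :: "complex \<Rightarrow> real"
  assumes g: "Ck_on 2 g U" and U: "open U" "x \<in> U"
  shows "frechet_derivative (\<lambda>y. frechet_derivative g (at y) v) (at x) w =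
         frechet_derivative (\<lambda>y. frechet_derivative g (at y) w) (at x) v"
proof (rule ccontr)
  let ?a = "\<lambda>v w x. frechet_derivative (\<lambda>y. frechet_derivative g (at y) v) (at x) w"
  assume ne: "?a v w x \<noteq> ?a w v x"
  define e where "e = \<bar>?a v w x - ?a w v x\<bar> / 2"
  have e: "e > 0" using ne by (simp add: e_def)
  have cont: "isCont (?a v w) x" for v w
    using g U by (simp add: numeral_2_eq_2 continuous_on_eq_continuous_at)
  obtain d1 where d1: "d1 > 0" "\<And>y. dist y x < d1 \<Longrightarrow> dist (?a v w y) (?a v w x) < e"
    using cont[of v w] e unfolding continuous_at_eps_delta by metis
  obtain d2 where d2: "d2 > 0" "\<And>y. dist y x < d2 \<Longrightarrow> dist (?a w v y) (?a w v x) < e"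
    using cont[of w v] e unfolding continuous_at_eps_delta by metis
  obtain d3 where d3: "d3 > 0" "ball x d3 \<subseteq> U"
    using U openE by blast
  define d where "d = min d1 (min d2 d3)"
  have d: "d > 0" "ball x d \<subseteq> U"
    using d1 d2 d3 by (auto simp: d_def)
  \<comment> \<open>Small enough to keep the parallelogram inside the ball; the summand 1 keeps the
    denominator positive when \<open>v\<close> and \<open>w\<close> vanish.\<close>
  define t where "t = d / (norm v + norm w + 1)"
  have "norm v + norm w + 1 > 0"
    by (simp add: add_nonneg_pos)
  then have t: "t > 0" "t * (norm v + norm w) < d"
    unfolding t_def using d(1) by (auto simp: divide_simps)
  obtain y where y: "y \<in> ball x d"
    "g (x + t *\<^sub>R w + t *\<^sub>R v) - g (x + t *\<^sub>R v) - (g (x + t *\<^sub>R w) - g x) = t * t * ?a v w y"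
    using mixed_difference[OF g d(2) t] by blast
  obtain z where z: "z \<in> ball x d"
    "g (x + t *\<^sub>R v + t *\<^sub>R w) - g (x + t *\<^sub>R w) - (g (x + t *\<^sub>R v) - g x) = t * t * ?a w v z"
    using mixed_difference[OF g d(2), of t w v] t by (auto simp: add.commute)
  have "t * t * ?a v w y = t * t * ?a w v z"
    using y z by (simp add: algebra_simps)
  then have "?a v w y = ?a w v z"
    using t by simp
  moreover have "dist (?a v w y) (?a v w x) < e" "dist (?a w v z) (?a w v x) < e"
    using d1(2)[of y] d2(2)[of z] y z by (auto simp: d_def dist_commute)
  ultimately have "\<bar>?a v w x - ?a w v x\<bar> < 2 * e"
    by (simp add: dist_real_def)
  then show False by (simp add: e_def)
qed

lemma frechet_derivative_bounded_linear:
  assumes "bounded_linear L" "f differentiable at x"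
  shows "frechet_derivative (\<lambda>x. L (f x)) (at x) v = L (frechet_derivative f (at x) v)"
  using frechet_derivative_eqI[OF bounded_linear.has_derivative[OF assms(1)
        assms(2)[unfolded frechet_derivative_works]]] by simp

lemma differentiable_bounded_linear:
  assumes "bounded_linear L" "f differentiable F"
  shows "(\<lambda>x. L (f x)) differentiable F"
  using assms bounded_linear.has_derivative unfolding differentiable_def by blast

text \<open>The mean value theorem needs real values, so real and imaginary parts are treated
  separately.\<close>

lemma symmetric_second_derivative:
  fixes f :: "complex \<Rightarrow> complex"
  assumes f: "Ck_on 2 f U" and U: "open U" "x \<in> U"
  shows "frechet_derivative (\<lambda>y. frechet_derivative f (at y) v) (at x) w =
         frechet_derivative (\<lambda>y. frechet_derivative f (at y) w) (at x) v"
proof -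
  have f': "f differentiable at y" "(\<lambda>y. frechet_derivative f (at y) v) differentiable at y" if "y \<in> U" for y v
    using f that by (auto simp: numeral_2_eq_2)
  have *: "frechet_derivative (\<lambda>y. frechet_derivative (\<lambda>y. L (f y)) (at y) v) (at x) w =
      L (frechet_derivative (\<lambda>y. frechet_derivative f (at y) v) (at x) w)"
    if L: "bounded_linear L" for L :: "complex \<Rightarrow> real" and v w
  proof -
    have "frechet_derivative (\<lambda>y. L (frechet_derivative f (at y) v)) (at x) =
       frechet_derivative (\<lambda>y. frechet_derivative (\<lambda>y. L (f y)) (at y) v) (at x)"
      by (rule frechet_derivative_transform_within_open[OF differentiable_bounded_linear[OF L f'(2)[OF U(2)]] U])
        (simp add: frechet_derivative_bounded_linear[OF L f'(1)])
    then show ?thesis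
      using frechet_derivative_bounded_linear[OF L f'(2)[OF U(2)], of v w] by simp
  qed
  have "L (frechet_derivative (\<lambda>y. frechet_derivative f (at y) v) (at x) w) =
         L (frechet_derivative (\<lambda>y. frechet_derivative f (at y) w) (at x) v)"
    if L: "bounded_linear L" for L :: "complex \<Rightarrow> real"
    using symmetric_second_derivative_real[OF Ck_on_bounded_linear[OF L U(1) f] U] *[OF L] by metis
  from this[OF bounded_linear_Re] this[OF bounded_linear_Im] show ?thesis
    by (simp add: complex_eq_iff)
qed

text \<open>The parameter \<open>s\<close> is \<open>1\<close> for the holomorphic and \<open>-1\<close> for the antiholomorphic
  Wirtinger derivative; this also is the shift of the harmonic sequence.\<close>

definition wirt :: "int \<Rightarrow> (complex \<Rightarrow> complex) \<Rightarrow> complex \<Rightarrow> complex" where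
  "wirt s g x = (frechet_derivative g (at x) 1 - of_int s * (\<i> * frechet_derivative g (at x) \<i>)) / 2"

definition wd :: "int \<Rightarrow> 'm chart \<Rightarrow> ('m \<Rightarrow> complex) \<Rightarrow> 'm \<Rightarrow> complex" where
  "wd s c f p = wirt s (in_chart c f) (snd c p)"

definition wdv :: "int \<Rightarrow> 'm chart \<Rightarrow> ('m \<Rightarrow> complex^7) \<Rightarrow> 'm \<Rightarrow> complex^7" where
  "wdv s c v p = (\<chi> k. wd s c (\<lambda>q. v q $ k) p)"

definition wdm :: "int \<Rightarrow> 'm chart \<Rightarrow> ('m \<Rightarrow> complex^7^7) \<Rightarrow> 'm \<Rightarrow> complex^7^7" where
  "wdm s c T p = (\<chi> j. wdv s c (\<lambda>q. T q $ j) p)"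

definition diff_at :: "'m chart \<Rightarrow> ('m \<Rightarrow> complex) \<Rightarrow> 'm \<Rightarrow> bool" where
  "diff_at c f p \<longleftrightarrow> in_chart c f differentiable (at (snd c p))"

definition diffv_at :: "'m chart \<Rightarrow> ('m \<Rightarrow> complex^7) \<Rightarrow> 'm \<Rightarrow> bool" where
  "diffv_at c v p \<longleftrightarrow> (\<forall>k. diff_at c (\<lambda>q. v q $ k) p)"

definition diffm_at :: "'m chart \<Rightarrow> ('m \<Rightarrow> complex^7^7) \<Rightarrow> 'm \<Rightarrow> bool" where
  "diffm_at c T p \<longleftrightarrow> (\<forall>j. diffv_at c (\<lambda>q. T q $ j) p)"

lemma dz_wd: "dz c f p = wd 1 c f p"
  and dzbar_wd: "dzbar c f p = wd (-1) c f p"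
  by (simp_all add: dz_def dzbar_def wd_def wirt_def Let_def)

lemma dz_vec_wdv: "dz_vec c v p = wdv 1 c v p"
  and dzbar_vec_wdv: "dzbar_vec c v p = wdv (-1) c v p"
  by (simp_all add: dz_vec_def dzbar_vec_def wdv_def dz_wd dzbar_wd)

lemma dz_mat_wdm: "dz_mat c T = wdm 1 c T"
  and dzbar_mat_wdm: "dzbar_mat c T = wdm (-1) c T"
  by (simp_all add: fun_eq_iff dz_mat_def dzbar_mat_def wdm_def dz_vec_wdv dzbar_vec_wdv)

lemma in_chart_apply: "in_chart c f x = f (inv_into (fst c) (snd c) x)"
  by (simp add: in_chart_def)

lemma wd_eqI:
  "(in_chart c f has_derivative D) (at (snd c p)) \<Longrightarrow> wd s c f p = (D 1 - of_int s * (\<i> * D \<i>)) / 2"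
  by (simp add: wd_def wirt_def frechet_derivative_eqI)

lemma diff_atD: "diff_at c f p \<Longrightarrow> \<exists>D. (in_chart c f has_derivative D) (at (snd c p))"
  by (simp add: diff_at_def differentiable_def)

lemma diff_atI: "(in_chart c f has_derivative D) (at (snd c p)) \<Longrightarrow> diff_at c f p"
  by (auto simp: diff_at_def differentiable_def)

lemma diff_at_const: "diff_at c (\<lambda>q. a) p"
  and wd_const: "wd s c (\<lambda>q. a) p = 0"
proof -
  have "(in_chart c (\<lambda>q. a) has_derivative (\<lambda>h. 0)) (at (snd c p))"
    by (simp add: in_chart_def o_def)
  from diff_atI[OF this] wd_eqI[OF this]
  show "diff_at c (\<lambda>q. a) p" "wd s c (\<lambda>q. a) p = 0" by simp_all
qed

lemma
  assumes "diff_at c f p" "diff_at c g p"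
  shows diff_at_add: "diff_at c (\<lambda>q. f q + g q) p"
    and wd_add: "wd s c (\<lambda>q. f q + g q) p = wd s c f p + wd s c g p"
proof -
  obtain D where D1: "(in_chart c f has_derivative D) (at (snd c p))"
    using diff_atD[OF assms(1)] ..
  obtain D' where D2: "(in_chart c g has_derivative D') (at (snd c p))"
    using diff_atD[OF assms(2)] ..
  note D = D1 D2
  from has_derivative_add[OF D]
  have "(in_chart c (\<lambda>q. f q + g q) has_derivative (\<lambda>h. D h + D' h)) (at (snd c p))"
    by (simp add: in_chart_def o_def)
  from diff_atI[OF this] wd_eqI[OF this, where s = s]
  show "diff_at c (\<lambda>q. f q + g q) p" "wd s c (\<lambda>q. f q + g q) p = wd s c f p + wd s c g p"
    unfolding wd_eqI[OF D(1)] wd_eqI[OF D(2)] by (auto simp: algebra_simps add_divide_distrib diff_divide_distrib)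
qed

lemma
  assumes "diff_at c f p"
  shows diff_at_cnj: "diff_at c (\<lambda>q. cnj (f q)) p"
    and wd_cnj: "wd s c (\<lambda>q. cnj (f q)) p = cnj (wd (- s) c f p)"
proof -
  obtain D where D: "(in_chart c f has_derivative D) (at (snd c p))"
    using diff_atD[OF assms] ..
  from bounded_linear.has_derivative[OF bounded_linear_cnj this]
  have "(in_chart c (\<lambda>q. cnj (f q)) has_derivative (\<lambda>h. cnj (D h))) (at (snd c p))"
    by (simp add: in_chart_def o_def)
  from diff_atI[OF this] wd_eqI[OF this, where s = s]
  show "diff_at c (\<lambda>q. cnj (f q)) p" "wd s c (\<lambda>q. cnj (f q)) p = cnj (wd (- s) c f p)"
    unfolding wd_eqI[OF D] by simp_all
qed

lemma
  assumes "\<And>i. i \<in> I \<Longrightarrow> diff_at c (f i) p"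
  shows diff_at_sum: "diff_at c (\<lambda>q. \<Sum>i\<in>I. f i q) p"
    and wd_sum: "wd s c (\<lambda>q. \<Sum>i\<in>I. f i q) p = (\<Sum>i\<in>I. wd s c (f i) p)"
proof -
  have "diff_at c (\<lambda>q. \<Sum>i\<in>I. f i q) p \<and> wd s c (\<lambda>q. \<Sum>i\<in>I. f i q) p = (\<Sum>i\<in>I. wd s c (f i) p)"
    using assms
    by (induction I rule: infinite_finite_induct) (simp_all add: diff_at_const wd_const diff_at_add wd_add)
  then show "diff_at c (\<lambda>q. \<Sum>i\<in>I. f i q) p"
    "wd s c (\<lambda>q. \<Sum>i\<in>I. f i q) p = (\<Sum>i\<in>I. wd s c (f i) p)" by simp_all
qed

text \<open>Both orders combine the same four second derivatives and can differ only in the mixed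
  ones, which are symmetric.\<close>

lemma wirt_wirt:
  assumes "Ck_on 2 g V" "open V" "x \<in> V"
  shows "wirt t g differentiable at x"
    and "wirt s (wirt t g) x = wirt t (wirt s g) x"
proof -
  define F where "F y v = frechet_derivative g (at y) v" for y v
  define A where "A v = frechet_derivative (\<lambda>y. F y v) (at x)" for v
  have A: "((\<lambda>y. F y v) has_derivative A v) (at x)" for v
    using assms unfolding A_def F_def by (simp add: numeral_2_eq_2 frechet_derivative_works[symmetric])
  have D: "(wirt t g has_derivative (\<lambda>h. (A 1 h - of_int t * (\<i> * A \<i> h)) / 2)) (at x)" for t
    unfolding wirt_def[abs_def] F_def[symmetric]
    by (auto intro!: derivative_eq_intros A)
  then show "wirt t g differentiable at x"
    by (auto simp: differentiable_def)
  have "A \<i> 1 = A 1 \<i>"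
    unfolding A_def F_def by (rule symmetric_second_derivative[OF assms])
  then show "wirt s (wirt t g) x = wirt t (wirt s g) x"
    unfolding wirt_def[of s "wirt t g"] wirt_def[of t "wirt s g"] frechet_derivative_eqI[OF D]
    by (simp add: field_simps)
qed

section \<open>Smooth maps and Wirtinger derivatives on a Riemann surface\<close>

locale riemann =
  fixes \<A> :: "'m::t2_space chart set"
  assumes riemann: "riemann_surface \<A>"
begin

lemma chart_exists: "\<exists>c\<in>\<A>. p \<in> fst c"
  using riemann unfolding riemann_surface_def by blast

lemma chart_homeo:
  assumes "c \<in> \<A>"
  shows "homeomorphism (fst c) (snd c ` fst c) (snd c) (inv_into (fst c) (snd c))"
    and "open (fst c)" and "open (snd c ` fst c)"
  using riemann assms unfolding riemann_surface_def by blast+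

lemma inv_chart: "c \<in> \<A> \<Longrightarrow> p \<in> fst c \<Longrightarrow> inv_into (fst c) (snd c) (snd c p) = p"
  using chart_homeo by (auto simp: homeomorphism_def)

lemma in_chart_at: "c \<in> \<A> \<Longrightarrow> p \<in> fst c \<Longrightarrow> in_chart c f (snd c p) = f p"
  by (simp add: in_chart_apply inv_chart)

lemma open_chart_image:
  assumes "c \<in> \<A>" "open U"
  shows "open (snd c ` (U \<inter> fst c))"
proof -
  have "openin (top_of_set (snd c ` fst c)) (snd c ` (U \<inter> fst c))"
    using assms by (intro homeomorphism_imp_open_map[OF chart_homeo(1)]) (auto simp: openin_open)
  then show ?thesis
    using chart_homeo(3)[OF assms(1)] openin_open_trans by blast
qed

lemma open_chart_preimage:
  assumes "c \<in> \<A>" "open V"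
  shows "open {p \<in> fst c. snd c p \<in> V}"
proof -
  have "continuous_on (fst c) (snd c)"
    using chart_homeo(1)[OF assms(1)] unfolding homeomorphism_def by blast
  from continuous_open_preimage[OF this chart_homeo(2)[OF assms(1)] assms(2)]
  show ?thesis by (simp add: vimage_def Int_def)
qed

lemma no_isolated_points:
  fixes p :: 'm
  assumes "open U" "p \<in> U"
  shows "\<exists>q\<in>U. q \<noteq> p"
proof -
  obtain c where c: "c \<in> \<A>" "p \<in> fst c" using chart_exists by blast
  have "open (snd c ` (U \<inter> fst c))" "snd c p \<in> snd c ` (U \<inter> fst c)"
    using open_chart_image c assms by auto
  then have "\<exists>x\<in>snd c ` (U \<inter> fst c). x \<noteq> snd c p"
    by (metis islimpt_UNIV UNIV_I islimptE)
  then show ?thesis by auto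
qed

lemma smooth_mapI:
  "(\<And>c n. c \<in> \<A> \<Longrightarrow> Ck_on n (in_chart c f) (snd c ` (U \<inter> fst c))) \<Longrightarrow> smooth_map \<A> U f"
  by (simp add: smooth_map_def)

lemma smooth_mapD:
  "smooth_map \<A> U f \<Longrightarrow> c \<in> \<A> \<Longrightarrow> Ck_on n (in_chart c f) (snd c ` (U \<inter> fst c))"
  by (simp add: smooth_map_def)

lemma smooth_map_mono: "smooth_map \<A> U f \<Longrightarrow> V \<subseteq> U \<Longrightarrow> smooth_map \<A> V f"
  unfolding smooth_map_def by (meson Ck_on_subset Int_mono image_mono order_refl)

lemma smooth_map_cong:
  assumes "open U" "smooth_map \<A> U f" "\<And>p. p \<in> U \<Longrightarrow> f p = g p"
  shows "smooth_map \<A> U g"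
  unfolding smooth_map_def
proof safe
  fix c n assume c: "(c :: 'm chart) \<in> \<A>"
  show "Ck_on n (in_chart c g) (snd c ` (U \<inter> fst c))"
  proof (rule Ck_on_cong[OF open_chart_image[OF c assms(1)]])
    show "Ck_on n (in_chart c f) (snd c ` (U \<inter> fst c))"
      using assms(2) c by (simp add: smooth_map_def)
    show "in_chart c f x = in_chart c g x" if "x \<in> snd c ` (U \<inter> fst c)" for x
      using that c assms(3) by (auto simp: in_chart_apply inv_chart)
  qed
qed

lemma smooth_map_const: "smooth_map \<A> U (\<lambda>q. a)"
  by (simp add: smooth_map_def in_chart_def o_def Ck_on_const)

lemma smooth_map_add:
  "open U \<Longrightarrow> smooth_map \<A> U f \<Longrightarrow> smooth_map \<A> U g \<Longrightarrow> smooth_map \<A> U (\<lambda>q. f q + g q)"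
  by (rule smooth_mapI, unfold in_chart_def o_def, rule Ck_on_add[OF open_chart_image])
    (auto dest: smooth_mapD simp: in_chart_def o_def)

lemma smooth_map_bounded_linear:
  "bounded_linear L \<Longrightarrow> open U \<Longrightarrow> smooth_map \<A> U f \<Longrightarrow> smooth_map \<A> U (\<lambda>q. L (f q))"
  by (rule smooth_mapI, unfold in_chart_def o_def, rule Ck_on_bounded_linear[OF _ open_chart_image])
    (auto dest: smooth_mapD simp: in_chart_def o_def)

lemma smooth_map_cnj:
  "open U \<Longrightarrow> smooth_map \<A> U f \<Longrightarrow> smooth_map \<A> U (\<lambda>q. cnj (f q))"
  by (rule smooth_map_bounded_linear[OF bounded_linear_cnj])

lemma smooth_map_mult:
  fixes f g :: "'m \<Rightarrow> complex"
  shows "open U \<Longrightarrow> smooth_map \<A> U f \<Longrightarrow> smooth_map \<A> U g \<Longrightarrow> smooth_map \<A> U (\<lambda>q. f q * g q)"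
  by (rule smooth_mapI, unfold in_chart_def o_def, rule Ck_on_mult[OF open_chart_image])
    (auto dest: smooth_mapD simp: in_chart_def o_def)

lemma smooth_map_inverse:
  fixes f :: "'m \<Rightarrow> complex"
  assumes "open U" "smooth_map \<A> U f" "\<And>q. q \<in> U \<Longrightarrow> f q \<noteq> 0"
  shows "smooth_map \<A> U (\<lambda>q. inverse (f q))"
  unfolding smooth_map_def
proof safe
  fix c n assume c: "(c :: 'm chart) \<in> \<A>"
  have "Ck_on n (\<lambda>x. inverse (in_chart c f x)) (snd c ` (U \<inter> fst c))"
    using assms c by (intro Ck_on_inverse open_chart_image) (auto simp: smooth_map_def in_chart_at)
  then show "Ck_on n (in_chart c (\<lambda>q. inverse (f q))) (snd c ` (U \<inter> fst c))"
    by (simp add: in_chart_def o_def)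
qed

lemma smooth_map_divide:
  fixes f g :: "'m \<Rightarrow> complex"
  assumes "open U" "smooth_map \<A> U f" "smooth_map \<A> U g" "\<And>q. q \<in> U \<Longrightarrow> g q \<noteq> 0"
  shows "smooth_map \<A> U (\<lambda>q. f q / g q)"
  unfolding divide_inverse by (intro smooth_map_mult smooth_map_inverse assms)

lemma smooth_map_sum:
  "open U \<Longrightarrow> (\<And>i. i \<in> I \<Longrightarrow> smooth_map \<A> U (f i)) \<Longrightarrow> smooth_map \<A> U (\<lambda>q. \<Sum>i\<in>I. f i q)"
  by (induction I rule: infinite_finite_induct) (simp_all add: smooth_map_const smooth_map_add)

lemma smooth_map_vec:
  fixes f :: "'m \<Rightarrow> 'a::real_normed_vector^'n"
  assumes "open U"
  shows "smooth_map \<A> U f \<longleftrightarrow> (\<forall>i. smooth_map \<A> U (\<lambda>q. f q $ i))"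
  unfolding smooth_map_def using Ck_on_vec[OF open_chart_image[OF _ assms]]
  by (force simp: in_chart_def o_def)

lemma smooth_map_holomorphic:
  assumes "open U" "holomorphic_map \<A> U H"
  shows "smooth_map \<A> U H"
  unfolding smooth_map_vec[OF assms(1)] using assms
  by (auto simp: smooth_map_def holomorphic_map_def intro!: Ck_on_holomorphic open_chart_image)

lemma smooth_map_diff_at:
  assumes "smooth_map \<A> U f" "p \<in> U" "c \<in> \<A>" "p \<in> fst c"
  shows "diff_at c f p"
proof -
  have "Ck_on (Suc 0) (in_chart c f) (snd c ` (U \<inter> fst c))"
    by (rule smooth_mapD[OF assms(1,3)])
  then have "\<forall>x\<in>snd c ` (U \<inter> fst c). in_chart c f differentiable at x"
    unfolding Ck_on.simps by blast
  then show ?thesis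
    using assms(2,4) unfolding diff_at_def by blast
qed

lemma smooth_map_diffv_at:
  assumes "open U" "smooth_map \<A> U v" "p \<in> U" "c \<in> \<A>" "p \<in> fst c"
  shows "diffv_at c v p"
  using assms smooth_map_diff_at unfolding diffv_at_def smooth_map_vec[OF assms(1)] by blast

lemma smooth_map_diffm_at:
  assumes "open U" "smooth_map \<A> U T" "p \<in> U" "c \<in> \<A>" "p \<in> fst c"
  shows "diffm_at c T p"
  unfolding diffm_at_def
proof
  fix j
  have "smooth_map \<A> U (\<lambda>q. T q $ j)"
    using assms(2) smooth_map_vec[OF assms(1), of T] by blast
  then show "diffv_at c (\<lambda>q. T q $ j) p"
    by (rule smooth_map_diffv_at[OF assms(1) _ assms(3-5)])
qed

lemma
  assumes "c \<in> \<A>" "p \<in> fst c" "diff_at c f p" "diff_at c g p"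
  shows diff_at_mult: "diff_at c (\<lambda>q. f q * g q) p"
    and wd_mult: "wd s c (\<lambda>q. f q * g q) p = wd s c f p * g p + f p * wd s c g p"
proof -
  obtain D where D1: "(in_chart c f has_derivative D) (at (snd c p))"
    using diff_atD[OF assms(3)] ..
  obtain D' where D2: "(in_chart c g has_derivative D') (at (snd c p))"
    using diff_atD[OF assms(4)] ..
  note D = D1 D2
  from has_derivative_mult[OF D]
  have "(in_chart c (\<lambda>q. f q * g q) has_derivative (\<lambda>h. f p * D' h + D h * g p)) (at (snd c p))"
    unfolding in_chart_at[OF assms(1,2)] by (simp add: in_chart_def o_def)
  from diff_atI[OF this] wd_eqI[OF this, where s = s]
  show "diff_at c (\<lambda>q. f q * g q) p" "wd s c (\<lambda>q. f q * g q) p = wd s c f p * g p + f p * wd s c g p"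
    unfolding wd_eqI[OF D(1)] wd_eqI[OF D(2)] by (auto simp: algebra_simps add_divide_distrib diff_divide_distrib)
qed

lemma wd_local:
  assumes "c \<in> \<A>" "p \<in> fst c" "open U" "p \<in> U" "\<And>q. q \<in> U \<Longrightarrow> f q = g q"
  shows "wd s c f p = wd s c g p"
proof -
  let ?V = "snd c ` (U \<inter> fst c)"
  have V: "open ?V" "snd c p \<in> ?V"
    using open_chart_image assms by auto
  have eq: "in_chart c f x = in_chart c g x" if "x \<in> ?V" for x
    using that assms by (auto simp: in_chart_apply inv_chart)
  \<comment> \<open>Differentiability is not assumed: the two functions have the same derivatives
    \<open>D\<close>, so even the arbitrary value of \<open>frechet_derivative\<close> at a point of
    non-differentiability agrees.\<close>
  have "(in_chart c f has_derivative D) (at (snd c p)) \<longleftrightarrow> (in_chart c g has_derivative D) (at (snd c p))" for D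
    using has_derivative_transform_within_open[OF _ V, where f = "in_chart c f" and g = "in_chart c g" and f' = D]
      has_derivative_transform_within_open[OF _ V, where f = "in_chart c g" and g = "in_chart c f" and f' = D] eq by auto
  then show ?thesis
    by (simp add: wd_def wirt_def frechet_derivative_def)
qed

lemma
  assumes "c \<in> \<A>" "p \<in> fst c" "open U" "p \<in> U" "smooth_map \<A> U f"
  shows diff_at_wd: "diff_at c (wd t c f) p"
    and wd_wd: "wd s c (wd t c f) p = wd t c (wd s c f) p"
proof -
  let ?V = "snd c ` (U \<inter> fst c)"
  have V: "open ?V" "snd c p \<in> ?V"
    using open_chart_image assms by auto
  have C: "Ck_on 2 (in_chart c f) ?V"
    using assms by (simp add: smooth_map_def)
  have eq: "wirt t (in_chart c f) x = in_chart c (wd t c f) x" if "x \<in> ?V" for x t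
    using that assms by (auto simp: in_chart_apply inv_chart wd_def)
  have "(wirt t (in_chart c f) has_derivative D) (at (snd c p)) \<longleftrightarrow>
      (in_chart c (wd t c f) has_derivative D) (at (snd c p))" for D t
    using has_derivative_transform_within_open[OF _ V, where f = "wirt t (in_chart c f)" and g = "in_chart c (wd t c f)" and f' = D]
      has_derivative_transform_within_open[OF _ V, where f = "in_chart c (wd t c f)" and g = "wirt t (in_chart c f)" and f' = D] eq by auto
  then have "wirt s (wirt t (in_chart c f)) (snd c p) = wirt s (in_chart c (wd t c f)) (snd c p)"
    "wirt t (in_chart c f) differentiable at (snd c p) \<longleftrightarrow> diff_at c (wd t c f) p" for s t
    by (simp_all add: wirt_def frechet_derivative_def diff_at_def differentiable_def)
  then show "diff_at c (wd t c f) p" "wd s c (wd t c f) p = wd t c (wd s c f) p"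
    using wirt_wirt[OF C V] unfolding wd_def by auto
qed

text \<open>Continuity together with the absence of isolated points. All extensions over exceptional
  points rest on this: an identity is proved off \<open>p\<close> and then holds at
  \<open>p\<close>.\<close>

lemma smooth_map_eq_punctured:
  fixes f g :: "'m \<Rightarrow> 'b::real_normed_vector"
  assumes "open U" "p \<in> U" "smooth_map \<A> U f" "smooth_map \<A> U g"
    and eq: "\<And>q. q \<in> U \<Longrightarrow> q \<noteq> p \<Longrightarrow> f q = g q"
  shows "f p = g p"
proof -
  obtain c where c: "c \<in> \<A>" "p \<in> fst c" using chart_exists by blast
  let ?V = "snd c ` (U \<inter> fst c)"
  have V: "open ?V" "snd c p \<in> ?V"
    using open_chart_image assms c by auto
  have lim: "(in_chart c f \<longlongrightarrow> f p) (at (snd c p))" if "smooth_map \<A> U f" for f :: "'m \<Rightarrow> 'b"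
  proof -
    have "Ck_on 0 (in_chart c f) ?V"
      by (rule smooth_mapD[OF that c(1)])
    then have "isCont (in_chart c f) (snd c p)"
      using V continuous_on_eq_continuous_at by (metis Ck_on.simps(1))
    then show ?thesis
      using in_chart_at[OF c, of f] by (simp add: isCont_def)
  qed
  have "eventually (\<lambda>x. in_chart c f x = in_chart c g x) (at (snd c p))"
    unfolding eventually_at_topological
    using V eq c by (intro exI[of _ ?V]) (auto simp: in_chart_apply inv_chart)
  from Lim_transform_eventually[OF lim[OF assms(3)] this] lim[OF assms(4)]
  show ?thesis by (intro tendsto_unique[OF at_neq_bot])
qed

end

section \<open>Orthogonal projections\<close>

lemma mv_nth: "(A *v v) $ i = (\<Sum>k\<in>UNIV. A $ i $ k * v $ k)"
  by (simp add: matrix_vector_mult_def)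

lemma mv_scale: "A *v (a *s v) = a *s (A *v (v :: complex^7))"
  by (simp add: vec_eq_iff mv_nth sum_distrib_left algebra_simps)

lemma mv_minus: "A *v (- v) = - (A *v (v :: complex^7))"
  by (simp add: vec_eq_iff mv_nth sum_negf)

lemma mv_sum: "A *v (\<Sum>i\<in>I. f i) = (\<Sum>i\<in>I. A *v (f i :: complex^7))"
  by (induction I rule: infinite_finite_induct) (simp_all add: matrix_vector_right_distrib)

lemma sum_mv: "(\<Sum>i\<in>I. f i) *v v = (\<Sum>i\<in>I. f i *v (v :: complex^7))"
  by (induction I rule: infinite_finite_induct) (simp_all add: matrix_vector_mult_add_rdistrib)

lemma herm_add_left: "herm (u + v) w = herm u w + herm v w"
  and herm_diff_left: "herm (u - v) w = herm u w - herm v w"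
  and herm_add_right: "herm w (u + v) = herm w u + herm w v"
  and herm_scale_left: "herm (a *s u) w = a * herm u w"
  and herm_scale_right: "herm w (a *s u) = cnj a * herm w u"
  by (simp_all add: herm_def cdot_add_left cdot_add_right cdot_diff_left cdot_diff_right conj_vec_add
      conj_vec_diff cdot_scale_left cdot_scale_right conj_vec_scale)

lemma herm_zero [simp]: "herm 0 w = 0" "herm w 0 = 0"
  by (simp_all add: herm_def)

lemma herm_cnj: "herm w v = cnj (herm v w)"
  by (simp add: herm_def cdot_7 algebra_simps)

lemma herm_sum_left: "herm (\<Sum>i\<in>I. f i) w = (\<Sum>i\<in>I. herm (f i) w)"
  by (induction I rule: infinite_finite_induct) (simp_all add: herm_add_left)

lemma orthogonal_family:
  assumes "finite J" and e0: "\<And>j. j \<in> J \<Longrightarrow> e j \<noteq> 0"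
    and orth: "\<And>i j. i \<in> J \<Longrightarrow> j \<in> J \<Longrightarrow> i \<noteq> j \<Longrightarrow> herm (e i) (e j) = 0"
  shows orthogonal_family_inj: "inj_on e J" and orthogonal_family_independent: "vec.independent (e ` J)"
proof -
  show inj: "inj_on e J"
  proof (rule inj_onI, rule ccontr)
    fix i j assume ij: "i \<in> J" "j \<in> J" "e i = e j" "i \<noteq> j"
    then have "herm (e j) (e j) = 0" using orth[of i j] by simp
    then show False using e0 ij(2) by simp
  qed
  show "vec.independent (e ` J)"
  proof (rule vec.independent_if_scalars_zero)
    fix f x assume sum: "(\<Sum>x\<in>e ` J. f x *s x) = 0" and "x \<in> e ` J"
    then obtain k where k: "k \<in> J" "x = e k" by blast
    have "(\<Sum>j\<in>J. f (e j) *s e j) = 0"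
      using sum sum.reindex[OF inj, of "\<lambda>x. f x *s x"] by simp
    then have "(\<Sum>j\<in>J. f (e j) * herm (e j) (e k)) = 0"
      by (simp flip: herm_scale_left herm_sum_left)
    moreover have "(\<Sum>j\<in>J. f (e j) * herm (e j) (e k)) =
        (\<Sum>j\<in>J. if j = k then f (e k) * herm (e k) (e k) else 0)"
      using orth k(1) by (intro sum.cong) auto
    ultimately show "f x = 0" using e0[OF k(1)] k \<open>finite J\<close> by simp
  qed (use \<open>finite J\<close> in simp)
qed

lemma inner_herm: "x \<bullet> y = Re (herm x y)"
  by (simp add: inner_vec_def herm_def cdot_def inner_complex_def)

lemma scaleR_vec: "r *\<^sub>R v = complex_of_real r *s (v :: complex^7)"
  unfolding vec_eq_iff vector_scaleR_component vector_smult_component by (simp add: scaleR_conv_of_real)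

lemma oproj_unique:
  assumes "vec.subspace W" "u \<in> W" "v - u \<in> ocompl W"
  shows "oproj W v = u"
  unfolding oproj_def
proof (rule the_equality)
  fix u' assume u': "u' \<in> W \<and> v - u' \<in> ocompl W"
  have "u' - u \<in> W"
    using assms(1,2) u' by (simp add: vec.subspace_diff)
  then have "herm (v - u) (u' - u) = 0" "herm (v - u') (u' - u) = 0"
    using u' assms(3) by (simp_all add: ocompl_def)
  then have "herm (u' - u) (u' - u) = 0"
    by (simp add: herm_diff_left)
  then show "u' = u" by simp
qed (use assms in simp)

text \<open>The real orthogonal decomposition only controls the real part of \<open>herm\<close>;
  since \<open>W\<close> is a complex subspace, testing against \<open>\<i> *s w\<close> as well
  controls the imaginary part.\<close>

lemma oproj_exists:
  assumes W: "vec.subspace W"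
  shows "oproj W v \<in> W" "v - oproj W v \<in> ocompl W"
proof -
  have "subspace W"
    using W by (auto simp: subspace_def scaleR_vec vec.subspace_def)
  then have sp: "span W = W"
    by (simp add: span_eq_iff)
  obtain y z where y: "y \<in> span W" and z: "\<And>w. w \<in> span W \<Longrightarrow> orthogonal z w" and v: "v = y + z"
    using orthogonal_subspace_decomp_exists[of W v] by blast
  have "herm z w = 0" if "w \<in> W" for w
  proof -
    have "\<i> *s w \<in> W" using W that by (simp add: vec.subspace_scale)
    then have "Re (herm z w) = 0" "Re (herm z (\<i> *s w)) = 0"
      using z[of w] z[of "\<i> *s w"] that sp by (simp_all add: orthogonal_def inner_herm)
    then show ?thesis by (simp add: herm_scale_right complex_eq_iff)
  qed
  then have "v - y \<in> ocompl W"
    using v by (simp add: ocompl_def)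
  with oproj_unique[OF W _ this] y sp v \<open>v - y \<in> ocompl W\<close>
  show "oproj W v \<in> W" "v - oproj W v \<in> ocompl W" by simp_all
qed

lemma subspace_ocompl: "vec.subspace (ocompl W)"
  by (auto simp: vec.subspace_def ocompl_def herm_add_left herm_scale_left)

lemma projm_works:
  assumes W: "vec.subspace W"
  shows "projm W *v v = oproj W v"
proof -
  have "Vector_Spaces.linear (*s) (*s) (oproj W)"
  proof (unfold_locales, goal_cases)
    case (1 b1 b2)
    show ?case
      using oproj_exists[OF W, of b1] oproj_exists[OF W, of b2] subspace_ocompl[of W]
        vec.subspace_add[of "ocompl W" "b1 - oproj W b1" "b2 - oproj W b2"]
      by (intro oproj_unique[OF W]) (simp_all add: vec.subspace_add[OF W] algebra_simps)
  next
    case (2 r b)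
    show ?case
      using oproj_exists[OF W, of b] subspace_ocompl[of W]
        vec.subspace_scale[of "ocompl W" "b - oproj W b" r]
      by (intro oproj_unique[OF W]) (simp_all add: vec.subspace_scale[OF W] vector_ssub_ldistrib)
  qed
  then show ?thesis
    unfolding projm_def by (rule matrix_works)
qed

lemma oproj_mem: "vec.subspace W \<Longrightarrow> v \<in> W \<Longrightarrow> oproj W v = v"
  by (rule oproj_unique) (simp_all add: ocompl_def)

lemma mem_iff_projm: "vec.subspace W \<Longrightarrow> v \<in> W \<longleftrightarrow> projm W *v v = v"
  using oproj_mem[of W v] oproj_exists(1)[of W v] by (auto simp: projm_works)

lemma projm_inject: "vec.subspace W \<Longrightarrow> vec.subspace W' \<Longrightarrow> projm W = projm W' \<Longrightarrow> W = W'"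
  using mem_iff_projm by (metis subsetI subset_antisym)

lemma projm_idem:
  assumes "vec.subspace W" shows "projm W ** projm W = projm W"
proof -
  have "(projm W ** projm W) *v v = projm W *v v" for v
    unfolding matrix_vector_mul_assoc[symmetric] projm_works[OF assms]
    by (rule oproj_mem[OF assms oproj_exists(1)[OF assms]])
  then show ?thesis by (simp add: matrix_eq)
qed

section \<open>Product rules for vector and matrix valued maps\<close>

context riemann
begin

lemma wdm_nth: "wdm s c T p $ i $ j = wd s c (\<lambda>q. T q $ i $ j) p"
  by (simp add: wdm_def wdv_def)

lemma diffm_at_nth: "diffm_at c T p \<Longrightarrow> diff_at c (\<lambda>q. T q $ i $ j) p"
  by (simp add: diffm_at_def diffv_at_def)

lemma diffv_at_nth: "diffv_at c T p \<Longrightarrow> diff_at c (\<lambda>q. T q $ i) p"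
  by (simp add: diffv_at_def)

context
  fixes c p
  assumes c: "c \<in> \<A>" "p \<in> fst c"
begin

lemma
  assumes "\<And>i. i \<in> I \<Longrightarrow> diff_at c (f i) p" "\<And>i. i \<in> I \<Longrightarrow> diff_at c (g i) p"
  shows diff_at_sum_mult: "diff_at c (\<lambda>q. \<Sum>i\<in>I. f i q * g i q) p"
    and wd_sum_mult: "wd s c (\<lambda>q. \<Sum>i\<in>I. f i q * g i q) p =
      (\<Sum>i\<in>I. wd s c (f i) p * g i p) + (\<Sum>i\<in>I. f i p * wd s c (g i) p)"
proof -
  have d: "diff_at c (\<lambda>q. f i q * g i q) p" if "i \<in> I" for i
    using assms that by (intro diff_at_mult[OF c])
  from diff_at_sum[where I = I and f = "\<lambda>i q. f i q * g i q", OF d]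
  show "diff_at c (\<lambda>q. \<Sum>i\<in>I. f i q * g i q) p" .
  have "wd s c (\<lambda>q. \<Sum>i\<in>I. f i q * g i q) p = (\<Sum>i\<in>I. wd s c (\<lambda>q. f i q * g i q) p)"
    by (rule wd_sum[OF d])
  also have "\<dots> = (\<Sum>i\<in>I. wd s c (f i) p * g i p + f i p * wd s c (g i) p)"
    using assms by (intro sum.cong refl wd_mult[OF c])
  finally show "wd s c (\<lambda>q. \<Sum>i\<in>I. f i q * g i q) p =
      (\<Sum>i\<in>I. wd s c (f i) p * g i p) + (\<Sum>i\<in>I. f i p * wd s c (g i) p)"
    by (simp add: sum.distrib)
qed

lemma
  assumes "diffm_at c T p" "diffm_at c R p"
  shows diffm_at_mult: "diffm_at c (\<lambda>q. T q ** R q) p"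
    and wdm_mult: "wdm s c (\<lambda>q. T q ** R q) p = wdm s c T p ** R p + T p ** wdm s c R p"
  using diff_at_sum_mult[of UNIV "\<lambda>k q. T q $ _ $ k" "\<lambda>k q. R q $ k $ _"]
    wd_sum_mult[of UNIV "\<lambda>k q. T q $ _ $ k" "\<lambda>k q. R q $ k $ _"] assms[THEN diffm_at_nth]
  by (simp_all add: diffm_at_def diffv_at_def vec_eq_iff wdm_nth matrix_matrix_mult_def)

lemma wdv_mv:
  assumes "diffm_at c T p" "diffv_at c v p"
  shows "wdv s c (\<lambda>q. T q *v v q) p = wdm s c T p *v v p + T p *v wdv s c v p"
  using wd_sum_mult[of UNIV "\<lambda>k q. T q $ _ $ k" "\<lambda>k q. v q $ k"] diffm_at_nth[OF assms(1)] diffv_at_nth[OF assms(2)]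
  by (simp_all add: diffv_at_def vec_eq_iff wdm_nth wdv_def matrix_vector_mult_def)

lemma wd_cdot:
  assumes "diffv_at c u p" "diffv_at c v p"
  shows "wd s c (\<lambda>q. cdot (u q) (v q)) p = cdot (wdv s c u p) (v p) + cdot (u p) (wdv s c v p)"
  using wd_sum_mult[of UNIV "\<lambda>k q. u q $ k" "\<lambda>k q. v q $ k"] assms[THEN diffv_at_nth]
  by (simp_all add: wdv_def cdot_def)

lemma
  assumes "diff_at c a p" "diffv_at c v p"
  shows diffv_at_scale: "diffv_at c (\<lambda>q. a q *s v q) p"
    and wdv_scale: "wdv s c (\<lambda>q. a q *s v q) p = wd s c a p *s v p + a p *s wdv s c v p"
  using diff_at_mult[OF c assms(1)] wd_mult[OF c assms(1)] diffv_at_nth[OF assms(2)]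
  by (simp_all add: diffv_at_def vec_eq_iff wdv_def)

lemma wdv_add:
  assumes "diffv_at c u p" "diffv_at c v p"
  shows "wdv s c (\<lambda>q. u q + v q) p = wdv s c u p + wdv s c v p"
  using assms[THEN diffv_at_nth]
  by (simp_all add: diffv_at_def vec_eq_iff wdv_def diff_at_add wd_add)

lemma diffv_at_const: "diffv_at c (\<lambda>q. a) p"
  and wdv_const: "wdv s c (\<lambda>q. a) p = 0"
  by (simp_all add: diffv_at_def diff_at_const wdv_def wd_const vec_eq_iff)

lemma wdv_conj:
  assumes "diffv_at c v p"
  shows "wdv s c (\<lambda>q. conj_vec (v q)) p = conj_vec (wdv (- s) c v p)"
  using diffv_at_nth[OF assms]
  by (simp_all add: diffv_at_def vec_eq_iff wdv_def diff_at_cnj wd_cnj)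

lemma wdv_ccross:
  assumes "diffv_at c u p" "diffv_at c v p"
  shows "wdv s c (\<lambda>q. ccross (u q) (v q)) p = ccross (wdv s c u p) (v p) + ccross (u p) (wdv s c v p)"
proof -
  obtain K where K: "\<And>u v k. ccross u v $ k = (\<Sum>i\<in>UNIV. u $ i * (\<Sum>j\<in>UNIV. K i j k * v $ j))"
    using ccross_expand by blast
  have d1: "diff_at c (\<lambda>q. \<Sum>j\<in>UNIV. K i j k * v q $ j) p" for i k
    by (intro diff_at_sum_mult diff_at_const diffv_at_nth[OF assms(2)])
  have d2: "wd s c (\<lambda>q. \<Sum>j\<in>UNIV. K i j k * v q $ j) p = (\<Sum>j\<in>UNIV. K i j k * wdv s c v p $ j)" for i k
    by (subst wd_sum_mult) (simp_all add: diff_at_const wd_const wdv_def diffv_at_nth[OF assms(2)])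
  have e2: "wd s c (\<lambda>q. ccross (u q) (v q) $ k) p = (ccross (wdv s c u p) (v p) + ccross (u p) (wdv s c v p)) $ k" for k
    unfolding vector_add_component K
    by (subst wd_sum_mult) (simp_all add: d1 d2 diffv_at_nth[OF assms(1)] wdv_def)
  show "wdv s c (\<lambda>q. ccross (u q) (v q)) p = ccross (wdv s c u p) (v p) + ccross (u p) (wdv s c v p)"
    using e2 by (simp add: vec_eq_iff wdv_def)
qed

lemma wdm_sum:
  assumes "\<And>i. i \<in> I \<Longrightarrow> diffm_at c (T i) p"
  shows "wdm s c (\<lambda>q. \<Sum>i\<in>I. T i q) p = (\<Sum>i\<in>I. wdm s c (T i) p)"
  using diffm_at_nth[OF assms]
  by (simp_all add: diffm_at_def diffv_at_def vec_eq_iff wdm_nth diff_at_sum wd_sum)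

lemma wdm_const: "wdm s c (\<lambda>q. a) p = 0"
  by (simp add: vec_eq_iff wdm_nth wd_const)

lemma wdm_local:
  assumes "open U" "p \<in> U" "\<And>q. q \<in> U \<Longrightarrow> T q = R q"
  shows "wdm s c T p = wdm s c R p"
  unfolding vec_eq_iff wdm_nth by (intro allI wd_local[OF c assms(1,2)]) (simp add: assms(3))

lemma wdv_local:
  assumes "open U" "p \<in> U" "\<And>q. q \<in> U \<Longrightarrow> u q = v q"
  shows "wdv s c u p = wdv s c v p"
  unfolding vec_eq_iff wdv_def vec_lambda_beta
  by (intro allI wd_local[OF c assms(1,2)]) (simp add: assms(3))

lemma
  assumes "open U" "p \<in> U" "smooth_map \<A> U T"
  shows diffm_at_wdm: "diffm_at c (wdm t c T) p"
    and wdm_wdm: "wdm s c (wdm t c T) p = wdm t c (wdm s c T) p"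
proof -
  have "smooth_map \<A> U (\<lambda>q. T q $ i $ j)" for i j
    using assms(3) unfolding smooth_map_vec[OF assms(1)] by blast
  from diff_at_wd[OF c assms(1,2) this] wd_wd[OF c assms(1,2) this]
  show "diffm_at c (wdm t c T) p" "wdm s c (wdm t c T) p = wdm t c (wdm s c T) p"
    unfolding diffm_at_def diffv_at_def vec_eq_iff wdm_nth by blast+
qed

end

end

section \<open>Harmonic sequences as gradings\<close>

definition ix :: "int set" where "ix = {-3..3}"

lemma finite_ix [simp]: "finite ix" by (simp add: ix_def)

text \<open>The cases \<open>s = 1\<close> and \<open>s = -1\<close> are \<open>A1_image\<close> and
  \<open>A2_image\<close>, so both Gauss bundles can be handled by one argument.\<close>

definition deriv_image ::
  "int \<Rightarrow> 'm::topological_space chart set \<Rightarrow> ('m \<Rightarrow> (complex^7) set) \<Rightarrow> 'm \<Rightarrow> (complex^7) set" where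
  "deriv_image s \<A> \<phi> p =
     {oproj (ocompl (\<phi> p)) (wdv s c v p) | c v. c \<in> \<A> \<and> p \<in> fst c \<and>
        (\<exists>U. open U \<and> p \<in> U \<and> smooth_map \<A> U v \<and> local_section \<phi> U v)}"

definition gauss ::
  "int \<Rightarrow> 'm::topological_space chart set \<Rightarrow> ('m \<Rightarrow> (complex^7) set) \<Rightarrow> 'm \<Rightarrow> (complex^7) set" where
  "gauss s \<A> \<phi> =
     (THE \<psi>. subbundle \<A> \<psi> \<and> (\<forall>p. \<not> p islimpt {q. deriv_image s \<A> \<phi> q \<noteq> \<psi> q}))"

lemma gauss1_eq: "gauss1 = gauss 1" and gauss2_eq: "gauss2 = gauss (-1)"
  by (simp_all add: fun_eq_iff gauss1_def gauss2_def gauss_def A1_image_def A2_image_def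
      deriv_image_def A1_def A2_def dz_vec_wdv dzbar_vec_wdv)

text \<open>Abstracts seven orthogonal lines with their projections; octonions no longer appear.
  \<open>P_degree\<close> is the only assumption on derivatives: in direction \<open>s\<close> every
  projection moves the line \<open>l\<close> into the line \<open>l + s\<close> alone.\<close>

locale graded = riemann \<A> for \<A> :: "'m::t2_space chart set" +
  fixes P :: "int \<Rightarrow> 'm \<Rightarrow> complex^7^7"
  assumes smooth_P: "smooth_map \<A> UNIV (P j)"
    and herm_P: "herm (P j p *v v) w = herm v (P j p *v w)"
    and P_orth: "P j p *v (P k p *v v) = (if j = k then P j p *v v else 0)"
    and P_outside: "j \<notin> ix \<Longrightarrow> P j p = 0"
    and P_complete: "(\<Sum>k\<in>ix. P k p *v v) = v"
    and P_line: "j \<in> ix \<Longrightarrow> \<exists>e. e \<noteq> 0 \<and> P j p *v e = e \<and> (\<forall>v. \<exists>a. P j p *v v = a *s e)"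
    and P_degree: "c \<in> \<A> \<Longrightarrow> p \<in> fst c \<Longrightarrow> s \<in> {1, -1} \<Longrightarrow> k \<noteq> l + s \<Longrightarrow>
        P k p *v (wdm s c (P j) p *v (P l p *v v)) = 0"
begin

definition PS :: "int set \<Rightarrow> 'm \<Rightarrow> complex^7^7" where
  "PS S p = (\<Sum>j\<in>S \<inter> ix. P j p)"

text \<open>Only \<open>S \<inter> ix\<close> matters, so complements of index sets can be taken in
  all integers.\<close>

definition sub :: "int set \<Rightarrow> 'm \<Rightarrow> (complex^7) set" where
  "sub S p = {v. \<forall>k\<in>ix. k \<notin> S \<longrightarrow> P k p *v v = 0}"

lemma P_eqI:
  assumes "\<And>k. k \<in> ix \<Longrightarrow> P k p *v v = P k p *v w"
  shows "v = w"
proof -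
  have "v = (\<Sum>k\<in>ix. P k p *v v)" by (rule P_complete[symmetric])
  also have "\<dots> = (\<Sum>k\<in>ix. P k p *v w)" by (intro sum.cong refl assms)
  also have "\<dots> = w" by (rule P_complete)
  finally show ?thesis .
qed

lemma PS_mv: "PS S p *v v = (\<Sum>j\<in>S \<inter> ix. P j p *v v)"
  by (simp add: PS_def sum_mv)

lemma P_PS: "P k p *v (PS S p *v v) = (if k \<in> S then P k p *v v else 0)"
proof -
  have "P k p *v (PS S p *v v) = (\<Sum>j\<in>S \<inter> ix. if k = j then P k p *v v else 0)"
    by (simp add: PS_mv mv_sum P_orth)
  also have "\<dots> = (if k \<in> S \<inter> ix then P k p *v v else 0)"
    by simp
  finally show ?thesis using P_outside[of k p] by auto
qed

lemma PS_P: "PS S p *v (P k p *v v) = (if k \<in> S then P k p *v v else 0)"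
proof -
  have "PS S p *v (P k p *v v) = (\<Sum>j\<in>S \<inter> ix. if k = j then P k p *v v else 0)"
    unfolding PS_mv by (rule sum.cong) (auto simp: P_orth)
  also have "\<dots> = (if k \<in> S \<inter> ix then P k p *v v else 0)"
    by simp
  finally show ?thesis using P_outside[of k p] by auto
qed

lemma PS_PS: "PS S p *v (PS T p *v v) = PS (S \<inter> T) p *v v"
  by (rule P_eqI[where p = p]) (simp add: P_PS)

lemma PS_compl: "PS (- S) p *v v = v - PS S p *v v"
  by (rule P_eqI[where p = p]) (simp add: P_PS matrix_vector_mult_diff_distrib)

lemma PS_UNIV: "PS UNIV p *v v = v"
  by (rule P_eqI[where p = p]) (simp add: P_PS)

lemma PS_empty: "S \<inter> ix = {} \<Longrightarrow> PS S p = 0"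
  by (simp add: PS_def)

lemma mem_sub: "v \<in> sub S p \<longleftrightarrow> PS S p *v v = v"
proof
  assume v: "v \<in> sub S p"
  show "PS S p *v v = v"
    by (rule P_eqI[where p = p]) (use v in \<open>auto simp: P_PS sub_def\<close>)
next
  assume "PS S p *v v = v"
  then have "P k p *v v = 0" if "k \<notin> S" for k
    using P_PS[of k p S v] that by simp
  then show "v \<in> sub S p" unfolding sub_def by blast
qed

lemma PS_mem: "PS S p *v v \<in> sub S p"
  by (simp add: mem_sub PS_PS)

lemma subspace_sub: "vec.subspace (sub S p)"
  by (auto simp: vec.subspace_def sub_def matrix_vector_right_distrib mv_scale)

lemma herm_PS: "herm (PS S p *v v) w = herm v (PS S p *v w)"
proof -
  have "herm (\<Sum>j\<in>J. P j p *v v) w = herm v (\<Sum>j\<in>J. P j p *v w)" if "finite J" for J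
    using that by (induction J rule: finite_induct) (simp_all add: herm_add_left herm_add_right herm_P)
  then show ?thesis by (simp add: PS_mv)
qed

lemma herm_sub:
  assumes "u \<in> sub S p" "v \<in> sub T p" "S \<inter> T \<inter> ix = {}"
  shows "herm u v = 0"
proof -
  have "herm u v = herm (PS S p *v u) (PS T p *v v)"
    using assms by (simp add: mem_sub)
  also have "\<dots> = 0"
    using PS_empty[OF assms(3)] by (simp add: herm_PS PS_PS)
  finally show ?thesis .
qed

lemma ocompl_sub: "ocompl (sub S p) = sub (- S) p"
proof
  show "sub (- S) p \<subseteq> ocompl (sub S p)"
    unfolding ocompl_def using herm_sub[of _ "- S" p _ S] by auto
  show "ocompl (sub S p) \<subseteq> sub (- S) p"
  proof
    fix v assume "v \<in> ocompl (sub S p)"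
    then have "herm v (PS S p *v v) = 0"
      using PS_mem by (simp add: ocompl_def)
    then have "herm (PS S p *v v) (PS S p *v v) = 0"
      by (simp add: herm_PS PS_PS)
    then show "v \<in> sub (- S) p"
      by (simp add: mem_sub PS_compl)
  qed
qed

lemma oproj_sub: "oproj (sub S p) v = PS S p *v v"
  by (rule oproj_unique[OF subspace_sub PS_mem]) (simp add: ocompl_sub PS_compl[symmetric] PS_mem)

lemma projm_sub: "projm (sub S p) = PS S p"
  by (simp add: matrix_eq projm_works[OF subspace_sub] oproj_sub)

lemma smooth_PS: "smooth_map \<A> UNIV (PS S)"
proof -
  have "smooth_map \<A> UNIV (\<lambda>p. \<Sum>j\<in>S \<inter> ix. P j p)"
    by (intro smooth_map_sum open_UNIV smooth_P)
  then show ?thesis by (simp add: PS_def[abs_def])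
qed

lemma dim_sub: "vec.dim (sub S p) = card (S \<inter> ix)"
proof -
  have "\<forall>j\<in>ix. \<exists>e. e \<noteq> 0 \<and> P j p *v e = e \<and> (\<forall>v. \<exists>a. P j p *v v = a *s e)"
    using P_line by blast
  from bchoice[OF this] obtain e
    where e: "\<And>j. j \<in> ix \<Longrightarrow> e j \<noteq> 0 \<and> P j p *v e j = e j \<and> (\<forall>v. \<exists>a. P j p *v v = a *s e j)"
    by blast
  have Pe: "P k p *v e j = (if j = k then e j else 0)" if "j \<in> ix" for j k
    using P_orth[of k p j "e j"] e[OF that] by auto
  have "herm (e i) (e j) = 0" if "i \<in> ix" "j \<in> ix" "i \<noteq> j" for i j
    using herm_P[of i p "e i" "e j"] Pe that by simp
  then have fam: "inj_on e (S \<inter> ix)" "vec.independent (e ` (S \<inter> ix))"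
    using e by (intro orthogonal_family; simp)+
  have "vec.span (e ` (S \<inter> ix)) = vec.span (sub S p)"
  proof -
    have sub: "e ` (S \<inter> ix) \<subseteq> sub S p"
      by (auto simp: sub_def Pe)
    have span: "v \<in> vec.span (e ` (S \<inter> ix))" if "v \<in> sub S p" for v
    proof -
      have "PS S p *v v \<in> vec.span (e ` (S \<inter> ix))"
        unfolding PS_mv
      proof (rule vec.span_sum)
        fix j assume j: "j \<in> S \<inter> ix"
        then obtain a where "P j p *v v = a *s e j" using e by blast
        then show "P j p *v v \<in> vec.span (e ` (S \<inter> ix))"
          using j by (simp add: vec.span_scale vec.span_base)
      qed
      then show ?thesis using that by (simp add: mem_sub)
    qed
    show ?thesis
    proof (rule antisym)
      show "vec.span (e ` (S \<inter> ix)) \<subseteq> vec.span (sub S p)"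
        using sub by (rule vec.span_mono)
      show "vec.span (sub S p) \<subseteq> vec.span (e ` (S \<inter> ix))"
        by (rule vec.span_minimal[OF _ vec.subspace_span]) (use span in blast)
    qed
  qed
  then have "vec.dim (sub S p) = card (e ` (S \<inter> ix))"
    using fam(2) by (intro vec.dim_eq_card)
  then show ?thesis
    by (simp add: card_image[OF fam(1)])
qed

lemma subbundle_sub: "subbundle \<A> (sub S)"
  unfolding subbundle_def using subspace_sub dim_sub smooth_PS by (auto simp: projm_sub)

text \<open>All arrows between neighbouring lines, in both directions, are non-zero. At such a point
  the image of the second fundamental form already is the fibre of the Gauss bundle.\<close>

definition nondegenerate_at :: "'m chart \<Rightarrow> 'm \<Rightarrow> bool" where
  "nondegenerate_at c p \<longleftrightarrow> c \<in> \<A> \<and> p \<in> fst c \<and>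
     (\<forall>s\<in>{1, -1}. \<forall>l\<in>ix. l + s \<in> ix \<longrightarrow> (\<exists>v. P (l + s) p *v (wdm s c (P l) p *v (P l p *v v)) \<noteq> 0))"

context
  fixes c p s
  assumes c: "c \<in> \<A>" "p \<in> fst c" and s: "s \<in> {1, -1::int}"
begin

lemma diffm_P: "diffm_at c (P j) p" and diffm_PS: "diffm_at c (PS S) p"
  using c smooth_map_diffm_at[OF open_UNIV] smooth_P smooth_PS by auto

text \<open>Derivative of the orthogonality relations between the projections.\<close>

lemma wdm_P_orth:
  "wdm s c (P j) p *v (P k p *v v) + P j p *v (wdm s c (P k) p *v v) = (if j = k then wdm s c (P j) p *v v else 0)"
proof -
  have "(\<lambda>q. P j q ** P k q) = (if j = k then P j else (\<lambda>q. 0))"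
    by (auto simp: fun_eq_iff matrix_eq P_orth matrix_vector_mul_assoc[symmetric])
  then have "wdm s c (P j) p ** P k p + P j p ** wdm s c (P k) p = (if j = k then wdm s c (P j) p else 0)"
    using wdm_mult[OF c diffm_P diffm_P, of s j k] wdm_const[OF c, of s 0] by (cases "j = k") simp_all
  then have "(wdm s c (P j) p ** P k p + P j p ** wdm s c (P k) p) *v v = (if j = k then wdm s c (P j) p else 0) *v v"
    by simp
  then show ?thesis
    by (simp add: matrix_vector_mult_add_rdistrib matrix_vector_mul_assoc[symmetric] split: if_splits)
qed

lemma wdm_PS_idem:
  "wdm s c (PS S) p *v (PS S p *v v) + PS S p *v (wdm s c (PS S) p *v v) = wdm s c (PS S) p *v v"
proof -
  have "(\<lambda>q. PS S q ** PS S q) = PS S"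
    by (auto simp: fun_eq_iff matrix_eq PS_PS matrix_vector_mul_assoc[symmetric])
  then have "wdm s c (PS S) p ** PS S p + PS S p ** wdm s c (PS S) p = wdm s c (PS S) p"
    using wdm_mult[OF c diffm_PS diffm_PS, of s S S] by simp
  then have "(wdm s c (PS S) p ** PS S p + PS S p ** wdm s c (PS S) p) *v v = wdm s c (PS S) p *v v"
    by simp
  then show ?thesis
    by (simp add: matrix_vector_mult_add_rdistrib matrix_vector_mul_assoc[symmetric])
qed

lemma wdm_PS: "wdm s c (PS S) p *v v = (\<Sum>j\<in>S \<inter> ix. wdm s c (P j) p *v v)"
proof -
  have "wdm s c (PS S) p = (\<Sum>j\<in>S \<inter> ix. wdm s c (P j) p)"
    unfolding PS_def[abs_def] by (rule wdm_sum[OF c diffm_P])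
  then show ?thesis by (simp add: sum_mv)
qed

lemma block_degree:
  assumes "k \<noteq> l + s"
  shows "P k p *v (wdm s c (PS S) p *v (P l p *v v)) = 0"
  using P_degree[OF c s assms] by (simp add: wdm_PS mv_sum)

text \<open>In \<open>D = D P + P D\<close> a block with both indices in \<open>S\<close> occurs
  twice on the right, one with both indices outside \<open>S\<close> not at all; either way it
  vanishes.\<close>

lemma block_same:
  assumes "(k \<in> S) = (l \<in> S)"
  shows "P k p *v (wdm s c (PS S) p *v (P l p *v v)) = 0"
  using arg_cong[OF wdm_PS_idem[of S "P l p *v v"], of "\<lambda>x. P k p *v x"] assms
  by (auto simp: matrix_vector_right_distrib P_PS PS_P split: if_splits)

text \<open>Only the summands \<open>j = l\<close> and \<open>j = k\<close> can contribute, and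
  exactly one of these indices is in \<open>S\<close>; they contribute the same arrow with opposite
  signs. Hence the zeros of an arrow do not depend on \<open>S\<close>.\<close>

lemma block_sign:
  assumes "(k \<in> S) \<noteq> (l \<in> S)"
  shows "P k p *v (wdm s c (PS S) p *v (P l p *v v)) =
    (if l \<in> S then 1 else - 1) *s (P k p *v (wdm s c (P l) p *v (P l p *v v)))"
proof (cases "k \<in> ix \<and> l \<in> ix")
  case False
  then have "P k p = 0 \<or> P l p = 0" using P_outside by blast
  then show ?thesis by auto
next
  case True
  have *: "P k p *v (wdm s c (P j) p *v (P l p *v v)) =
      - (if j = k then P k p *v (wdm s c (P l) p *v (P l p *v v)) else 0)" if "j \<noteq> l" for j
  proof -
    have "wdm s c (P j) p *v (P l p *v v) = - (P j p *v (wdm s c (P l) p *v (P l p *v v)))"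
      using wdm_P_orth[of j l "P l p *v v"] that by (simp add: P_orth eq_neg_iff_add_eq_0)
    then show ?thesis by (auto simp: mv_minus P_orth)
  qed
  have sum: "P k p *v (wdm s c (PS S) p *v (P l p *v v)) =
      (\<Sum>j\<in>S \<inter> ix. P k p *v (wdm s c (P j) p *v (P l p *v v)))"
    by (simp add: wdm_PS mv_sum)
  show ?thesis
  proof (cases "l \<in> S")
    case l: True
    then have "k \<notin> S" using assms by simp
    then have "(\<Sum>j\<in>S \<inter> ix. P k p *v (wdm s c (P j) p *v (P l p *v v))) =
        (\<Sum>j\<in>S \<inter> ix. if j = l then P k p *v (wdm s c (P l) p *v (P l p *v v)) else 0)"
      using * by (intro sum.cong) auto
    also have "\<dots> = P k p *v (wdm s c (P l) p *v (P l p *v v))"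
      using l True by simp
    finally show ?thesis using sum l by simp
  next
    case l: False
    then have "k \<in> S" using assms by simp
    have "(\<Sum>j\<in>S \<inter> ix. P k p *v (wdm s c (P j) p *v (P l p *v v))) =
        (\<Sum>j\<in>S \<inter> ix. if j = k then - (P k p *v (wdm s c (P l) p *v (P l p *v v))) else 0)"
      by (rule sum.cong[OF refl]) (subst *, use l in auto)
    also have "\<dots> = - (P k p *v (wdm s c (P l) p *v (P l p *v v)))"
      using \<open>k \<in> S\<close> True by simp
    finally show ?thesis using sum l by simp
  qed
qed

lemma block_nonzero:
  assumes "nondegenerate_at c p" "l \<in> ix" "l + s \<in> ix" "(l + s \<in> S) \<noteq> (l \<in> S)"
  shows "\<exists>v. P (l + s) p *v (wdm s c (PS S) p *v (P l p *v v)) \<noteq> 0"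
  using assms s block_sign[OF assms(4)] unfolding nondegenerate_at_def by auto

text \<open>The target is a line, so a non-zero arrow is onto; the preimage is found by
  rescaling.\<close>

lemma block_surj:
  assumes "nondegenerate_at c p" "l \<in> ix" "l + s \<in> ix" "(l + s \<in> S) \<noteq> (l \<in> S)"
  shows "\<exists>u. P (l + s) p *v (wdm s c (PS S) p *v (P l p *v u)) = P (l + s) p *v w"
proof -
  obtain v where v: "P (l + s) p *v (wdm s c (PS S) p *v (P l p *v v)) \<noteq> 0"
    using block_nonzero[OF assms] by blast
  obtain e where e: "\<And>v. \<exists>a. P (l + s) p *v v = a *s e"
    using P_line[OF assms(3)] by blast
  obtain a where a: "P (l + s) p *v (wdm s c (PS S) p *v (P l p *v v)) = a *s e" using e by blast
  obtain b where b: "P (l + s) p *v w = b *s e" using e by blast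
  have "a \<noteq> 0" using a v by auto
  then have "P (l + s) p *v (wdm s c (PS S) p *v (P l p *v ((b / a) *s v))) = b *s e"
    by (simp add: mv_scale a vector_smult_assoc)
  then show ?thesis unfolding b by blast
qed

end

end

text \<open>Index set of the Gauss bundle in direction \<open>s\<close>: the indices reached by one
  step that leaves \<open>S\<close>.\<close>

definition shift :: "int \<Rightarrow> int set \<Rightarrow> int set" where
  "shift s S = {j + s | j. j \<in> S \<and> j + s \<notin> S}"

lemma mem_shift: "k \<in> shift s S \<longleftrightarrow> k - s \<in> S \<and> k \<notin> S"
  by (force simp: shift_def)

section \<open>Gauss bundles and Laplacians of sums of lines\<close>

context graded
begin

lemma degree_left:
  assumes "\<And>k. k \<noteq> l + s \<Longrightarrow> P k p *v (M *v (P l p *v v)) = 0"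
  shows "M *v (P l p *v v) = P (l + s) p *v (M *v (P l p *v v))"
  by (rule P_eqI[where p = p]) (auto simp: P_orth assms)

lemma degree_right:
  assumes "\<And>l. k \<noteq> l + s \<Longrightarrow> P k p *v (M *v (P l p *v v)) = 0"
  shows "P k p *v (M *v v) = P k p *v (M *v (P (k - s) p *v v))"
proof -
  have "P k p *v (M *v v) = P k p *v (M *v (\<Sum>j\<in>ix. P j p *v v))"
    by (simp add: P_complete)
  also have "\<dots> = (\<Sum>j\<in>ix. if j = k - s then P k p *v (M *v (P (k - s) p *v v)) else 0)"
    unfolding mv_sum by (intro sum.cong) (auto simp: assms)
  also have "\<dots> = (if k - s \<in> ix then P k p *v (M *v (P (k - s) p *v v)) else 0)"
    by simp
  finally show ?thesis
    using P_outside[of "k - s" p] by auto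
qed

text \<open>The second fundamental form of \<open>sub S\<close> written in the grading: a component
  comes from the one line \<open>s\<close> steps before it, and only if that step leaves
  \<open>S\<close>.\<close>

lemma gauss_component:
  assumes c: "c \<in> \<A>" "p \<in> fst c" and s: "s \<in> {1, -1}"
  shows "P k p *v (PS (- S) p *v (wdm s c (PS S) p *v (PS S p *v v))) =
     (if k \<in> shift s S then P k p *v (wdm s c (PS S) p *v (P (k - s) p *v v)) else 0)"
proof -
  have "P k p *v (wdm s c (PS S) p *v (PS S p *v v)) =
      P k p *v (wdm s c (PS S) p *v (P (k - s) p *v (PS S p *v v)))"
    by (rule degree_right) (rule block_degree[OF c s])
  then show ?thesis
    by (simp add: P_PS mem_shift)
qed

lemma deriv_image_sub:
  assumes s: "s \<in> {1, -1}" and S: "S \<subseteq> ix"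
  shows "deriv_image s \<A> (sub S) p \<subseteq> sub (shift s S) p"
    and "nondegenerate_at c p \<Longrightarrow> deriv_image s \<A> (sub S) p = sub (shift s S) p"
proof -
  show sub: "deriv_image s \<A> (sub S) p \<subseteq> sub (shift s S) p"
  proof
    fix w assume "w \<in> deriv_image s \<A> (sub S) p"
    then obtain c v U where c: "c \<in> \<A>" "p \<in> fst c"
      and U: "open U" "p \<in> U" "smooth_map \<A> U v" "local_section (sub S) U v"
      and w: "w = oproj (ocompl (sub S p)) (wdv s c v p)"
      unfolding deriv_image_def by blast
    have v: "PS S q *v v q = v q" if "q \<in> U" for q
      using U(4) that by (simp add: local_section_def mem_sub)
    \<comment> \<open>A section satisfies \<open>v = P v\<close>, so its derivative is
      \<open>P' v + P v'\<close>; the second term lies in the bundle and is removed by the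
      projection to the complement.\<close>
    have "wdv s c v p = wdv s c (\<lambda>q. PS S q *v v q) p"
      by (rule wdv_local[OF c U(1,2)]) (simp add: v)
    also have "\<dots> = wdm s c (PS S) p *v (PS S p *v v p) + PS S p *v wdv s c v p"
      by (subst wdv_mv[OF c diffm_PS[OF c s] smooth_map_diffv_at[OF U(1,3,2) c]])
        (simp add: v[OF U(2)])
    finally have "w = PS (- S) p *v (wdm s c (PS S) p *v (PS S p *v v p) + PS S p *v wdv s c v p)"
      using w by (simp add: ocompl_sub oproj_sub)
    also have "\<dots> = PS (- S) p *v (wdm s c (PS S) p *v (PS S p *v v p))"
      by (simp add: matrix_vector_right_distrib PS_PS PS_empty)
    finally show "w \<in> sub (shift s S) p"
      using gauss_component[OF c s] by (auto simp: sub_def)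
  qed
  assume nd: "nondegenerate_at c p"
  then have c: "c \<in> \<A>" "p \<in> fst c" by (auto simp: nondegenerate_at_def)
  have "w \<in> deriv_image s \<A> (sub S) p" if w: "w \<in> sub (shift s S) p" for w
  proof -
    let ?D = "wdm s c (PS S) p"
    have ex: "\<exists>u. P k p *v (?D *v (P (k - s) p *v u)) = P k p *v w" if "k \<in> shift s S" "k \<in> ix" for k
      using block_surj[OF c s nd, of "k - s" S w] that S by (auto simp: mem_shift)
    then obtain f where f: "\<And>k. k \<in> shift s S \<Longrightarrow> k \<in> ix \<Longrightarrow> P k p *v (?D *v (P (k - s) p *v f k)) = P k p *v w"
      by metis
    \<comment> \<open>A constant vector assembled so that its component of index
      \<open>k - s\<close> is sent to the component of index \<open>k\<close> of \<open>w\<close>.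
      Projecting it pointwise to the bundle yields a smooth global section with the prescribed
      image.\<close>
    define u where "u = (\<Sum>j\<in>ix. P j p *v f (j + s))"
    have Pu: "P j p *v u = P j p *v f (j + s)" if "j \<in> ix" for j
    proof -
      have "P j p *v u = (\<Sum>i\<in>ix. if i = j then P j p *v f (j + s) else 0)"
        unfolding u_def mv_sum by (rule sum.cong) (auto simp: P_orth)
      then show ?thesis using that by simp
    qed
    define v where "v = (\<lambda>q. PS S q *v u)"
    have sm: "smooth_map \<A> UNIV v"
      unfolding v_def smooth_map_vec[OF open_UNIV] mv_nth
    proof (intro allI smooth_map_sum smooth_map_mult open_UNIV smooth_map_const)
      show "smooth_map \<A> UNIV (\<lambda>q. PS S q $ i $ k)" for i k
        using smooth_PS[of S] unfolding smooth_map_vec[OF open_UNIV] by blast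
    qed
    have "wdv s c v p = ?D *v u"
      unfolding v_def
      by (subst wdv_mv[OF c diffm_PS[OF c s] diffv_at_const[OF c]]) (simp add: wdv_const[OF c])
    also have "\<dots> = ?D *v (PS S p *v u) + PS S p *v (?D *v u)"
      using wdm_PS_idem[OF c s] by simp
    finally have eq: "oproj (ocompl (sub S p)) (wdv s c v p) = PS (- S) p *v (?D *v (PS S p *v u))"
      by (simp add: ocompl_sub oproj_sub matrix_vector_right_distrib PS_PS PS_empty)
    have "\<dots> = w"
    proof (rule P_eqI[where p = p])
      fix k assume k: "k \<in> ix"
      show "P k p *v (PS (- S) p *v (?D *v (PS S p *v u))) = P k p *v w"
      proof (cases "k \<in> shift s S")
        case True
        then have "k - s \<in> ix" using S by (auto simp: mem_shift)
        then show ?thesis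
          using True f[OF True k] Pu[of "k - s"] by (simp add: gauss_component[OF c s])
      next
        case False
        then show ?thesis
          using w k by (simp add: gauss_component[OF c s] sub_def)
      qed
    qed
    then have "w = oproj (ocompl (sub S p)) (wdv s c v p)" using eq by simp
    moreover have "local_section (sub S) UNIV v"
      by (simp add: local_section_def v_def PS_mem)
    ultimately show ?thesis
      unfolding deriv_image_def using c sm open_UNIV by blast
  qed
  with sub show "deriv_image s \<A> (sub S) p = sub (shift s S) p" by blast
qed

lemma subbundle_unique:
  assumes "subbundle \<A> \<phi>" "subbundle \<A> \<psi>" "\<not> p islimpt {q. \<phi> q \<noteq> \<psi> q}"
  shows "\<phi> p = \<psi> p"
proof -
  obtain U where U: "open U" "p \<in> U" "\<And>q. q \<in> U \<Longrightarrow> q \<noteq> p \<Longrightarrow> \<phi> q = \<psi> q"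
    using assms(3) unfolding islimpt_def by blast
  have "projm (\<phi> p) = projm (\<psi> p)"
  proof (rule smooth_map_eq_punctured[OF U(1,2)])
    show "smooth_map \<A> U (\<lambda>p. projm (\<phi> p))" "smooth_map \<A> U (\<lambda>p. projm (\<psi> p))"
      using assms(1,2) smooth_map_mono[of UNIV] unfolding subbundle_def by blast+
  qed (simp add: U)
  then show ?thesis
    using assms(1,2) projm_inject unfolding subbundle_def by blast
qed

lemma gauss_sub:
  assumes nd: "\<And>p. \<not> p islimpt {q. \<not> (\<exists>c. nondegenerate_at c q)}"
    and s: "s \<in> {1, -1}" and S: "S \<subseteq> ix"
  shows "gauss s \<A> (sub S) = sub (shift s S)"
  unfolding gauss_def
proof (rule the_equality)
  let ?Z = "{q. \<not> (\<exists>c. nondegenerate_at c q)}"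
  have sub: "{q. deriv_image s \<A> (sub S) q \<noteq> sub (shift s S) q} \<subseteq> ?Z"
    using deriv_image_sub(2)[OF s S] by blast
  then have lim: "\<not> p islimpt {q. deriv_image s \<A> (sub S) q \<noteq> sub (shift s S) q}" for p
    using nd islimpt_subset by blast
  then show "subbundle \<A> (sub (shift s S)) \<and>
      (\<forall>p. \<not> p islimpt {q. deriv_image s \<A> (sub S) q \<noteq> sub (shift s S) q})"
    using subbundle_sub by blast
  fix \<psi> assume \<psi>: "subbundle \<A> \<psi> \<and> (\<forall>p. \<not> p islimpt {q. deriv_image s \<A> (sub S) q \<noteq> \<psi> q})"
  show "\<psi> = sub (shift s S)"
  proof
    fix p
    \<comment> \<open>Two candidates can differ only where one of them differs from the image.
      Neither of these sets accumulates at \<open>p\<close>, so they agree on a punctured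
      neighbourhood and hence at \<open>p\<close>.\<close>
    have "\<not> p islimpt ({q. deriv_image s \<A> (sub S) q \<noteq> \<psi> q} \<union> {q. deriv_image s \<A> (sub S) q \<noteq> sub (shift s S) q})"
      using \<psi> lim[of p] by (simp add: islimpt_Un)
    then have "\<not> p islimpt {q. \<psi> q \<noteq> sub (shift s S) q}"
      by (rule contrapos_nn) (erule islimpt_subset, blast)
    then show "\<psi> p = sub (shift s S) p"
      using subbundle_unique \<psi> subbundle_sub by blast
  qed
qed

text \<open>\<open>\<partial>P\<close> has degree \<open>s\<close>, so its derivative in the opposite direction has degree \<open>s\<close> or \<open>0\<close>. As the
  second derivatives commute, only the degree \<open>0\<close> part survives.\<close>

lemma second_derivative_degree:
  assumes c: "c \<in> \<A>" "p \<in> fst c" and s: "s \<in> {1, -1}" and kl: "k \<noteq> l" "k \<noteq> l + s"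
  shows "P k p *v (wdm (- s) c (wdm s c (PS S)) p *v (P l p *v v)) = 0"
proof -
  have ms: "- s \<in> {1, -1}" using s by auto
  let ?T = "wdm s c (PS S)"
  let ?D = "\<lambda>j. wdm (- s) c (P j) p"
  have dT: "diffm_at c ?T p"
    using diffm_at_wdm[OF c open_UNIV UNIV_I smooth_PS] .
  \<comment> \<open>A block that vanishes throughout the chart is differentiated in the opposite
    direction. Of the three terms, those with derivatives of \<open>P k\<close> and
    \<open>P l\<close> vanish by degree, because \<open>k \<noteq> l\<close>.\<close>
  have "P k q ** (?T q ** P l q) = 0" if "q \<in> fst c" for q
    using block_degree[OF c(1) that s kl(2)] by (simp add: matrix_eq matrix_vector_mul_assoc[symmetric])
  then have "wdm (- s) c (\<lambda>q. P k q ** (?T q ** P l q)) p = wdm (- s) c (\<lambda>q. 0) p"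
    using chart_homeo(2)[OF c(1)] by (intro wdm_local[OF c]) (use c in auto)
  also have "\<dots> = 0" by (rule wdm_const[OF c])
  also have "wdm (- s) c (\<lambda>q. P k q ** (?T q ** P l q)) p =
      ?D k ** (?T p ** P l p) + P k p ** (wdm (- s) c ?T p ** P l p + ?T p ** ?D l)"
    using wdm_mult[OF c diffm_P[OF c s] diffm_at_mult[OF c dT diffm_P[OF c s]]]
      wdm_mult[OF c dT diffm_P[OF c s]] by simp
  finally have eq: "(?D k ** (?T p ** P l p) + P k p ** (wdm (- s) c ?T p ** P l p + ?T p ** ?D l)) *v
      (P l p *v v) = 0" by simp
  have 1: "P k p *v (?D k *v (?T p *v (P l p *v v))) = 0"
  proof -
    have "?T p *v (P l p *v v) = P (l + s) p *v (?T p *v (P l p *v v))"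
      by (rule degree_left) (rule block_degree[OF c s])
    then have "P k p *v (?D k *v (?T p *v (P l p *v v))) =
        P k p *v (?D k *v (P (l + s) p *v (?T p *v (P l p *v v))))" by simp
    also have "\<dots> = 0"
      using P_degree[OF c ms, of k "l + s"] kl by simp
    finally show ?thesis .
  qed
  have 2: "P k p *v (?T p *v (?D l *v (P l p *v v))) = 0"
  proof -
    have "P k p *v (?T p *v (?D l *v (P l p *v v))) = P k p *v (?T p *v (P (k - s) p *v (?D l *v (P l p *v v))))"
      by (rule degree_right) (rule block_degree[OF c s])
    moreover have "P (k - s) p *v (?D l *v (P l p *v v)) = 0"
      using P_degree[OF c ms, of "k - s" l l] kl by simp
    ultimately show ?thesis by simp
  qed
  have "P k p *v ((?D k ** (?T p ** P l p) + P k p ** (wdm (- s) c ?T p ** P l p + ?T p ** ?D l)) *v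
      (P l p *v v)) = P k p *v (wdm (- s) c ?T p *v (P l p *v v))"
    using 1 2 by (simp add: matrix_vector_mult_add_rdistrib matrix_vector_right_distrib
        matrix_vector_mul_assoc[symmetric] P_orth)
  then show ?thesis using eq by simp
qed

lemma laplacian_block:
  assumes c: "c \<in> \<A>" "p \<in> fst c" and kl: "k \<noteq> l"
  shows "P k p *v (wdm (-1) c (wdm 1 c (PS S)) p *v (P l p *v v)) = 0"
proof (cases "k = l + 1")
  case True
  then have "P k p *v (wdm 1 c (wdm (-1) c (PS S)) p *v (P l p *v v)) = 0"
    using second_derivative_degree[OF c, of "-1" k l S v] kl by simp
  then show ?thesis
    using wdm_wdm[OF c open_UNIV UNIV_I smooth_PS] by simp
next
  case False
  then show ?thesis
    using second_derivative_degree[OF c, of 1 k l S v] kl by simp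
qed

lemma laplacian_commute:
  assumes c: "c \<in> \<A>" "p \<in> fst c"
  shows "PS S p ** wdm (-1) c (wdm 1 c (PS S)) p = wdm (-1) c (wdm 1 c (PS S)) p ** PS S p"
proof -
  let ?Y = "wdm (-1) c (wdm 1 c (PS S)) p"
  have *: "P k p *v (?Y *v w) = P k p *v (?Y *v (P k p *v w))" for k w
    using degree_right[of k 0 p ?Y w] laplacian_block[OF c] by simp
  have "PS S p *v (?Y *v v) = ?Y *v (PS S p *v v)" for v
  proof (rule P_eqI[where p = p])
    fix k assume k: "k \<in> ix"
    show "P k p *v (PS S p *v (?Y *v v)) = P k p *v (?Y *v (PS S p *v v))"
      using *[of k v] *[of k "PS S p *v v"] by (simp add: P_PS)
  qed
  then show ?thesis
    by (simp add: matrix_eq matrix_vector_mul_assoc[symmetric])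
qed

end

section \<open>Harmonicity\<close>

lemma scaleR_mv: "(r *\<^sub>R A) *v v = r *\<^sub>R (A *v (v :: complex^7))"
  by (simp add: vec_eq_iff mv_nth scaleR_sum_right)

lemma matrix_add_rdistrib: "(A + B) ** C = A ** C + B ** (C :: complex^7^7)"
  by (simp add: vec_eq_iff matrix_matrix_mult_def sum.distrib algebra_simps)

lemma herm_axis: "herm (axis i 1) (A *v axis j 1) = cnj (A $ i $ j)"
  "herm (A *v axis i 1) (axis j 1) = A $ j $ i"
  by (simp_all add: herm_def cdot_def mv_nth axis_def if_distrib[of cnj] mult_delta_left mult_delta_right
      cong: if_cong)

text \<open>\<open>X\<close> exchanges image and kernel of the projection \<open>Q\<close>, while
  \<open>Y\<close> preserves both; the trace form pairs such matrices to zero. The factor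
  \<open>Q\<close> is moved across the form by self-adjointness.\<close>

lemma offdiagonal_inner_diagonal:
  fixes X Y Q :: "complex^7^7"
  assumes X: "X = X ** Q + Q ** X" and Q: "Q ** Q = Q" and Y: "Q ** Y = Y ** Q"
    and herm: "\<And>v w. herm (Q *v v) w = herm v (Q *v w)"
  shows "X \<bullet> Y = 0"
proof -
  define tr :: "complex^7^7 \<Rightarrow> complex^7^7 \<Rightarrow> complex"
    where "tr A B = (\<Sum>i\<in>UNIV. \<Sum>k\<in>UNIV. A $ i $ k * cnj (B $ i $ k))" for A B
  have Qh: "cnj (Q $ i $ j) = Q $ j $ i" for i j
    using herm[of "axis i 1" "axis j 1"] by (simp add: herm_axis)
  have left: "tr (Q ** A) B = tr A (Q ** B)" for A B
  proof -
    have "tr (Q ** A) B = (\<Sum>i\<in>UNIV. \<Sum>k\<in>UNIV. \<Sum>j\<in>UNIV. Q $ i $ j * A $ j $ k * cnj (B $ i $ k))"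
      by (simp add: tr_def matrix_matrix_mult_def sum_distrib_right)
    also have "\<dots> = (\<Sum>i\<in>UNIV. \<Sum>j\<in>UNIV. \<Sum>k\<in>UNIV. Q $ i $ j * A $ j $ k * cnj (B $ i $ k))"
      by (rule sum.cong[OF refl], rule sum.swap)
    also have "\<dots> = (\<Sum>j\<in>UNIV. \<Sum>i\<in>UNIV. \<Sum>k\<in>UNIV. Q $ i $ j * A $ j $ k * cnj (B $ i $ k))"
      by (rule sum.swap)
    also have "\<dots> = (\<Sum>j\<in>UNIV. \<Sum>k\<in>UNIV. \<Sum>i\<in>UNIV. Q $ i $ j * A $ j $ k * cnj (B $ i $ k))"
      by (rule sum.cong[OF refl], rule sum.swap)
    also have "\<dots> = tr A (Q ** B)"
      by (simp add: tr_def matrix_matrix_mult_def sum_distrib_left Qh algebra_simps)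
    finally show ?thesis .
  qed
  have right: "tr (A ** Q) B = tr A (B ** Q)" for A B
  proof -
    have "tr (A ** Q) B = (\<Sum>i\<in>UNIV. \<Sum>k\<in>UNIV. \<Sum>j\<in>UNIV. A $ i $ j * Q $ j $ k * cnj (B $ i $ k))"
      by (simp add: tr_def matrix_matrix_mult_def sum_distrib_right)
    also have "\<dots> = (\<Sum>i\<in>UNIV. \<Sum>j\<in>UNIV. \<Sum>k\<in>UNIV. A $ i $ j * Q $ j $ k * cnj (B $ i $ k))"
      by (rule sum.cong[OF refl], rule sum.swap)
    also have "\<dots> = tr A (B ** Q)"
      by (simp add: tr_def matrix_matrix_mult_def sum_distrib_left Qh algebra_simps)
    finally show ?thesis .
  qed
  have add: "tr (A + B) C = tr A C + tr B C" for A B C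
    by (simp add: tr_def algebra_simps sum.distrib)
  have "Q ** (X ** Q) = 0"
  proof -
    have "Q ** (X ** Q) = Q ** ((X ** Q + Q ** X) ** Q)"
      using X by simp
    also have "\<dots> = Q ** (X ** (Q ** Q)) + (Q ** Q) ** (X ** Q)"
      by (simp add: matrix_add_ldistrib matrix_add_rdistrib matrix_mul_assoc)
    also have "\<dots> = Q ** (X ** Q) + Q ** (X ** Q)"
      by (simp add: Q)
    finally show ?thesis by simp
  qed
  then have QXQ: "Q ** X ** Q = 0" by (simp add: matrix_mul_assoc)
  have "tr X Y = tr (X ** Q) Y + tr (Q ** X) Y"
    using X add by metis
  also have "tr (X ** Q) Y = tr (X ** Q ** Q) Y"
    by (simp add: Q flip: matrix_mul_assoc)
  also have "\<dots> = tr (X ** Q) (Q ** Y)"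
    by (simp add: right Y)
  also have "\<dots> = tr (Q ** (X ** Q)) Y"
    by (simp add: left)
  also have "\<dots> = 0"
    using \<open>Q ** (X ** Q) = 0\<close> by (simp add: tr_def)
  also have "tr (Q ** X) Y = tr (Q ** (Q ** X)) Y"
    by (simp add: Q matrix_mul_assoc)
  also have "\<dots> = tr (Q ** X) (Y ** Q)"
    by (simp add: left Y)
  also have "\<dots> = tr (Q ** X ** Q) Y"
    by (simp add: right)
  also have "\<dots> = 0"
    using QXQ by (simp add: tr_def)
  finally have "tr X Y = 0" by simp
  moreover have "X \<bullet> Y = Re (tr X Y)"
    by (simp add: tr_def inner_vec_def inner_complex_def)
  ultimately show ?thesis by simp
qed

text \<open>Obtained by differentiating \<open>\<gamma> t ** \<gamma> t = \<gamma> t\<close>. For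
  \<open>G2_SO4\<close> this describes a larger space than its tangent space, but orthogonality to
  the larger one suffices.\<close>

lemma tangent_idempotent:
  assumes S: "\<And>M. M \<in> S \<Longrightarrow> M ** M = M" and X: "X \<in> tangent_vectors S Q"
  shows "X = X ** Q + Q ** (X :: complex^7^7)"
proof -
  obtain \<gamma> where \<gamma>: "\<gamma> 0 = Q" "\<And>t. \<gamma> t \<in> S" "(\<gamma> has_vector_derivative X) (at 0)"
    using X unfolding tangent_vectors_def by blast
  have d: "((\<lambda>t. \<gamma> t $ i $ j) has_vector_derivative X $ i $ j) (at 0)" for i j
    using bounded_linear.has_vector_derivative[OF bounded_linear_vec_nth
        bounded_linear.has_vector_derivative[OF bounded_linear_vec_nth \<gamma>(3)]] .
  have "X $ i $ j = (X ** Q + Q ** X) $ i $ j" for i j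
  proof -
    have "((\<lambda>t. \<Sum>k\<in>UNIV. \<gamma> t $ i $ k * \<gamma> t $ k $ j) has_vector_derivative
        (\<Sum>k\<in>UNIV. \<gamma> 0 $ i $ k * X $ k $ j + X $ i $ k * \<gamma> 0 $ k $ j)) (at 0)"
      by (intro has_vector_derivative_sum has_vector_derivative_mult d)
    moreover have "(\<lambda>t. \<Sum>k\<in>UNIV. \<gamma> t $ i $ k * \<gamma> t $ k $ j) = (\<lambda>t. \<gamma> t $ i $ j)"
    proof
      fix t
      have "(\<gamma> t ** \<gamma> t) $ i $ j = \<gamma> t $ i $ j" using S \<gamma>(2) by simp
      then show "(\<Sum>k\<in>UNIV. \<gamma> t $ i $ k * \<gamma> t $ k $ j) = \<gamma> t $ i $ j"
        by (simp add: matrix_matrix_mult_def)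
    qed
    ultimately have "X $ i $ j = (\<Sum>k\<in>UNIV. \<gamma> 0 $ i $ k * X $ k $ j + X $ i $ k * \<gamma> 0 $ k $ j)"
      using vector_derivative_unique_at[OF d] by simp
    then show ?thesis
      by (simp add: \<gamma>(1) matrix_matrix_mult_def sum.distrib)
  qed
  then show ?thesis by (simp add: vec_eq_iff)
qed

lemma G2_SO4_subspace: "W \<in> G2_SO4 \<Longrightarrow> vec.subspace W"
  unfolding G2_SO4_def associative_subspace_def by (auto intro: complexify_subspace)

context graded
begin

lemma harmonic_sub:
  assumes "\<And>p. sub S p \<in> G2_SO4"
  shows "harmonic_into \<A> G2_SO4 (sub S)"
  unfolding harmonic_into_def projm_sub dz_mat_wdm dzbar_mat_wdm
proof (intro conjI ballI allI assms)
  show "smooth_map \<A> UNIV (\<lambda>p. PS S p)" by (rule smooth_PS)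
  fix c p X assume c: "c \<in> \<A>" "p \<in> fst c" and X: "X \<in> tangent_vectors (projm ` G2_SO4) (PS S p)"
  have "X = X ** PS S p + PS S p ** X"
    by (rule tangent_idempotent[OF _ X]) (auto simp: projm_idem G2_SO4_subspace)
  then show "X \<bullet> wdm (-1) c (wdm 1 c (PS S)) p = 0"
  proof (rule offdiagonal_inner_diagonal)
    show "PS S p ** PS S p = PS S p"
      by (simp add: matrix_eq PS_PS matrix_vector_mul_assoc[symmetric])
  qed (simp_all add: laplacian_commute[OF c] herm_PS)
qed

lemma strongly_conformal_sub:
  assumes nd: "\<And>p. \<not> p islimpt {q. \<not> (\<exists>c. nondegenerate_at c q)}"
    and S: "S \<subseteq> ix" "shift 1 S \<inter> shift (-1) S \<inter> ix = {}"
  shows "strongly_conformal \<A> (sub S)"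
  unfolding strongly_conformal_def gauss1_eq gauss2_eq
  using gauss_sub[OF nd _ S(1), of 1] gauss_sub[OF nd _ S(1), of "-1"] herm_sub[OF _ _ S(2)] by simp

lemma cartan_embed_sub: "cartan_embed (sub S) p = PS S p - PS (- S) p"
  by (simp add: cartan_embed_def ocompl_sub projm_sub)

text \<open>The reflection is \<open>2 P - 1\<close> and its own inverse, so \<open>Az\<close> is
  this reflection after \<open>\<partial>P\<close>. On each component it only changes the sign of
  the arrow.\<close>

lemma Az_sub:
  assumes c: "c \<in> \<A>" "p \<in> fst c"
  shows "Az c (sub S) p *v v = PS S p *v (wdm 1 c (PS S) p *v v) - PS (- S) p *v (wdm 1 c (PS S) p *v v)"
proof -
  let ?I = "\<lambda>p. PS S p - PS (- S) p"
  have sq: "?I p ** ?I p = mat 1"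
    by (simp add: matrix_eq matrix_vector_mul_assoc[symmetric] matrix_vector_mult_diff_rdistrib
        matrix_vector_mult_diff_distrib PS_PS PS_empty)
      (simp add: PS_compl)
  then have "invertible (?I p)"
    unfolding invertible_def by blast
  then have "matrix_inv (?I p) ** ?I p = mat 1"
    unfolding invertible_def matrix_inv_def by (rule someI2_ex) simp
  then have inv: "matrix_inv (?I p) = ?I p"
  proof -
    have "matrix_inv (?I p) = matrix_inv (?I p) ** (?I p ** ?I p)"
      unfolding sq by simp
    also have "\<dots> = (matrix_inv (?I p) ** ?I p) ** ?I p"
      by (rule matrix_mul_assoc)
    also have "\<dots> = ?I p"
      unfolding \<open>matrix_inv (?I p) ** ?I p = mat 1\<close> by simp
    finally show ?thesis .
  qed
  have "wdm 1 c (cartan_embed (sub S)) p = wdm 1 c (PS S) p + wdm 1 c (PS S) p"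
  proof -
    have d: "diff_at c (\<lambda>q. PS S q $ i $ j) p" for i j
      by (rule diffm_at_nth[OF diffm_PS[OF c, of 1]]) simp
    have d2: "diff_at c (\<lambda>q. PS S q $ i $ j + - (mat 1 $ i $ j)) p" for i j
      by (rule diff_at_add[OF d diff_at_const])
    have "PS (- S) q = mat 1 - PS S q" for q
      by (simp add: matrix_eq PS_compl matrix_vector_mult_diff_rdistrib)
    then have eq: "cartan_embed (sub S) q $ i $ j = PS S q $ i $ j + (PS S q $ i $ j + - (mat 1 $ i $ j))" for q i j
      unfolding cartan_embed_sub by simp
    have "wd 1 c (\<lambda>q. cartan_embed (sub S) q $ i $ j) p =
        wd 1 c (\<lambda>q. PS S q $ i $ j) p + wd 1 c (\<lambda>q. PS S q $ i $ j) p" for i j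
      unfolding eq wd_add[OF d d2] wd_add[OF d diff_at_const] wd_const by simp
    then show ?thesis
      unfolding vec_eq_iff wdm_nth vector_add_component by blast
  qed
  then have "Az c (sub S) p *v v = ((1 / 2) *\<^sub>R (?I p ** (wdm 1 c (PS S) p + wdm 1 c (PS S) p))) *v v"
    by (simp add: Az_def dz_mat_wdm cartan_embed_sub inv)
  also have "\<dots> = (1 / 2) *\<^sub>R (?I p *v (wdm 1 c (PS S) p *v v + wdm 1 c (PS S) p *v v))"
    by (simp only: scaleR_mv matrix_vector_mul_assoc[symmetric]
        matrix_vector_mult_add_rdistrib)
  also have "\<dots> = ?I p *v (wdm 1 c (PS S) p *v v)"
    unfolding matrix_vector_right_distrib unfolding scaleR_2[symmetric] by simp
  finally show ?thesis
    by (simp add: matrix_vector_mult_diff_rdistrib)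
qed

end

section \<open>Nilpotency\<close>

lemma funpow_mv_add: "((\<lambda>x. (A :: complex^7^7) *v x) ^^ n) (u + v) = ((\<lambda>x. A *v x) ^^ n) u + ((\<lambda>x. A *v x) ^^ n) (v :: complex^7)"
  by (induction n) (simp_all add: matrix_vector_right_distrib)

lemma funpow_mv_0: "((\<lambda>x. (A :: complex^7^7) *v x) ^^ n) 0 = (0 :: complex^7)"
  by (induction n) simp_all

lemma funpow_mv_sum:
  "((\<lambda>x. (A :: complex^7^7) *v x) ^^ n) (\<Sum>i\<in>I. f i) = (\<Sum>i\<in>I. ((\<lambda>x. A *v x) ^^ n) (f i :: complex^7))"
  by (induction I rule: infinite_finite_induct) (simp_all add: funpow_mv_add funpow_mv_0)

context graded
begin

context
  fixes c p and S :: "int set"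
  assumes c: "c \<in> \<A>" "p \<in> fst c"
begin

private abbreviation Azp :: "nat \<Rightarrow> complex^7 \<Rightarrow> complex^7" where
  "Azp n \<equiv> (\<lambda>x. Az c (sub S) p *v x) ^^ n"

lemma P_Az:
  "P k p *v (Az c (sub S) p *v v) = (if k \<in> S then 1 else - 1) *s (P k p *v (wdm 1 c (PS S) p *v v))"
  by (simp add: Az_sub[OF c] matrix_vector_mult_diff_distrib P_PS)

lemma Az_shift: "P (l + 1) p *v (Az c (sub S) p *v (P l p *v v)) = Az c (sub S) p *v (P l p *v v)"
proof (rule P_eqI[where p = p])
  fix k
  show "P k p *v (P (l + 1) p *v (Az c (sub S) p *v (P l p *v v))) = P k p *v (Az c (sub S) p *v (P l p *v v))"
    using block_degree[OF c, of 1 k l S v] by (auto simp: P_orth P_Az mv_minus)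
qed

lemma Az_zero:
  assumes "(l + 1 \<in> S) = (l \<in> S)"
  shows "Az c (sub S) p *v (P l p *v v) = 0"
proof -
  have "P (l + 1) p *v (Az c (sub S) p *v (P l p *v v)) = 0"
    using block_same[OF c, of 1 "l + 1" S l v] assms by (simp add: P_Az)
  then show ?thesis by (simp add: Az_shift)
qed

lemma Az_nonzero:
  assumes nd: "nondegenerate_at c p" and l: "l \<in> ix" "l + 1 \<in> ix" "(l + 1 \<in> S) \<noteq> (l \<in> S)"
    and w: "P l p *v w = w" "w \<noteq> 0"
  shows "Az c (sub S) p *v w \<noteq> 0"
proof
  assume 0: "Az c (sub S) p *v w = 0"
  obtain e where e: "\<And>v. \<exists>a. P l p *v v = a *s e"
    using P_line[OF l(1)] by blast
  obtain v where v: "P (l + 1) p *v (wdm 1 c (PS S) p *v (P l p *v v)) \<noteq> 0"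
    using block_nonzero[OF c _ nd l] by auto
  obtain a b where "P l p *v v = a *s e" "P l p *v w = b *s e" using e by blast
  then have "P l p *v v = (a / b) *s w"
    using w by (auto simp: vector_smult_assoc)
  then have "Az c (sub S) p *v (P l p *v v) = 0"
    by (simp add: mv_scale 0)
  then have "P (l + 1) p *v (Az c (sub S) p *v (P l p *v v)) = 0" by simp
  then show False using v by (auto simp: P_Az split: if_splits)
qed

lemma Azp_degree: "P (l + int n) p *v Azp n (P l p *v v) = Azp n (P l p *v v)"
proof (induction n)
  case 0
  show ?case by (simp add: P_orth)
next
  case (Suc n)
  have "P (l + int n + 1) p *v (Az c (sub S) p *v (P (l + int n) p *v Azp n (P l p *v v))) =
      Az c (sub S) p *v (P (l + int n) p *v Azp n (P l p *v v))"
    by (rule Az_shift)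
  then show ?case by (simp add: Suc algebra_simps)
qed

lemma Azp_outside: "l + int n \<notin> ix \<Longrightarrow> Azp n (P l p *v v) = 0"
  using Azp_degree[of l n v] P_outside[of "l + int n" p] by simp

text \<open>Powers of \<open>Az\<close> move along \<open>l\<close>, \<open>l + 1\<close>, and so
  on. The chain dies at the first step that does not cross the boundary of \<open>S\<close>.\<close>

lemma Azp_zero:
  assumes "i < n" "(l + int i + 1 \<in> S) = (l + int i \<in> S)"
  shows "Azp n (P l p *v v) = 0"
proof -
  have "Azp (Suc i) (P l p *v v) = Az c (sub S) p *v (P (l + int i) p *v Azp i (P l p *v v))"
    by (simp add: Azp_degree)
  also have "\<dots> = 0"
    by (rule Az_zero[OF assms(2)])
  finally have 0: "Azp (Suc i) (P l p *v v) = 0" .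
  have "n = (n - Suc i) + Suc i" using assms(1) by simp
  then have "Azp n (P l p *v v) = Azp (n - Suc i) (Azp (Suc i) (P l p *v v))"
    by (metis funpow_add o_apply)
  then show ?thesis by (simp only: 0 funpow_mv_0)
qed

text \<open>Non-zero arrows are injective on lines, so along an unbroken chain of them no vector is
  lost.\<close>

lemma Azp_nonzero:
  assumes nd: "nondegenerate_at c p"
    and l: "\<And>i. i \<le> n \<Longrightarrow> l + int i \<in> ix" "\<And>i. i < n \<Longrightarrow> (l + int i + 1 \<in> S) \<noteq> (l + int i \<in> S)"
    and w: "P l p *v w = w" "w \<noteq> 0"
  shows "Azp n w \<noteq> 0"
  using l
proof (induction n)
  case 0
  show ?case using w by simp
next
  case (Suc n)
  have "P (l + int n) p *v Azp n w = Azp n w"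
    using Azp_degree[of l n w] w by simp
  moreover have "Azp n w \<noteq> 0"
    by (rule Suc.IH) (use Suc.prems in auto)
  ultimately have "Az c (sub S) p *v Azp n w \<noteq> 0"
    using Suc.prems(1)[of n] Suc.prems(1)[of "Suc n"] Suc.prems(2)[of n]
    by (intro Az_nonzero[OF nd]) (auto simp: algebra_simps)
  then show ?case by simp
qed

lemma Azp_kills:
  assumes v: "v \<in> sub T p" and T: "\<And>l. l \<in> T \<Longrightarrow> l \<in> ix \<Longrightarrow> Azp n (P l p *v v) = 0"
  shows "Azp n v = 0"
proof -
  have "Azp n v = Azp n (\<Sum>l\<in>T \<inter> ix. P l p *v v)"
    using v by (simp add: mem_sub PS_mv)
  also have "\<dots> = 0"
    unfolding funpow_mv_sum by (rule sum.neutral) (use T in blast)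
  finally show ?thesis .
qed

end

lemma nilconformal_sub: "nilconformal \<A> (sub S)"
  unfolding nilconformal_def
proof (intro ballI)
  fix c p assume c: "c \<in> \<A>" "p \<in> fst c"
  \<comment> \<open>Seven steps to the right leave the range from -3 to 3 from any starting
    index.\<close>
  have "((\<lambda>x. Az c (sub S) p *v x) ^^ 7) v = 0" for v
    by (rule Azp_kills[OF c, of v UNIV]) (auto simp: mem_sub PS_UNIV ix_def intro!: Azp_outside[OF c])
  then show "\<exists>n. \<forall>v. ((\<lambda>x. Az c (sub S) p *v x) ^^ n) v = 0" by blast
qed

text \<open>The assumption says that from any index in \<open>S\<close> either the first step stays
  inside \<open>S\<close> or the second stays outside, so the chain breaks within two steps.\<close>

lemma s_number_1:
  assumes "\<And>l. l \<in> S \<Longrightarrow> l \<in> ix \<Longrightarrow> l + 1 \<in> S \<or> l + 2 \<notin> S"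
  shows "s_number \<A> (sub S) = 1"
  unfolding s_number_def
proof (rule Least_equality, intro conjI ballI)
  fix c p v assume c: "c \<in> \<A>" "p \<in> fst c" and "v \<in> (if even (1 - 1 :: nat) then sub S p else ocompl (sub S p))"
  then have v: "v \<in> sub S p" by simp
  show "((\<lambda>x. Az c (sub S) p *v x) ^^ (2 * 1)) v = 0"
  proof (rule Azp_kills[OF c v])
    fix l assume l: "l \<in> S" "l \<in> ix"
    show "((\<lambda>x. Az c (sub S) p *v x) ^^ (2 * 1)) (P l p *v v) = 0"
    proof (cases "l + 1 \<in> S")
      case True
      then show ?thesis using l by (intro Azp_zero[OF c, of 0]) auto
    next
      case False
      then show ?thesis
        using assms[OF l] by (intro Azp_zero[OF c, of 1]) (auto simp: add.commute[of 2 l])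
    qed
  qed
qed auto

text \<open>Membership alternates, so no chain breaks before the end of the sequence. For
  \<open>s = 1\<close> two steps lead from -2 to 0; for \<open>s = 2\<close> the complement is
  tested, and four steps lead from -3 to 1; for \<open>s = 3\<close> six steps start at -2 or later
  and pass beyond 3.\<close>

lemma s_number_3:
  assumes nd: "nondegenerate_at c p"
  shows "s_number \<A> (sub {-2, 0, 2}) = 3"
  unfolding s_number_def
proof (rule Least_equality, intro conjI ballI)
  let ?S = "{-2, 0, 2 :: int}"
  fix c p v assume c: "c \<in> \<A>" "p \<in> fst c" and "v \<in> (if even (3 - 1 :: nat) then sub ?S p else ocompl (sub ?S p))"
  then have v: "v \<in> sub ?S p" by simp
  show "((\<lambda>x. Az c (sub ?S) p *v x) ^^ (2 * 3)) v = 0"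
    by (rule Azp_kills[OF c v], rule Azp_outside[OF c]) (auto simp: ix_def)
next
  let ?S = "{-2, 0, 2 :: int}"
  fix s :: nat
  assume s: "0 < s \<and> (\<forall>c\<in>\<A>. \<forall>p\<in>fst c. \<forall>v\<in>(if even (s - 1) then sub ?S p else ocompl (sub ?S p)).
     ((\<lambda>x. Az c (sub ?S) p *v x) ^^ (2 * s)) v = 0)"
  have c: "c \<in> \<A>" "p \<in> fst c" using nd by (auto simp: nondegenerate_at_def)
  have ne: "s \<noteq> 1"
  proof
    assume s1: "s = 1"
    obtain w where w: "P (-2) p *v w = w" "w \<noteq> 0"
      using P_line[of "-2" p] by (auto simp: ix_def)
    have "w \<in> sub ?S p"
    proof -
      have "P k p *v w = 0" if "k \<noteq> -2" for k
        using P_orth[of k p "-2" w] w that by simp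
      then show ?thesis by (auto simp: sub_def)
    qed
    then have "((\<lambda>x. Az c (sub ?S) p *v x) ^^ 2) w = 0"
      using s c s1 by fastforce
    moreover have "((\<lambda>x. Az c (sub ?S) p *v x) ^^ 2) w \<noteq> 0"
      by (rule Azp_nonzero[OF c nd _ _ w]) (auto simp: ix_def less_Suc_eq numeral_eq_Suc)
    ultimately show False by simp
  qed
  have ne2: "s \<noteq> 2"
  proof
    assume s2: "s = 2"
    obtain w where w: "P (-3) p *v w = w" "w \<noteq> 0"
      using P_line[of "-3" p] by (auto simp: ix_def)
    have "w \<in> sub (- ?S) p"
    proof -
      have "P k p *v w = 0" if "k \<noteq> -3" for k
        using P_orth[of k p "-3" w] w that by simp
      then show ?thesis by (auto simp: sub_def)
    qed
    then have "w \<in> ocompl (sub ?S p)" by (simp only: ocompl_sub)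
    then have "((\<lambda>x. Az c (sub ?S) p *v x) ^^ 4) w = 0"
      using s c s2 by fastforce
    moreover have "((\<lambda>x. Az c (sub ?S) p *v x) ^^ 4) w \<noteq> 0"
      by (rule Azp_nonzero[OF c nd _ _ w]) (auto simp: ix_def less_Suc_eq numeral_eq_Suc)
    ultimately show False by simp
  qed
  show "3 \<le> s" using s ne ne2 by linarith
qed auto

text \<open>A constant bundle would have a constant projection, contradicting a non-zero arrow out
  of \<open>S\<close>.\<close>

lemma nonconstant_sub:
  assumes nd: "nondegenerate_at c p" and l: "l \<in> ix" "l + 1 \<in> ix" "l \<in> S" "l + 1 \<notin> S"
  shows "nonconstant (sub S)"
proof (rule ccontr)
  assume "\<not> nonconstant (sub S)"
  then have "sub S q = sub S p" for q by (auto simp: nonconstant_def)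
  then have "PS S q = PS S p" for q by (metis projm_sub)
  then have "PS S = (\<lambda>q. PS S p)" by blast
  then have "wdm 1 c (PS S) p = wdm 1 c (\<lambda>q. PS S p) p" by simp
  also have "\<dots> = 0"
    using nd by (intro wdm_const) (auto simp: nondegenerate_at_def)
  finally have "wdm 1 c (PS S) p = 0" .
  moreover have "\<exists>v. P (l + 1) p *v (wdm 1 c (PS S) p *v (P l p *v v)) \<noteq> 0"
    using nd l by (intro block_nonzero) (auto simp: nondegenerate_at_def)
  ultimately show False by simp
qed

lemma gauss_iterate:
  assumes nd: "\<And>p. \<not> p islimpt {q. \<not> (\<exists>c. nondegenerate_at c q)}"
    and s: "s \<in> {1, -1}" and i: "i \<le> 3"
  shows "(gauss s \<A> ^^ i) (sub {0}) = sub {s * int i}"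
  using i
proof (induction i)
  case (Suc i)
  have "shift s {s * int i} = {s * int (Suc i)}"
    using s by (auto simp: shift_def algebra_simps)
  moreover have "{s * int i} \<subseteq> ix"
    using s Suc.prems by (auto simp: ix_def)
  ultimately show ?case
    using Suc gauss_sub[OF nd s, of "{s * int i}"] by simp
qed simp

lemma bundle_sum3_sub:
  assumes "i \<in> {1, 2, 3 :: nat}"
  shows "bundle_sum3 (sub {- int i}) (sub {0}) (sub {int i}) = sub {- int i, 0, int i}"
proof (rule ext, rule set_eqI)
  fix p v
  have PS1: "PS {j} p *v v = P j p *v v" if "j \<in> ix" for j
    using that by (simp add: PS_mv)
  have i: "- int i \<in> ix" "0 \<in> ix" "int i \<in> ix" "int i \<noteq> 0"
    using assms by (auto simp: ix_def)
  show "v \<in> bundle_sum3 (sub {- int i}) (sub {0}) (sub {int i}) p \<longleftrightarrow> v \<in> sub {- int i, 0, int i} p"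
  proof
    assume "v \<in> sub {- int i, 0, int i} p"
    then have "PS {- int i, 0, int i} p *v v = v" by (simp add: mem_sub)
    then have "v = PS {- int i} p *v v + PS {0} p *v v + PS {int i} p *v v"
      using i by (simp add: PS1 PS_mv Int_insert_left add.assoc)
    then show "v \<in> bundle_sum3 (sub {- int i}) (sub {0}) (sub {int i}) p"
      unfolding bundle_sum3_def using PS_mem by blast
  next
    assume "v \<in> bundle_sum3 (sub {- int i}) (sub {0}) (sub {int i}) p"
    then show "v \<in> sub {- int i, 0, int i} p"
      unfolding bundle_sum3_def by (auto simp: sub_def matrix_vector_right_distrib)
  qed
qed

lemma graded_conclusion:
  assumes nd: "\<And>p. \<not> p islimpt {q. \<not> (\<exists>c. nondegenerate_at c q)}"
    and G2: "\<And>i p. i \<in> {1, 2, 3 :: nat} \<Longrightarrow> sub {- int i, 0, int i} p \<in> G2_SO4"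
    and phi: "\<And>i. \<phi> i = bundle_sum3 ((gauss2 \<A> ^^ i) (sub {0})) (sub {0}) ((gauss1 \<A> ^^ i) (sub {0}))"
  shows "(\<forall>i\<in>{1,2,3}. harmonic_into \<A> G2_SO4 (\<phi> i) \<and>
                       nonconstant (\<phi> i) \<and> nilconformal \<A> (\<phi> i)) \<and>
         (\<forall>i\<in>{1,3}. strongly_conformal \<A> (\<phi> i) \<and> s_number \<A> (\<phi> i) = 1) \<and>
         s_number \<A> (\<phi> 2) = 3"
proof -
  have \<phi>: "\<phi> i = sub {- int i, 0, int i}" if "i \<in> {1, 2, 3}" for i
    using gauss_iterate[OF nd, of 1 i] gauss_iterate[OF nd, of "-1" i] bundle_sum3_sub[OF that] that
    by (auto simp: phi gauss1_eq gauss2_eq)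
  \<comment> \<open>Degenerate points do not accumulate and the surface has no isolated points, so a
    nondegenerate point exists.\<close>
  obtain c q where q: "nondegenerate_at c q"
  proof -
    obtain p :: 'm where True by simp
    obtain U where U: "open U" "p \<in> U" "\<And>q. q \<in> U \<Longrightarrow> q \<noteq> p \<Longrightarrow> \<exists>c. nondegenerate_at c q"
      using nd[of p] unfolding islimpt_def by blast
    obtain q where "q \<in> U" "q \<noteq> p" using no_isolated_points[OF U(1,2)] by blast
    then show ?thesis using U(3) that by blast
  qed
  have "harmonic_into \<A> G2_SO4 (\<phi> i) \<and> nilconformal \<A> (\<phi> i)" if "i \<in> {1, 2, 3}" for i
    using \<phi>[OF that] harmonic_sub[OF G2[OF that]] nilconformal_sub by simp
  moreover have "nonconstant (\<phi> 1)" "nonconstant (\<phi> 2)" "nonconstant (\<phi> 3)"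
    using \<phi> nonconstant_sub[OF q, of 1] nonconstant_sub[OF q, of 2] nonconstant_sub[OF q, of 0]
    by (auto simp: ix_def)
  \<comment> \<open>The shifts are {2} and {-2} in the first case, {-2, 1, 4} and {-4, -1, 2} in the
    second. For {-2, 0, 2} they would meet in -1 and 1.\<close>
  moreover have "shift 1 {-1, 0, 1} \<inter> shift (-1) {-1, 0, 1} \<inter> ix = {}"
    "shift 1 {-3, 0, 3} \<inter> shift (-1) {-3, 0, 3} \<inter> ix = {}"
    by (auto simp: mem_shift)
  then have "strongly_conformal \<A> (\<phi> 1)" "strongly_conformal \<A> (\<phi> 3)"
    using \<phi> strongly_conformal_sub[OF nd, of "{-1, 0, 1}"] strongly_conformal_sub[OF nd, of "{-3, 0, 3}"]
    by (auto simp: ix_def)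
  moreover have "s_number \<A> (\<phi> 1) = 1" "s_number \<A> (\<phi> 3) = 1" "s_number \<A> (\<phi> 2) = 3"
  proof -
    have "s_number \<A> (sub {-1, 0, 1}) = 1" "s_number \<A> (sub {-3, 0, 3}) = 1"
      by (rule s_number_1; auto)+
    then show "s_number \<A> (\<phi> 1) = 1" "s_number \<A> (\<phi> 3) = 1" "s_number \<A> (\<phi> 2) = 3"
      using \<phi> s_number_3[OF q] by auto
  qed
  ultimately show ?thesis by blast
qed

end

section \<open>Local frames\<close>

text \<open>For \<open>e = 0\<close> division by zero makes this the zero matrix, the value required
  for indices outside \<open>ix\<close>.\<close>

definition line_proj :: "complex^7 \<Rightarrow> complex^7^7" where
  "line_proj e = (\<chi> a b. e $ a * cnj (e $ b) / herm e e)"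

lemma line_proj_mv: "line_proj e *v v = (herm v e / herm e e) *s e"
  by (simp add: vec_eq_iff mv_nth line_proj_def herm_def[of v] cdot_def sum_distrib_left
      sum_distrib_right sum_divide_distrib algebra_simps)

lemma line_proj_0: "line_proj 0 = 0"
  by (simp add: vec_eq_iff line_proj_def)

lemma line_proj_scale:
  assumes "a \<noteq> 0"
  shows "line_proj (a *s e) = line_proj e"
  using assms by (simp add: vec_eq_iff line_proj_def herm_scale_left herm_scale_right mult_ac)

lemma line_proj_self: "line_proj e *v e = e"
  by (cases "e = 0") (simp_all add: line_proj_mv)

lemma line_proj_herm: "herm (line_proj e *v v) w = herm v (line_proj e *v w)"
  by (simp add: line_proj_mv herm_scale_left herm_scale_right herm_cnj[of e w] herm_self)

lemma line_proj_orth: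
  assumes "herm e e' = 0"
  shows "line_proj e' *v (line_proj e *v v) = 0"
  using assms by (simp add: line_proj_mv herm_scale_left)

lemma line_proj_idem: "line_proj e *v (line_proj e *v v) = line_proj e *v v"
  by (simp add: line_proj_mv[of e v] mv_scale line_proj_self)

text \<open>Seven orthogonal non-zero vectors form a basis, and the projections read off its
  coefficients.\<close>

lemma line_proj_complete:
  assumes e0: "\<And>j. j \<in> ix \<Longrightarrow> e j \<noteq> 0"
    and orth: "\<And>j k. j \<in> ix \<Longrightarrow> k \<in> ix \<Longrightarrow> j \<noteq> k \<Longrightarrow> herm (e j) (e k) = 0"
  shows "(\<Sum>k\<in>ix. line_proj (e k) *v v) = v"
proof -
  have *: "line_proj (e k) *v (\<Sum>j\<in>ix. f j *s e j) = f k *s e k" if "k \<in> ix" for k f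
  proof -
    have "line_proj (e k) *v (\<Sum>j\<in>ix. f j *s e j) = (\<Sum>j\<in>ix. if j = k then f k *s e k else 0)"
      unfolding mv_sum using orth that
      by (intro sum.cong) (auto simp: mv_scale line_proj_self line_proj_mv)
    then show ?thesis using that by simp
  qed
  have inj: "inj_on e ix" and ind: "vec.independent (e ` ix)"
    by (rule orthogonal_family; use e0 orth in simp)+
  have "card ix = 7" by (simp add: ix_def)
  then have "card (e ` ix) = 7"
    by (simp add: card_image[OF inj])
  then have "vec.dim (UNIV :: (complex^7) set) \<le> card (e ` ix)"
    unfolding vec_dim_card by simp
  from vec.card_ge_dim_independent[OF subset_UNIV ind this]
  have "v \<in> vec.span (e ` ix)" by blast
  then obtain f where "v = (\<Sum>x\<in>e ` ix. f x *s x)"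
    using vec.span_finite[of "e ` ix"] by auto
  then have v: "v = (\<Sum>j\<in>ix. f (e j) *s e j)"
    using sum.reindex[OF inj, of "\<lambda>x. f x *s x"] by simp
  have "(\<Sum>k\<in>ix. line_proj (e k) *v v) = (\<Sum>k\<in>ix. f (e k) *s e k)"
    using *[of _ "\<lambda>j. f (e j)"] by (intro sum.cong) (simp_all add: v)
  then show ?thesis using v by simp
qed

context riemann
begin

lemma smooth_cdot:
  assumes "open U" "smooth_map \<A> U u" "smooth_map \<A> U v"
  shows "smooth_map \<A> U (\<lambda>q. cdot (u q) (v q))"
  unfolding cdot_def using assms(2,3) unfolding smooth_map_vec[OF assms(1)]
  by (intro smooth_map_sum smooth_map_mult assms(1)) auto

lemma smooth_conj:
  assumes "open U" "smooth_map \<A> U u"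
  shows "smooth_map \<A> U (\<lambda>q. conj_vec (u q))"
  using assms(2) unfolding smooth_map_vec[OF assms(1)] conj_vec_nth
  by (intro allI smooth_map_cnj assms(1)) auto

lemma smooth_scale:
  fixes u :: "'m \<Rightarrow> complex^7"
  assumes "open U" "smooth_map \<A> U a" "smooth_map \<A> U u"
  shows "smooth_map \<A> U (\<lambda>q. a q *s u q)"
  using assms(3) unfolding smooth_map_vec[OF assms(1)] vector_smult_component
  by (intro allI smooth_map_mult assms(1,2)) auto

lemma smooth_ccross:
  assumes "open U" "smooth_map \<A> U u" "smooth_map \<A> U v"
  shows "smooth_map \<A> U (\<lambda>q. ccross (u q) (v q))"
proof -
  obtain K where K: "\<And>u v k. ccross u v $ k = (\<Sum>i\<in>UNIV. u $ i * (\<Sum>j\<in>UNIV. K i j k * v $ j))"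
    using ccross_expand by blast
  show ?thesis
    using assms(2,3) unfolding smooth_map_vec[OF assms(1)] K
    by (intro allI smooth_map_sum smooth_map_mult smooth_map_const assms(1)) auto
qed

lemma smooth_herm:
  assumes "open U" "smooth_map \<A> U u" "smooth_map \<A> U v"
  shows "smooth_map \<A> U (\<lambda>q. herm (u q) (v q))"
  unfolding herm_def by (intro smooth_cdot smooth_conj assms)

lemma smooth_line_proj:
  assumes "open U" "smooth_map \<A> U e" "\<And>q. q \<in> U \<Longrightarrow> e q \<noteq> 0"
  shows "smooth_map \<A> U (\<lambda>q. line_proj (e q))"
  unfolding smooth_map_vec[OF assms(1)]
proof (intro allI)
  fix i j
  have "smooth_map \<A> U (\<lambda>q. e q $ i)" for i
    using assms(2) unfolding smooth_map_vec[OF assms(1)] by blast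
  then have "smooth_map \<A> U (\<lambda>q. e q $ i * cnj (e q $ j) / herm (e q) (e q))"
    using assms by (intro smooth_map_divide smooth_map_mult smooth_map_cnj smooth_herm) auto
  then show "smooth_map \<A> U (\<lambda>q. line_proj (e q) $ i $ j)"
    by (simp add: line_proj_def)
qed

text \<open>Differentiating \<open>P j e l = e l\<close> or \<open>0\<close> expresses derivatives
  of the projections by those of the frame. The component of the derivative of \<open>e l\<close>
  along \<open>e l\<close> itself, which depends on the scaling, cancels.\<close>

lemma frame_degree:
  fixes e :: "int \<Rightarrow> 'm \<Rightarrow> complex^7" and P :: "int \<Rightarrow> 'm \<Rightarrow> complex^7^7"
  assumes c: "c \<in> \<A>" "q \<in> fst c" and U: "open U" "q \<in> U"
    and sm: "\<And>j. smooth_map \<A> U (e j)"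
    and e0: "\<And>j r. r \<in> U \<Longrightarrow> e j r = 0 \<longleftrightarrow> j \<notin> ix"
    and orth: "\<And>j k r. r \<in> U \<Longrightarrow> j \<noteq> k \<Longrightarrow> herm (e j r) (e k r) = 0"
    and P: "\<And>j r. r \<in> U \<Longrightarrow> P j r = line_proj (e j r)"
    and D: "\<And>j k. k \<noteq> j \<Longrightarrow> k \<noteq> j + s \<Longrightarrow> herm (wdv s c (e j) q) (e k q) = 0"
  shows "k \<noteq> l + s \<Longrightarrow> P k q *v (wdm s c (P j) q *v (P l q *v v)) = 0"
    and "s \<noteq> 0 \<Longrightarrow> herm (wdv s c (e l) q) (e (l + s) q) \<noteq> 0 \<Longrightarrow>
      P (l + s) q *v (wdm s c (P l) q *v (P l q *v e l q)) \<noteq> 0"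
proof -
  have smP: "smooth_map \<A> U (P j)" for j
  proof (cases "j \<in> ix")
    case True
    then have "smooth_map \<A> U (\<lambda>q. line_proj (e j q))"
      using e0 by (intro smooth_line_proj U sm) blast
    then show ?thesis by (rule smooth_map_cong[OF U(1)]) (simp add: P)
  next
    case False
    have "P j r = 0" if "r \<in> U" for r
      using e0[OF that, of j] False by (simp add: P[OF that] line_proj_0)
    then show ?thesis
      by (intro smooth_map_cong[OF U(1) smooth_map_const[of U 0]]) simp
  qed
  have Pe: "P j r *v e l r = (if j = l then e l r else 0)" if "r \<in> U" for j l r
    using orth[OF that, of l j] by (simp add: P[OF that] line_proj_self line_proj_mv)
  have DP: "wdm s c (P j) q *v e l q = (if j = l then wdv s c (e l) q else 0) - P j q *v wdv s c (e l) q" for j l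
  proof -
    have "wdv s c (\<lambda>r. P j r *v e l r) q = wdv s c (if j = l then e l else (\<lambda>r. 0)) q"
      by (rule wdv_local[OF c U]) (simp add: Pe)
    also have "\<dots> = (if j = l then wdv s c (e l) q else 0)"
      using wdv_const[OF c] by simp
    finally show ?thesis
      using wdv_mv[OF c smooth_map_diffm_at[OF U(1) smP U(2) c] smooth_map_diffv_at[OF U(1) sm U(2) c], of s j l]
      by (simp add: eq_diff_eq)
  qed
  have off: "P k q *v wdv s c (e l) q = 0" if "k \<noteq> l" "k \<noteq> l + s" for k l
    using D[OF that] by (simp add: P[OF U(2)] line_proj_mv)
  have PP: "P k q *v (P j q *v v) = (if k = j then P j q *v v else 0)" for k j v
    using orth[OF U(2), of j k] by (simp add: P[OF U(2)] line_proj_idem line_proj_orth)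
  show "P k q *v (wdm s c (P j) q *v (P l q *v v)) = 0" if k: "k \<noteq> l + s" for k l j v
  proof -
    obtain a where a: "P l q *v v = a *s e l q"
      unfolding P[OF U(2)] line_proj_mv by blast
    have "P k q *v (wdm s c (P j) q *v e l q) = 0"
      using k off[of k l] by (auto simp: DP matrix_vector_mult_diff_distrib PP)
    then show ?thesis by (simp add: a mv_scale)
  qed
  assume "s \<noteq> 0" and ne: "herm (wdv s c (e l) q) (e (l + s) q) \<noteq> 0"
  then have "P (l + s) q *v (wdm s c (P l) q *v (P l q *v e l q)) = P (l + s) q *v wdv s c (e l) q"
    by (simp add: Pe[OF U(2)] DP matrix_vector_mult_diff_distrib PP)
  also have "\<dots> \<noteq> 0"
    using ne by (auto simp: P[OF U(2)] line_proj_mv)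
  finally show "P (l + s) q *v (wdm s c (P l) q *v (P l q *v e l q)) \<noteq> 0" .
qed

end

section \<open>Superhorizontal maps\<close>

lemma ocompl_ocompl:
  assumes W: "vec.subspace W"
  shows "ocompl (ocompl W) = W"
proof
  show "W \<subseteq> ocompl (ocompl W)"
  proof
    fix v assume "v \<in> W"
    then have "herm w v = 0" if "w \<in> ocompl W" for w using that by (simp add: ocompl_def)
    then have "herm v w = 0" if "w \<in> ocompl W" for w
      using that herm_cnj[of v w] by simp
    then show "v \<in> ocompl (ocompl W)" by (simp add: ocompl_def)
  qed
  show "ocompl (ocompl W) \<subseteq> W"
  proof
    fix v assume v: "v \<in> ocompl (ocompl W)"
    let ?u = "oproj W v"
    have u: "?u \<in> W" "v - ?u \<in> ocompl W" using oproj_exists[OF W] by auto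
    have "herm v (v - ?u) = 0"
      using v u(2) unfolding ocompl_def by blast
    moreover have "herm (v - ?u) ?u = 0"
      using u unfolding ocompl_def by blast
    then have "herm ?u (v - ?u) = 0"
      using herm_cnj[of ?u "v - ?u"] by simp
    ultimately have "herm (v - ?u) (v - ?u) = 0"
      by (simp add: herm_diff_left)
    then show "v \<in> W" using u(1) by simp
  qed
qed

lemma quadric5_span:
  assumes L: "L \<in> quadric5" and v: "v \<in> L" "v \<noteq> 0"
  shows "L = vec.span {v}"
proof
  have sub: "vec.subspace L" "vec.dim L = 1" using L by (auto simp: quadric5_def)
  show "vec.span {v} \<subseteq> L"
    using v sub by (intro vec.span_minimal) auto
  have "vec.independent {v}" using v by simp
  then show "L \<subseteq> vec.span {v}"
    using v sub by (intro vec.card_ge_dim_independent) auto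
qed

text \<open>The exponent 0 covers the case that \<open>f\<close> does not vanish at
  \<open>a\<close>, so both cases can be used uniformly.\<close>

lemma holomorphic_factor:
  assumes f: "f holomorphic_on ball a r" "r > 0" and nz: "\<exists>x\<in>ball a r. f x \<noteq> 0"
  shows "\<exists>m g r'. 0 < r' \<and> r' \<le> r \<and> g holomorphic_on ball a r' \<and>
    (\<forall>w\<in>ball a r'. f w = (w - a) ^ m * g w \<and> g w \<noteq> 0)"
proof (cases "f a = 0")
  case True
  have "\<not> f constant_on ball a r"
    using nz True f(2) by (force simp: constant_on_def)
  then obtain g s n where g: "0 < n" "0 < s" "ball a s \<subseteq> ball a r" "g holomorphic_on ball a s"
      "\<And>w. w \<in> ball a s \<Longrightarrow> f w = (w - a) ^ n * g w" "\<And>w. w \<in> ball a s \<Longrightarrow> g w \<noteq> 0"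
    using holomorphic_factor_zero_nonconstant[OF f(1) open_ball connected_ball _ True] f(2)
    by (metis centre_in_ball)
  have "ball a (min s r) \<subseteq> ball a s" by auto
  then show ?thesis
    using g f(2) by (intro exI[of _ n] exI[of _ g] exI[of _ "min s r"])
      (auto intro: holomorphic_on_subset)
next
  case False
  have "continuous_on (ball a r) f" using f holomorphic_on_imp_continuous_on by blast
  then have "isCont f a" using f(2) by (simp add: continuous_on_eq_continuous_at)
  then obtain e where e: "e > 0" "\<forall>y. dist a y < e \<longrightarrow> f y \<noteq> 0"
    using continuous_at_avoid[of a f 0] False by blast
  have "ball a (min e r) \<subseteq> ball a r" by auto
  then show ?thesis
    using e f by (intro exI[of _ 0] exI[of _ f] exI[of _ "min e r"])
      (auto intro: holomorphic_on_subset)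
qed

lemma deriv_zero_constant:
  assumes f: "f holomorphic_on ball a r" and d: "\<And>x. x \<in> ball a r \<Longrightarrow> deriv f x = 0"
  shows "\<exists>b. \<forall>x\<in>ball a r. f x = b"
proof (rule has_field_derivative_zero_constant)
  fix x assume x: "x \<in> ball a r"
  have "(f has_field_derivative 0) (at x)"
    using holomorphic_derivI[OF f open_ball x, of UNIV] unfolding d[OF x] .
  then show "(f has_field_derivative 0) (at x within ball a r)"
    by (rule has_field_derivative_at_within)
qed simp

section \<open>Holomorphic functions of one coordinate as maps on the surface\<close>

context riemann
begin

lemma wd_field:
  assumes "in_chart c f field_differentiable at (snd c p)"
  shows "wd 1 c f p = deriv (in_chart c f) (snd c p)" and "wd (-1) c f p = 0"
proof -
  have "(in_chart c f has_derivative (*) (deriv (in_chart c f) (snd c p))) (at (snd c p))"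
    using assms field_differentiable_derivI has_field_derivative_def by blast
  from wd_eqI[OF this, where s = 1] wd_eqI[OF this, where s = "-1"]
  show "wd 1 c f p = deriv (in_chart c f) (snd c p)" "wd (-1) c f p = 0"
    by (simp_all add: algebra_simps)
qed

lemma holomorphic_map_wdv:
  assumes "open U" "holomorphic_map \<A> U H" "c \<in> \<A>" "p \<in> U" "p \<in> fst c"
  shows "wdv (-1) c H p = 0"
proof -
  have "in_chart c (\<lambda>q. H q $ k) field_differentiable at (snd c p)" for k
    using assms open_chart_image[OF assms(3,1)] unfolding holomorphic_map_def
    by (meson IntI holomorphic_on_imp_differentiable_at image_eqI)
  then show ?thesis by (simp add: vec_eq_iff wdv_def wd_field)
qed

lemma chart_inj:
  assumes "c \<in> \<A>" shows "inj_on (snd c) (fst c)"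
  by (rule inj_on_inverseI[where g = "inv_into (fst c) (snd c)"]) (rule inv_chart[OF assms])

lemma transition_holomorphic:
  "c \<in> \<A> \<Longrightarrow> d \<in> \<A> \<Longrightarrow> in_chart c (snd d) holomorphic_on snd c ` (fst c \<inter> fst d)"
  using riemann unfolding riemann_surface_def by blast

text \<open>Sections are constructed in the coordinate of a single chart, while holomorphy refers to
  all charts; the transition functions mediate.\<close>

definition chart_fun :: "'m chart \<Rightarrow> (7 \<Rightarrow> complex \<Rightarrow> complex) \<Rightarrow> 'm \<Rightarrow> complex^7" where
  "chart_fun d \<eta> q = (\<chi> i. \<eta> i (snd d q))"

context
  fixes d B U and \<eta> :: "7 \<Rightarrow> complex \<Rightarrow> complex"
  assumes d: "d \<in> \<A>" and B: "open B"
    and \<eta>: "\<And>i. \<eta> i holomorphic_on B" and U_def: "U = {q \<in> fst d. snd d q \<in> B}"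
begin

lemma chart_fun_holomorphic: "holomorphic_map \<A> U (chart_fun d \<eta>)"
  unfolding holomorphic_map_def
proof (intro ballI allI)
  fix c k assume c: "c \<in> \<A>"
  have "in_chart c (snd d) holomorphic_on snd c ` (U \<inter> fst c)"
    by (rule holomorphic_on_subset[OF transition_holomorphic[OF c d]]) (auto simp: U_def)
  moreover have "in_chart c (snd d) ` (snd c ` (U \<inter> fst c)) \<subseteq> B"
    using c by (auto simp: in_chart_at U_def)
  ultimately have "\<eta> k \<circ> in_chart c (snd d) holomorphic_on snd c ` (U \<inter> fst c)"
    using holomorphic_on_compose_gen \<eta> by blast
  moreover have "in_chart c (\<lambda>p. chart_fun d \<eta> p $ k) = \<eta> k \<circ> in_chart c (snd d)"
    by (simp add: fun_eq_iff in_chart_apply chart_fun_def)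
  ultimately show "in_chart c (\<lambda>p. chart_fun d \<eta> p $ k) holomorphic_on snd c ` (U \<inter> fst c)"
    by simp
qed

lemma chart_fun_wdv:
  assumes c: "c \<in> \<A>" "q \<in> fst c" "q \<in> U"
  shows "wdv 1 c (chart_fun d \<eta>) q = wd 1 c (snd d) q *s chart_fun d (\<lambda>i. deriv (\<eta> i)) q"
proof -
  have V: "open (snd c ` (fst d \<inter> fst c))"
    using open_chart_image[OF c(1) chart_homeo(2)[OF d]] .
  have q: "q \<in> fst d" "snd d q \<in> B" using c(3) by (auto simp: U_def)
  have at: "in_chart c (snd d) (snd c q) = snd d q"
    using in_chart_at[OF c(1,2)] .
  have t: "in_chart c (snd d) field_differentiable at (snd c q)"
    using transition_holomorphic[OF c(1) d] V q c
    by (intro holomorphic_on_imp_differentiable_at[of _ "snd c ` (fst d \<inter> fst c)"]) (auto simp: Int_commute)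
  have e: "\<eta> i field_differentiable at (in_chart c (snd d) (snd c q))" for i
    unfolding at by (rule holomorphic_on_imp_differentiable_at[OF \<eta> B q(2)])
  have eq: "in_chart c (\<lambda>p. chart_fun d \<eta> p $ i) = \<eta> i \<circ> in_chart c (snd d)" for i
    by (simp add: fun_eq_iff in_chart_apply chart_fun_def)
  have "wd 1 c (\<lambda>p. chart_fun d \<eta> p $ i) q = deriv (\<eta> i) (snd d q) * deriv (in_chart c (snd d)) (snd c q)" for i
  proof -
    have "wd 1 c (\<lambda>p. chart_fun d \<eta> p $ i) q = deriv (\<eta> i \<circ> in_chart c (snd d)) (snd c q)"
      using wd_field(1)[of c "\<lambda>p. chart_fun d \<eta> p $ i" q] field_differentiable_compose[OF t e, of i]
      unfolding eq by simp
    also have "\<dots> = deriv (\<eta> i) (snd d q) * deriv (in_chart c (snd d)) (snd c q)"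
      using deriv_chain[OF t e] at by simp
    finally show ?thesis .
  qed
  then show ?thesis
    using wd_field(1)[OF t] by (simp add: vec_eq_iff wdv_def chart_fun_def)
qed

lemma wd_own_chart:
  assumes "q \<in> U"
  shows "wd 1 d (snd d) q = 1"
proof -
  have q: "q \<in> fst d" using assms by (auto simp: U_def)
  have V: "open (snd d ` fst d)" "snd d q \<in> snd d ` fst d"
    using chart_homeo(3)[OF d] q by auto
  have "(in_chart d (snd d) has_field_derivative 1) (at (snd d q))"
    by (rule has_field_derivative_transform_within_open[OF DERIV_ident V])
      (auto simp: in_chart_at[OF d])
  then show ?thesis
    using wd_field(1)[of d "snd d" q] DERIV_imp_deriv field_differentiable_def by metis
qed

end

end

section \<open>Fullness and adapted holomorphic sections\<close>

locale bryant_setup = riemann \<A> for \<A> :: "'m::t2_space chart set" +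
  fixes h :: "'m \<Rightarrow> (complex^7) set"
  assumes hol: "holomorphic_to_quadric \<A> h" and full: "full_map h" and sh: "superhorizontal \<A> h"
begin

lemma h_quadric: "h p \<in> quadric5"
  using hol by (simp add: holomorphic_to_quadric_def)

lemma h_subspace: "vec.subspace (h p)"
  using h_quadric[of p] by (simp add: quadric5_def)

text \<open>By the identity theorem and connectedness, fullness is a local property.\<close>

lemma full_local:
  assumes V: "open V" "V \<noteq> {}" and W: "vec.subspace W" and hW: "\<And>q. q \<in> V \<Longrightarrow> h q \<subseteq> W"
  shows "W = UNIV"
proof -
  define S where "S = {p. \<exists>N. open N \<and> p \<in> N \<and> (\<forall>q\<in>N. h q \<subseteq> W)}"
  have "open S"
    unfolding S_def open_subopen[of "{p. _ p}"] by blast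
  moreover have "open (- S)"
  proof (subst open_subopen, safe)
    fix p assume p: "p \<notin> S"
    obtain U H where U: "open U" "p \<in> U" "holomorphic_map \<A> U H" "local_section h U H" "\<forall>q\<in>U. H q \<noteq> 0"
      using hol unfolding holomorphic_to_quadric_def by blast
    obtain c where c: "c \<in> \<A>" "p \<in> fst c" using chart_exists by blast
    have "open (snd c ` (U \<inter> fst c))" "snd c p \<in> snd c ` (U \<inter> fst c)"
      using open_chart_image c U by auto
    then obtain r where r: "r > 0" "ball (snd c p) r \<subseteq> snd c ` (U \<inter> fst c)"
      using openE by blast
    define T where "T = {q \<in> fst c. snd c q \<in> ball (snd c p) r}"
    have T: "open T" "p \<in> T"
      using open_chart_preimage[OF c(1) open_ball] c r by (auto simp: T_def)
    have TU: "q \<in> U" if "q \<in> T" for q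
    proof -
      have q: "q \<in> fst c" "snd c q \<in> ball (snd c p) r"
        using that by (simp_all add: T_def)
      have "snd c q \<in> snd c ` (U \<inter> fst c)"
        by (rule subsetD[OF r(2) q(2)])
      then have "q \<in> U \<inter> fst c"
        by (subst (asm) inj_on_image_mem_iff[OF chart_inj[OF c(1)] q(1)]) simp_all
      then show ?thesis by simp
    qed
    have "q \<notin> S" if "q \<in> T" for q
    proof
      assume "q \<in> S"
      then obtain N where N: "open N" "q \<in> N" "\<forall>q\<in>N. h q \<subseteq> W" unfolding S_def by blast
      have "h q' \<subseteq> W" if q': "q' \<in> T" for q'
      proof -
        have "herm (H q') w = 0" if w: "w \<in> ocompl W" for w
        proof -
          \<comment> \<open>Each linear equation of \<open>W\<close>, evaluated on the section, is
            holomorphic in the coordinate and vanishes on a non-empty open part of the ball, hence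
            on the whole ball.\<close>
          let ?f = "\<lambda>x. \<Sum>k\<in>UNIV. in_chart c (\<lambda>p. H p $ k) x * cnj (w $ k)"
          let ?N = "snd c ` (N \<inter> T \<inter> fst c)"
          have f: "?f (snd c s) = herm (H s) w" if "s \<in> fst c" for s
            by (simp add: herm_def cdot_def in_chart_at[OF c(1) that])
          have "?f holomorphic_on ball (snd c p) r"
            using U(3) c(1) holomorphic_on_subset[OF _ r(2)] unfolding holomorphic_map_def
            by (intro holomorphic_intros) auto
          moreover have "?f x = 0" if x: "x \<in> ?N" for x
          proof -
            obtain s where s: "s \<in> N" "s \<in> T" "s \<in> fst c" "x = snd c s" using x by blast
            have "H s \<in> W"
              using s N(3) U(4) TU by (auto simp: local_section_def)
            then have "herm w (H s) = 0" using w by (simp add: ocompl_def)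
            then have "herm (H s) w = 0" using herm_cnj[of "H s" w] by simp
            then show ?thesis using f[OF s(3)] s(4) by simp
          qed
          moreover have "open ?N"
            using open_chart_image[OF c(1)] N(1) T(1) by (simp add: open_Int)
          moreover have "?N \<subseteq> ball (snd c p) r" "?N \<noteq> {}"
            using N(2) \<open>q \<in> T\<close> by (auto simp: T_def)
          moreover have "snd c q' \<in> ball (snd c p) r" using q' by (simp add: T_def)
          ultimately have "?f (snd c q') = 0"
            using analytic_continuation_open[of ?N "ball (snd c p) r" ?f "\<lambda>_. 0" "snd c q'"] by auto
          then show ?thesis using f q' by (simp add: T_def)
        qed
        then have "H q' \<in> ocompl (ocompl W)" by (simp add: ocompl_def)
        then have "H q' \<in> W" by (simp add: ocompl_ocompl[OF W])
        moreover have "h q' = vec.span {H q'}"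
          using U(4,5) TU[OF q'] by (intro quadric5_span h_quadric) (auto simp: local_section_def)
        ultimately show ?thesis
          using W by (simp add: vec.span_minimal)
      qed
      then have "p \<in> S" using T unfolding S_def by blast
      then show False using p by blast
    qed
    then show "\<exists>T. open T \<and> p \<in> T \<and> T \<subseteq> - S" using T by blast
  qed
  moreover have "S \<noteq> {}" using V hW unfolding S_def by blast
  moreover have "connected (UNIV :: 'm set)"
    using riemann by (simp add: riemann_surface_def)
  ultimately have "S = UNIV"
    unfolding connected_clopen
    by (auto simp: open_openin[symmetric] closed_closedin[symmetric] closed_def)
  then have "h p \<subseteq> W" for p unfolding S_def by blast
  then show ?thesis using full W unfolding full_map_def by blast
qed

end

text \<open>Normalisation in two different coordinates makes the two vectors linearly independent,
  so the Gram-Schmidt step cannot yield zero.\<close>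

lemma orthogonal_part_nonzero:
  assumes "k \<noteq> l" "H $ k = (1::complex)" "K $ k = 0" "K $ l = 1"
  shows "K - a *s H \<noteq> 0"
proof
  assume 0: "K - a *s H = 0"
  from arg_cong[OF this, of "\<lambda>v. v $ k"] have "a = 0" using assms by simp
  then show False using arg_cong[OF 0, of "\<lambda>v. v $ l"] assms by simp
qed

context bryant_setup
begin

text \<open>Normalized holomorphic sections \<open>H\<close> of \<open>h\<close> and \<open>K\<close> such that \<open>H' \<in> span {K}\<close>: the span of
  \<open>H\<close> and \<open>K\<close> extends \<open>span {H, H'}\<close> over \<open>p\<close>.\<close>

definition adapted :: "'m \<Rightarrow> 'm set \<Rightarrow> ('m \<Rightarrow> complex^7) \<Rightarrow> ('m \<Rightarrow> complex^7) \<Rightarrow> bool" where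
  "adapted p U H K \<longleftrightarrow> open U \<and> p \<in> U \<and> holomorphic_map \<A> U H \<and> holomorphic_map \<A> U K \<and>
     local_section h U H \<and>
     (\<exists>k l. k \<noteq> l \<and> (\<forall>q\<in>U. H q $ k = 1 \<and> K q $ k = 0 \<and> K q $ l = 1)) \<and>
     (\<forall>c\<in>\<A>. \<forall>q\<in>U \<inter> fst c. \<exists>a. wdv 1 c H q = a *s K q) \<and>
     (\<exists>d\<in>\<A>. U \<subseteq> fst d \<and> (\<forall>q\<in>U - {p}. wdv 1 d H q \<noteq> 0 \<and> wdv 1 d K q \<noteq> 0))"

lemma span_pair_neq_UNIV: "vec.span {a, b :: complex^7} \<noteq> UNIV"
proof
  assume "vec.span {a, b} = UNIV"
  then have "vec.dim (UNIV :: (complex^7) set) \<le> card {a, b}"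
    by (intro vec.dim_le_card) auto
  also have "\<dots> \<le> 2" by (simp add: card_insert_if)
  finally show False unfolding vec_dim_card by simp
qed

lemma not_in_plane:
  assumes V: "open V" "V \<noteq> {}" and s: "\<And>q. q \<in> V \<Longrightarrow> H q \<in> h q \<and> H q \<noteq> 0 \<and> H q \<in> vec.span {a, b}"
  shows False
proof -
  have "vec.span {a, b} = UNIV"
  proof (rule full_local[OF V vec.subspace_span])
    fix q assume q: "q \<in> V"
    then have "h q = vec.span {H q}"
      using s by (intro quadric5_span h_quadric) auto
    then show "h q \<subseteq> vec.span {a, b}"
      using s[OF q] by (simp add: vec.span_minimal)
  qed
  then show False using span_pair_neq_UNIV by blast
qed

text \<open>Where the derivative of the section vanishes its direction still has a limit: after
  division by the coordinate derivative of least vanishing order, the quotient extends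
  holomorphically and becomes \<open>K\<close>. Fullness excludes that the derivatives of
  \<open>H\<close> or \<open>K\<close> vanish identically.\<close>

lemma adapted_exists: "\<exists>U H K. adapted p U H K"
proof -
  obtain U0 H0 where U0: "open U0" "p \<in> U0" "holomorphic_map \<A> U0 H0" "local_section h U0 H0" "\<forall>q\<in>U0. H0 q \<noteq> 0"
    using hol unfolding holomorphic_to_quadric_def by blast
  obtain d where d: "d \<in> \<A>" "p \<in> fst d" using chart_exists by blast
  obtain k where k: "H0 p $ k \<noteq> 0"
    using U0(2,5) by (auto simp: vec_eq_iff)
  define x0 where "x0 = snd d p"
  define g where "g i = in_chart d (\<lambda>q. H0 q $ i)" for i
  have V0: "open (snd d ` (U0 \<inter> fst d))" "x0 \<in> snd d ` (U0 \<inter> fst d)"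
    using open_chart_image[OF d(1) U0(1)] U0(2) d(2) by (auto simp: x0_def)
  have g: "g i holomorphic_on snd d ` (U0 \<inter> fst d)" for i
    using U0(3) d(1) unfolding holomorphic_map_def g_def by blast
  have gd: "g i (snd d q) = H0 q $ i" if "q \<in> fst d" for q i
    unfolding g_def by (rule in_chart_at[OF d(1) that])
  have "isCont (g k) x0"
    using holomorphic_on_imp_continuous_on[OF g] V0 continuous_on_eq_continuous_at by blast
  moreover have "g k x0 \<noteq> 0" using gd[OF d(2)] k by (simp add: x0_def)
  ultimately obtain e where e: "e > 0" "\<forall>y. dist x0 y < e \<longrightarrow> g k y \<noteq> 0"
    using continuous_at_avoid[of x0 "g k" 0] by blast
  obtain e' where e': "e' > 0" "ball x0 e' \<subseteq> snd d ` (U0 \<inter> fst d)"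
    using V0 openE by blast
  define r where "r = min e e'"
  have r: "r > 0" "ball x0 r \<subseteq> snd d ` (U0 \<inter> fst d)" "\<And>y. y \<in> ball x0 r \<Longrightarrow> g k y \<noteq> 0"
    using e e' by (auto simp: r_def)
  \<comment> \<open>Division by a coordinate that does not vanish at \<open>p\<close> normalises the
    section to have this coordinate equal to 1.\<close>
  define \<eta> where "\<eta> i x = g i x / g k x" for i x
  have \<eta>: "\<eta> i holomorphic_on ball x0 r" for i
    unfolding \<eta>_def[abs_def] using r(2,3) g holomorphic_on_subset
    by (intro holomorphic_on_divide) blast+
  have \<eta>': "deriv (\<eta> i) holomorphic_on ball x0 r" for i
    by (rule holomorphic_deriv[OF \<eta> open_ball])
  have \<eta>k: "\<eta> k x = 1" if "x \<in> ball x0 r" for x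
    using r(3)[OF that] by (simp add: \<eta>_def)
  define T where "T s = {q \<in> fst d. snd d q \<in> ball x0 s}" for s
  have T: "open (T s)" "s > 0 \<Longrightarrow> p \<in> T s" for s
    using open_chart_preimage[OF d(1) open_ball] d(2) by (auto simp: T_def x0_def)
  have sec: "chart_fun d \<eta> q \<in> h q \<and> chart_fun d \<eta> q \<noteq> 0 \<and> chart_fun d \<eta> q $ k = 1" if "q \<in> T r" for q
  proof -
    have q: "q \<in> fst d" "snd d q \<in> ball x0 r" using that by (simp_all add: T_def)
    have "snd d q \<in> snd d ` (U0 \<inter> fst d)" by (rule subsetD[OF r(2) q(2)])
    then have qU: "q \<in> U0 \<inter> fst d"
      by (subst (asm) inj_on_image_mem_iff[OF chart_inj[OF d(1)] q(1)]) simp_all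
    have "chart_fun d \<eta> q = (1 / g k (snd d q)) *s H0 q"
      by (simp add: chart_fun_def vec_eq_iff \<eta>_def gd[OF q(1)])
    moreover have "H0 q \<in> h q" using U0(4) qU by (simp add: local_section_def)
    ultimately have "chart_fun d \<eta> q \<in> h q"
      using vec.subspace_scale[OF h_subspace] by simp
    moreover have k1: "chart_fun d \<eta> q $ k = 1"
      using \<eta>k[OF q(2)] by (simp add: chart_fun_def)
    moreover have "chart_fun d \<eta> q \<noteq> 0" using k1 by auto
    ultimately show ?thesis by blast
  qed
  \<comment> \<open>The non-constant coordinates. The normalised coordinate \<open>k\<close> is not
    among them, and if there were none, \<open>h\<close> would be constant.\<close>
  define I where "I = {i. \<exists>x\<in>ball x0 r. deriv (\<eta> i) x \<noteq> 0}"
  have I0: "deriv (\<eta> i) x = 0" if "i \<notin> I" "x \<in> ball x0 r" for i x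
    using that by (auto simp: I_def)
  have kI: "k \<notin> I"
  proof -
    have "deriv (\<eta> k) x = 0" if x: "x \<in> ball x0 r" for x
    proof -
      have "(\<eta> k has_field_derivative 0) (at x)"
        by (rule has_field_derivative_transform_within_open[OF DERIV_const[of 1] open_ball x])
          (simp add: \<eta>k)
      then show ?thesis by (rule DERIV_imp_deriv)
    qed
    then show ?thesis by (auto simp: I_def)
  qed
  have "I \<noteq> {}"
  proof
    assume I: "I = {}"
    have "\<exists>b. \<forall>x\<in>ball x0 r. \<eta> i x = b" for i
      by (rule deriv_zero_constant[OF \<eta>]) (use I0 I in blast)
    then obtain b where b: "\<And>i x. x \<in> ball x0 r \<Longrightarrow> \<eta> i x = b i" by metis
    have "chart_fun d \<eta> q = (\<chi> i. b i)" if "q \<in> T r" for q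
      using that b by (simp add: chart_fun_def vec_eq_iff T_def)
    then have "chart_fun d \<eta> q \<in> vec.span {\<chi> i. b i, \<chi> i. b i}" if "q \<in> T r" for q
      using that by (simp add: vec.span_base)
    then show False
      using not_in_plane[OF T(1), of r "chart_fun d \<eta>"] sec T(2)[OF r(1)] by blast
  qed
  have "\<exists>m g r'. 0 < r' \<and> r' \<le> r \<and> g holomorphic_on ball x0 r' \<and>
      (i \<in> I \<longrightarrow> (\<forall>w\<in>ball x0 r'. deriv (\<eta> i) w = (w - x0) ^ m * g w \<and> g w \<noteq> 0))" for i
  proof (cases "i \<in> I")
    case True
    then show ?thesis
      using holomorphic_factor[OF \<eta>' r(1), of i] by (auto simp: I_def)
  next
    case False
    then show ?thesis using \<eta>[of i] r(1) by blast
  qed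
  then obtain m G R where mGR: "\<And>i. 0 < R i" "\<And>i. R i \<le> r" "\<And>i. G i holomorphic_on ball x0 (R i)"
    "\<And>i w. i \<in> I \<Longrightarrow> w \<in> ball x0 (R i) \<Longrightarrow> deriv (\<eta> i) w = (w - x0) ^ m i * G i w"
    "\<And>i w. i \<in> I \<Longrightarrow> w \<in> ball x0 (R i) \<Longrightarrow> G i w \<noteq> 0"
    by metis
  define s where "s = Min (range R)"
  have s: "s > 0" "s \<le> r" "\<And>i. s \<le> R i"
    using mGR(1) order.trans[OF Min_le[of "range R" "R k"] mGR(2)[of k]] by (auto simp: s_def)
  have sR: "ball x0 s \<subseteq> ball x0 (R i)" "ball x0 s \<subseteq> ball x0 r" for i
    using s by (auto simp: subset_ball)
  \<comment> \<open>A coordinate whose derivative vanishes to the least order at \<open>x0\<close>;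
    it may serve as denominator for all the others.\<close>
  obtain l where l: "l \<in> I" "\<And>i. i \<in> I \<Longrightarrow> m l \<le> m i"
    using \<open>I \<noteq> {}\<close> ex_has_least_nat[of "\<lambda>i. i \<in> I" _ m] by blast
  have kl: "k \<noteq> l" using kI l(1) by blast
  \<comment> \<open>The quotient of the derivatives of coordinates \<open>i\<close> and
    \<open>l\<close>, with the common power of \<open>x - x0\<close> cancelled so that it is
    holomorphic at \<open>x0\<close> too.\<close>
  define \<kappa> where "\<kappa> i x = (if i \<in> I then (x - x0) ^ (m i - m l) * (G i x / G l x) else 0)" for i x
  have Gs: "G i holomorphic_on ball x0 s" for i
    using mGR(3) sR holomorphic_on_subset by blast
  have Gl: "G l x \<noteq> 0" if "x \<in> ball x0 s" for x
    using mGR(5)[OF l(1)] sR(1)[of l] that by blast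
  have \<kappa>: "\<kappa> i holomorphic_on ball x0 s" for i
  proof (cases "i \<in> I")
    case True
    have "(\<lambda>x. (x - x0) ^ (m i - m l) * (G i x / G l x)) holomorphic_on ball x0 s"
      by (intro holomorphic_intros Gs Gl)
    then show ?thesis using True by (simp add: \<kappa>_def[abs_def])
  qed (simp add: \<kappa>_def[abs_def])
  define \<mu> where "\<mu> = deriv (\<eta> l)"
  have \<mu>\<kappa>: "deriv (\<eta> i) x = \<mu> x * \<kappa> i x" if x: "x \<in> ball x0 s" for i x
  proof (cases "i \<in> I")
    case True
    have "x \<in> ball x0 (R i)" "x \<in> ball x0 (R l)" using x sR by blast+
    then show ?thesis
      using True mGR(4)[OF True, of x] mGR(4)[OF l(1), of x] mGR(5)[OF l(1), of x] l(2)[OF True]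
      by (simp add: \<mu>_def \<kappa>_def power_add[symmetric] mult.assoc[symmetric])
  next
    case False
    then show ?thesis using I0[OF False] x sR(2) by (auto simp: \<kappa>_def)
  qed
  have \<mu>0: "\<mu> x \<noteq> 0" if "x \<in> ball x0 s" "x \<noteq> x0" for x
    using that sR(1)[of l] mGR(4,5)[OF l(1), of x] by (auto simp: \<mu>_def)
  have \<kappa>k: "\<kappa> k x = 0" "x \<in> ball x0 s \<Longrightarrow> \<kappa> l x = 1" for x
    using kI l(1) mGR(5)[OF l(1), of x] sR(1)[of l] by (auto simp: \<kappa>_def)
  \<comment> \<open>If the direction of the derivative were a constant vector \<open>b\<close>,
    integration would give \<open>H = a + \<eta> l b\<close>, so \<open>h\<close> would lie in a
    plane locally, contradicting fullness.\<close>
  have "\<exists>i. \<exists>x\<in>ball x0 s. deriv (\<kappa> i) x \<noteq> 0"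
  proof (rule ccontr)
    assume "\<not> ?thesis"
    then have "\<exists>b. \<forall>x\<in>ball x0 s. \<kappa> i x = b" for i
      by (intro deriv_zero_constant[OF \<kappa>]) blast
    then obtain b where b: "\<And>i x. x \<in> ball x0 s \<Longrightarrow> \<kappa> i x = b i" by metis
    have "\<exists>a. \<forall>x\<in>ball x0 s. \<eta> i x - \<eta> l x * b i = a" for i
    proof (rule deriv_zero_constant)
      show "(\<lambda>x. \<eta> i x - \<eta> l x * b i) holomorphic_on ball x0 s"
        using \<eta> sR(2) holomorphic_on_subset by (intro holomorphic_intros) blast+
      fix x assume x: "x \<in> ball x0 s"
      then have xr: "x \<in> ball x0 r" using sR(2) by blast
      have "((\<lambda>x. \<eta> i x - \<eta> l x * b i) has_field_derivative deriv (\<eta> i) x - deriv (\<eta> l) x * b i) (at x)"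
        using holomorphic_derivI[OF \<eta> open_ball xr, of i UNIV] holomorphic_derivI[OF \<eta> open_ball xr, of l UNIV]
        by (intro DERIV_diff DERIV_cmult_right)
      then have "deriv (\<lambda>x. \<eta> i x - \<eta> l x * b i) x = deriv (\<eta> i) x - deriv (\<eta> l) x * b i"
        by (rule DERIV_imp_deriv)
      then show "deriv (\<lambda>x. \<eta> i x - \<eta> l x * b i) x = 0"
        using \<mu>\<kappa>[OF x, of i] b[OF x, of i] by (simp add: \<mu>_def)
    qed
    then obtain a where a: "\<And>i x. x \<in> ball x0 s \<Longrightarrow> \<eta> i x - \<eta> l x * b i = a i" by metis
    have "chart_fun d \<eta> q \<in> vec.span {\<chi> i. a i, \<chi> i. b i}" if "q \<in> T s" for q
    proof -
      have "snd d q \<in> ball x0 s" using that by (simp add: T_def)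
      then have "chart_fun d \<eta> q = (\<chi> i. a i) + \<eta> l (snd d q) *s (\<chi> i. b i)"
        using a[of "snd d q"] by (simp add: chart_fun_def vec_eq_iff flip: a)
      then show ?thesis
        by (simp add: vec.span_add vec.span_scale vec.span_base)
    qed
    moreover have "T s \<subseteq> T r" using sR(2) by (auto simp: T_def)
    ultimately show False
      using not_in_plane[OF T(1), of s "chart_fun d \<eta>"] sec T(2)[OF s(1)] by blast
  qed
  then obtain i where i: "\<exists>x\<in>ball x0 s. deriv (\<kappa> i) x \<noteq> 0" by blast
  \<comment> \<open>Some coordinate of \<open>K\<close> has a derivative that is not identically
    zero; a smaller ball avoids its zeros other than possibly the centre.\<close>
  obtain m' g' t where t: "0 < t" "t \<le> s"
    "\<forall>w\<in>ball x0 t. deriv (\<kappa> i) w = (w - x0) ^ m' * g' w \<and> g' w \<noteq> 0"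
    using holomorphic_factor[OF holomorphic_deriv[OF \<kappa> open_ball] s(1) i] by blast
  have ts: "ball x0 t \<subseteq> ball x0 s" "ball x0 t \<subseteq> ball x0 r"
    using t(2) s(2) by (auto simp: subset_ball)
  have \<eta>t: "\<eta> i holomorphic_on ball x0 t" and \<kappa>t: "\<kappa> i holomorphic_on ball x0 t" for i
    using \<eta> \<kappa> ts holomorphic_on_subset by blast+
  let ?H = "chart_fun d \<eta>" and ?K = "chart_fun d \<kappa>"
  note cf = chart_fun_holomorphic[OF d(1) open_ball _ T_def] chart_fun_wdv[OF d(1) open_ball _ T_def]
    wd_own_chart[OF d(1) open_ball _ T_def]
  have "adapted p (T t) ?H ?K"
    unfolding adapted_def
  proof (intro conjI)
    show "open (T t)" "p \<in> T t" using T t(1) by auto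
    show "holomorphic_map \<A> (T t) ?H" "holomorphic_map \<A> (T t) ?K"
      using cf(1) \<eta>t \<kappa>t by blast+
    have Tr: "T t \<subseteq> T r" using ts by (auto simp: T_def)
    then show "local_section h (T t) ?H"
      using sec by (auto simp: local_section_def)
    have "?H q $ k = 1 \<and> ?K q $ k = 0 \<and> ?K q $ l = 1" if "q \<in> T t" for q
    proof -
      have "snd d q \<in> ball x0 s" using that ts by (auto simp: T_def)
      then show ?thesis using that Tr sec \<kappa>k by (auto simp: chart_fun_def)
    qed
    then show "\<exists>k l. k \<noteq> l \<and> (\<forall>q\<in>T t. ?H q $ k = 1 \<and> ?K q $ k = 0 \<and> ?K q $ l = 1)"
      using kl by blast
    have D: "chart_fun d (\<lambda>i. deriv (\<eta> i)) q = \<mu> (snd d q) *s ?K q" if "q \<in> T t" for q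
      using that ts(1) \<mu>\<kappa> by (auto simp: chart_fun_def vec_eq_iff T_def)
    show "\<forall>c\<in>\<A>. \<forall>q\<in>T t \<inter> fst c. \<exists>a. wdv 1 c ?H q = a *s ?K q"
    proof (intro ballI)
      fix c q assume "c \<in> \<A>" "q \<in> T t \<inter> fst c"
      then have cq: "c \<in> \<A>" "q \<in> fst c" "q \<in> T t" by auto
      have "wdv 1 c ?H q = (wd 1 c (snd d) q * \<mu> (snd d q)) *s ?K q"
        unfolding cf(2)[where \<eta> = \<eta>, OF \<eta>t cq] D[OF cq(3)] by (simp add: vector_smult_assoc)
      then show "\<exists>a. wdv 1 c ?H q = a *s ?K q" by blast
    qed
    show "\<exists>d\<in>\<A>. T t \<subseteq> fst d \<and> (\<forall>q\<in>T t - {p}. wdv 1 d ?H q \<noteq> 0 \<and> wdv 1 d ?K q \<noteq> 0)"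
    proof (rule bexI[OF _ d(1)], intro conjI ballI)
      show "T t \<subseteq> fst d" by (auto simp: T_def)
      fix q assume q: "q \<in> T t - {p}"
      then have qT: "q \<in> T t" "q \<in> fst d" "snd d q \<in> ball x0 t" by (auto simp: T_def)
      have ne: "snd d q \<noteq> x0"
        using q chart_inj[OF d(1)] d(2) qT(2) unfolding x0_def inj_on_def by blast
      have w1: "wd 1 d (snd d) q = 1" using cf(3)[where \<eta> = \<eta>] \<eta>t qT(1) by blast
      have "wdv 1 d ?H q = \<mu> (snd d q) *s ?K q"
        using cf(2)[where \<eta> = \<eta>, OF _ d(1) qT(2,1)] \<eta>t D[OF qT(1)] w1 by simp
      moreover have "?K q $ l = 1" using \<kappa>k(2) ts(1) qT(3) by (auto simp: chart_fun_def)
      ultimately have "wdv 1 d ?H q $ l \<noteq> 0"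
        using \<mu>0[of "snd d q"] ts(1) qT(3) ne by auto
      then show "wdv 1 d ?H q \<noteq> 0" by auto
      have "wdv 1 d ?K q = chart_fun d (\<lambda>i. deriv (\<kappa> i)) q"
        using cf(2)[where \<eta> = \<kappa>, OF _ d(1) qT(2,1)] \<kappa>t w1 by simp
      then have "wdv 1 d ?K q $ i = deriv (\<kappa> i) (snd d q)" by (simp add: chart_fun_def)
      also have "\<dots> \<noteq> 0" using t(3) qT(3) ne by auto
      finally show "wdv 1 d ?K q \<noteq> 0" by auto
    qed
  qed
  then show ?thesis by blast
qed

end

lemma Ck_on_local:
  assumes "\<And>x. x \<in> U \<Longrightarrow> \<exists>V. open V \<and> x \<in> V \<and> Ck_on n f V"
  shows "Ck_on n f U"
  using assms
proof (induction n arbitrary: f)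
  case 0
  show ?case
    unfolding Ck_on.simps
  proof (rule continuous_at_imp_continuous_on, rule ballI)
    fix x assume "x \<in> U"
    then obtain V where V: "open V" "x \<in> V" "continuous_on V f"
      using 0[of x] by auto
    then show "isCont f x"
      using continuous_on_eq_continuous_at by blast
  qed
next
  case (Suc n)
  show ?case
    unfolding Ck_on.simps
  proof (intro conjI ballI allI)
    fix x assume "x \<in> U"
    then obtain V where V: "open V" "x \<in> V" "Ck_on (Suc n) f V"
      using Suc.prems[of x] by auto
    then show "f differentiable at x" by simp
  next
    fix v
    show "Ck_on n (\<lambda>x. frechet_derivative f (at x) v) U"
    proof (rule Suc.IH)
      fix x assume "x \<in> U"
      then obtain V where V: "open V" "x \<in> V" "Ck_on (Suc n) f V"
        using Suc.prems[of x] by auto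
      then show "\<exists>V. open V \<and> x \<in> V \<and> Ck_on n (\<lambda>x. frechet_derivative f (at x) v) V"
        by (intro exI[of _ V]) simp
    qed
  qed
qed

lemma (in riemann) smooth_map_local:
  assumes "\<And>p. \<exists>V. open V \<and> p \<in> V \<and> smooth_map \<A> V f"
  shows "smooth_map \<A> UNIV f"
proof (rule smooth_mapI, rule Ck_on_local)
  fix c n x assume c: "c \<in> \<A>" and "x \<in> snd c ` (UNIV \<inter> fst c)"
  then obtain p where p: "p \<in> fst c" "x = snd c p" by blast
  obtain V where V: "open V" "p \<in> V" "smooth_map \<A> V f" using assms by blast
  show "\<exists>V. open V \<and> x \<in> V \<and> Ck_on n (in_chart c f) V"
    using open_chart_image[OF c V(1)] smooth_mapD[OF V(3) c] p V(2)
    by (intro exI[of _ "snd c ` (V \<inter> fst c)"]) auto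
qed

section \<open>The frame lines are determined by the flag spanned by the two sections\<close>

context g2_pair
begin

lemma annihilator_B:
  assumes "ccross H v = 0"
  shows "cdot v B = 0"
  using cdot_ccross_rotate[of v "conj_vec H" H] assms
  by (simp add: B_def bryant_vec_def cdot_scale_right)

lemma annihilator_frame:
  assumes "ccross H v = 0" "j \<in> {-3, -2, -1, 0}"
  shows "cdot v (frame j) = 0"
  using assms annihilator_B[OF assms(1)] ccross_annihilator_isotropic[OF H0 H_isotropic assms(1)] HE HG
  by (auto simp: frame_def)

lemma herm_frame: "herm v (frame j) = cdot v (frame (- j))"
  by (simp add: herm_def conj_frame)

lemma frame_complete: "(\<Sum>j\<in>ix. line_proj (frame j) *v v) = v"
proof (rule line_proj_complete)
  show "frame j \<noteq> 0" if "j \<in> ix" for j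
    using that frame_eq_0_iff[of j] by (auto simp: ix_def)
  show "herm (frame j) (frame k) = 0" if "j \<noteq> k" for j k
    using frame_orth[of j "- k"] that by (simp add: herm_frame)
qed

text \<open>An annihilated vector pairs to zero with the indices -3 to 0, so it has components only
  along -3, -2 and -1; the second assumption removes the last one.\<close>

lemma annihilator_plane:
  assumes "ccross H v = 0" "cdot v (conj_vec G) = 0"
  shows "\<exists>a b. v = a *s H + b *s E"
proof -
  have "herm v (frame j) = 0" if "j \<notin> {-3, -2}" for j
    using annihilator_frame[OF assms(1), of "- j"] that assms(2) index_cases[of j]
    unfolding herm_frame by (auto simp: frame_def)
  then have "line_proj (frame j) *v v = 0" if "j \<notin> {-3, -2}" for j
    using that by (simp add: line_proj_mv)
  then have "(\<Sum>j\<in>ix. line_proj (frame j) *v v) = (\<Sum>j\<in>{-3, -2}. line_proj (frame j) *v v)"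
    by (intro sum.mono_neutral_right) (auto simp: ix_def)
  then have "v = line_proj (frame (-3)) *v v + line_proj (frame (-2)) *v v"
    by (simp add: frame_complete)
  then show ?thesis
    by (auto simp: line_proj_mv frame_def)
qed

lemma bryant_vec_scale: "a \<noteq> 0 \<Longrightarrow> bryant_vec (a *s v) = bryant_vec v"
proof -
  assume a: "a \<noteq> 0"
  have *: "bryant_vec v = (\<i> / herm v v) *s ccross (conj_vec v) v" for v
    by (simp add: bryant_vec_def herm_self)
  show ?thesis
    using a by (simp add: * herm_scale_left herm_scale_right conj_vec_scale ccross_scale_left
        ccross_scale_right vector_smult_assoc vec_eq_iff field_simps)
qed

text \<open>Orthogonality to the first vector forces \<open>x = 0\<close>, so both generators are
  merely rescaled. All other frame vectors are built from them by products and conjugation and are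
  rescaled too.\<close>

lemma line_proj_frame_eq:
  assumes "g2_pair H' E'" and H': "H' = a *s H" and E': "E' = x *s H + y *s E"
  shows "line_proj (g2_pair.frame H' E' j) = line_proj (frame j)"
proof -
  interpret p: g2_pair H' E' by fact
  have a: "a \<noteq> 0" using p.H0 H' by auto
  have "cdot E' (conj_vec H) = 0"
    using p.EH a by (simp add: H' conj_vec_scale cdot_scale_right)
  then have "x = 0"
    using EH H0 by (simp add: E' cdot_add_left cdot_scale_left)
  then have E': "E' = y *s E" using E' by simp
  then have y: "y \<noteq> 0" using p.E0 by auto
  have G: "p.G = (a * cnj y) *s G"
    unfolding p.G_def G_def unfolding H' E'
    by (simp add: conj_vec_scale ccross_scale_left ccross_scale_right vector_smult_assoc)
  have B: "p.B = B"
    unfolding p.B_def B_def unfolding H' using a by (rule bryant_vec_scale)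
  show ?thesis
    unfolding p.frame_def frame_def G B unfolding E' H'
    using a y by (simp add: conj_vec_scale line_proj_scale)
qed

end

context bryant_setup
begin

text \<open>The Gram-Schmidt step. The subtraction is written as a sum to fit the smoothness and
  product rules, which are stated for sums.\<close>

definition second :: "('m \<Rightarrow> complex^7) \<Rightarrow> ('m \<Rightarrow> complex^7) \<Rightarrow> 'm \<Rightarrow> complex^7" where
  "second H K q = K q + (- 1 * (herm (K q) (H q) / herm (H q) (H q))) *s H q"

definition local_frame :: "('m \<Rightarrow> complex^7) \<Rightarrow> ('m \<Rightarrow> complex^7) \<Rightarrow> int \<Rightarrow> 'm \<Rightarrow> complex^7" where
  "local_frame H K j q = g2_pair.frame (H q) (second H K q) j"

context
  fixes p U H K
  assumes ad: "adapted p U H K"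
begin

lemma adaptedD: "open U" "p \<in> U" "holomorphic_map \<A> U H" "holomorphic_map \<A> U K" "local_section h U H"
  "\<exists>k l. k \<noteq> l \<and> (\<forall>q\<in>U. H q $ k = 1 \<and> K q $ k = 0 \<and> K q $ l = 1)"
  "\<And>c q. c \<in> \<A> \<Longrightarrow> q \<in> U \<Longrightarrow> q \<in> fst c \<Longrightarrow> \<exists>a. wdv 1 c H q = a *s K q"
  "\<exists>d\<in>\<A>. U \<subseteq> fst d \<and> (\<forall>q\<in>U - {p}. wdv 1 d H q \<noteq> 0 \<and> wdv 1 d K q \<noteq> 0)"
  using ad unfolding adapted_def by (blast, blast, blast, blast, blast, blast, blast, blast)

lemma smooth_HK: "smooth_map \<A> U H" "smooth_map \<A> U K"
  using smooth_map_holomorphic[OF adaptedD(1)] adaptedD(3,4) by blast+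

lemma adapted_H0: "q \<in> U \<Longrightarrow> H q \<noteq> 0"
  using adaptedD(6) by (metis zero_index zero_neq_one)

text \<open>Away from \<open>p\<close>, \<open>K\<close> is proportional to the non-zero derivative
  of \<open>H\<close>, so this is superhorizontality; at \<open>p\<close> it follows by
  continuity.\<close>

lemma adapted_cross:
  assumes q: "q \<in> U"
  shows "ccross (H q) (K q) = 0"
proof -
  have off: "ccross (H q) (K q) = 0" if q: "q \<in> U" "q \<noteq> p" for q
  proof -
    obtain d where d: "d \<in> \<A>" "U \<subseteq> fst d" "wdv 1 d H q \<noteq> 0"
      using adaptedD(8) q by blast
    obtain a where a: "wdv 1 d H q = a *s K q"
      using adaptedD(7)[OF d(1) q(1)] d(2) q by blast
    have "ccross (H q) (wdv 1 d H q) = 0"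
      using sh adaptedD(1,3,5) d q unfolding superhorizontal_def dz_vec_wdv by blast
    then show ?thesis using a d(3) by (auto simp: ccross_scale_right)
  qed
  show ?thesis
  proof (cases "q = p")
    case True
    have "ccross (H p) (K p) = (\<lambda>_. 0) p"
      by (rule smooth_map_eq_punctured[OF adaptedD(1,2) smooth_ccross[OF adaptedD(1) smooth_HK]
            smooth_map_const]) (use off in simp)
    then show ?thesis using True by simp
  qed (use off q in blast)
qed

lemma adapted_pair: "q \<in> U \<Longrightarrow> g2_pair (H q) (second H K q)"
proof
  assume q: "q \<in> U"
  show "H q \<noteq> 0" by (rule adapted_H0[OF q])
  show "cdot (H q) (H q) = 0"
    using h_quadric[of q] adaptedD(5) q by (auto simp: quadric5_def local_section_def)
  show "ccross (H q) (second H K q) = 0"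
    by (simp add: second_def ccross_add_right ccross_diff_right ccross_scale_right ccross_minus_right adapted_cross[OF q])
  show "second H K q \<noteq> 0"
  proof -
    obtain k l where "k \<noteq> l" "H q $ k = 1" "K q $ k = 0" "K q $ l = 1"
      using adaptedD(6) q by blast
    from orthogonal_part_nonzero[OF this, of "herm (K q) (H q) / herm (H q) (H q)"]
    show ?thesis by (simp add: second_def)
  qed
  have "herm (second H K q) (H q) = 0"
    using adapted_H0[OF q] by (simp add: second_def herm_add_left herm_diff_left herm_scale_left)
  then show "cdot (second H K q) (conj_vec (H q)) = 0" by (simp add: herm_def)
qed

lemma smooth_second: "smooth_map \<A> U (second H K)"
  unfolding second_def[abs_def]
  by (intro smooth_map_add smooth_scale smooth_map_mult smooth_map_const smooth_map_divide smooth_herm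
      smooth_HK adaptedD(1)) (simp add: adapted_H0)

lemma local_frame_values:
  assumes "q \<in> U"
  shows "local_frame H K (-3) q = H q" "local_frame H K (-2) q = second H K q"
    "local_frame H K (-1) q = ccross (H q) (conj_vec (second H K q))"
    "local_frame H K 0 q = bryant_vec (H q)"
    "conj_vec (local_frame H K j q) = local_frame H K (- j) q"
    "\<bar>j\<bar> > 3 \<Longrightarrow> local_frame H K j q = 0"
proof -
  interpret g2_pair "H q" "second H K q" by (rule adapted_pair[OF assms])
  show "local_frame H K (-3) q = H q" "local_frame H K (-2) q = second H K q"
    "local_frame H K (-1) q = ccross (H q) (conj_vec (second H K q))"
    "local_frame H K 0 q = bryant_vec (H q)"
    "conj_vec (local_frame H K j q) = local_frame H K (- j) q"
    "\<bar>j\<bar> > 3 \<Longrightarrow> local_frame H K j q = 0"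
    by (simp_all add: local_frame_def frame_def[of "-3"] frame_def[of "-2"] frame_def[of "-1"]
        frame_def[of 0] G_def B_def conj_frame frame_eq_0_iff)
qed

lemma smooth_local_frame: "smooth_map \<A> U (local_frame H K j)"
proof -
  note U = adaptedD(1)
  have neg: "smooth_map \<A> U (local_frame H K j)" if j: "j \<in> {-3, -2, -1}" for j
  proof -
    consider "j = -3" | "j = -2" | "j = -1" using j by blast
    then show ?thesis
    proof cases
      case 1
      show ?thesis by (rule smooth_map_cong[OF U smooth_HK(1)]) (simp add: 1 local_frame_values)
    next
      case 2
      show ?thesis by (rule smooth_map_cong[OF U smooth_second]) (simp add: 2 local_frame_values)
    next
      case 3
      show ?thesis
        by (rule smooth_map_cong[OF U smooth_ccross[OF U smooth_HK(1) smooth_conj[OF U smooth_second]]])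
          (simp add: 3 local_frame_values)
    qed
  qed
  consider "j \<in> {-3, -2, -1}" | "- j \<in> {-3, -2, -1}" | "j = 0" | "\<bar>j\<bar> > 3"
    by fastforce
  then show ?thesis
  proof cases
    case 1
    then show ?thesis by (rule neg)
  next
    case 2
    show ?thesis
      by (rule smooth_map_cong[OF U smooth_conj[OF U neg[OF 2]]]) (simp add: local_frame_values(5))
  next
    case 3
    have "smooth_map \<A> U (\<lambda>q. (\<i> / herm (H q) (H q)) *s ccross (conj_vec (H q)) (H q))"
      by (intro smooth_scale smooth_map_divide smooth_map_const smooth_herm smooth_ccross smooth_conj
          smooth_HK U) (simp add: adapted_H0)
    then show ?thesis
      by (rule smooth_map_cong[OF U]) (simp add: 3 local_frame_values(4) bryant_vec_def herm_self)
  next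
    case 4
    show ?thesis by (rule smooth_map_cong[OF U smooth_map_const[of U 0]]) (simp add: 4 local_frame_values(6))
  qed
qed

lemma local_frame_orth:
  assumes "q \<in> U"
  shows "j + k \<noteq> 0 \<Longrightarrow> cdot (local_frame H K j q) (local_frame H K k q) = 0"
    and "herm v (local_frame H K k q) = cdot v (local_frame H K (- k) q)"
    and "local_frame H K j q = 0 \<longleftrightarrow> j \<notin> ix"
    and "cdot (local_frame H K 0 q) (local_frame H K 0 q) = 1"
proof -
  interpret g2_pair "H q" "second H K q" by (rule adapted_pair[OF assms])
  show "j + k \<noteq> 0 \<Longrightarrow> cdot (local_frame H K j q) (local_frame H K k q) = 0"
    "herm v (local_frame H K k q) = cdot v (local_frame H K (- k) q)"
    "local_frame H K j q = 0 \<longleftrightarrow> j \<notin> ix"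
    by (auto simp: local_frame_def frame_orth herm_frame frame_eq_0_iff ix_def)
  show "cdot (local_frame H K 0 q) (local_frame H K 0 q) = 1"
    using BB by (simp add: local_frame_def frame_def)
qed

end

end

section \<open>Derivatives of the local frame\<close>

context bryant_setup
begin

context
  fixes p U H K c q
  assumes ad: "adapted p U H K" and c: "c \<in> \<A>" "q \<in> fst c" and q: "q \<in> U"
begin

interpretation g2_pair "H q" "second H K q"
  by (rule adapted_pair[OF ad q])

private abbreviation e where "e \<equiv> local_frame H K"
text \<open>Up to a non-zero factor, the component of \<open>\<partial>e j\<close> along
  \<open>e (- k)\<close>. Degree one means that apart from the diagonal case
  \<open>j + k = 0\<close> only \<open>j + k = -1\<close> occurs.\<close>

private abbreviation b where "b j k \<equiv> cdot (wdv 1 c (e j) q) (e k q)"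

lemma U_open: "open U"
  by (rule adaptedD(1)[OF ad])

lemma diffv_smooth: "smooth_map \<A> U v \<Longrightarrow> diffv_at c v q"
  by (rule smooth_map_diffv_at[OF U_open _ q c])

lemma diffv_frame: "diffv_at c (e j) q"
  by (rule diffv_smooth[OF smooth_local_frame[OF ad]])

lemma diffv_HK: "diffv_at c H q" "diffv_at c K q"
  by (rule diffv_smooth; rule smooth_HK[OF ad])+

lemma wdv_frame_local: "(\<And>r. r \<in> U \<Longrightarrow> e j r = v r) \<Longrightarrow> wdv s c (e j) q = wdv s c v q"
  by (rule wdv_local[OF c U_open q])

lemma wdv_antiholomorphic: "wdv (-1) c H q = 0" "wdv (-1) c K q = 0"
  using holomorphic_map_wdv[OF U_open _ c(1) q c(2)] adaptedD(3,4)[OF ad] by blast+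

lemma wdv_frame_conj: "wdv s c (e (- j)) q = conj_vec (wdv (- s) c (e j) q)"
proof -
  have "wdv s c (e (- j)) q = wdv s c (\<lambda>r. conj_vec (e j r)) q"
    by (rule wdv_frame_local) (simp add: local_frame_values(5)[OF ad])
  then show ?thesis by (simp add: wdv_conj[OF c diffv_frame])
qed

text \<open>The pairings \<open>cdot (e j) (e k)\<close> are constant in these cases, and their
  derivative is \<open>b j k + b k j\<close>.\<close>

lemma pairing_skew: "j + k \<noteq> 0 \<Longrightarrow> b j k = - b k j" and pairing_0_0: "b 0 0 = 0"
proof -
  have *: "wd 1 c (\<lambda>r. cdot (e j r) (e k r)) q = b j k + b k j" for j k
    by (simp add: wd_cdot[OF c diffv_frame diffv_frame] cdot_commute[of "e j q"])
  have "wd 1 c (\<lambda>r. cdot (e j r) (e k r)) q = wd 1 c (\<lambda>r. 0) q" if "j + k \<noteq> 0"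
    by (rule wd_local[OF c U_open q]) (simp add: local_frame_orth(1)[OF ad _ that])
  then show "j + k \<noteq> 0 \<Longrightarrow> b j k = - b k j"
    using * by (simp add: wd_const eq_neg_iff_add_eq_0)
  have "wd 1 c (\<lambda>r. cdot (e 0 r) (e 0 r)) q = wd 1 c (\<lambda>r. 1) q"
    by (rule wd_local[OF c U_open q]) (simp add: local_frame_orth(4)[OF ad])
  then show "b 0 0 = 0"
    using *[of 0 0] by (simp add: wd_const)
qed

lemma annihilate_derivative:
  assumes "smooth_map \<A> U v" "\<And>r. r \<in> U \<Longrightarrow> ccross (H r) (v r) = 0"
  shows "ccross (H q) (wdv s c v q) = - ccross (wdv s c H q) (v q)"
proof -
  have "wdv s c (\<lambda>r. ccross (H r) (v r)) q = wdv s c (\<lambda>r. 0) q"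
    by (rule wdv_local[OF c U_open q]) (rule assms(2))
  then show ?thesis
    by (simp add: wdv_ccross[OF c diffv_HK(1) diffv_smooth[OF assms(1)]] wdv_const[OF c]
        eq_neg_iff_add_eq_0 add.commute)
qed

lemma HKq: "ccross (H q) (K q) = 0" "ccross (K q) (H q) = 0"
  using adapted_cross[OF ad q] ccross_commute[of "K q" "H q"] by simp_all

text \<open>Differentiating \<open>ccross H K = 0\<close> leaves a multiple of
  \<open>ccross K K\<close>, since the derivative of \<open>H\<close> is a multiple of
  \<open>K\<close>.\<close>

lemma wdv_K_annihilated: "ccross (H q) (wdv 1 c K q) = 0"
proof -
  obtain a where "wdv 1 c H q = a *s K q" using adaptedD(7)[OF ad c(1) q c(2)] by blast
  then show ?thesis
    using annihilate_derivative[OF smooth_HK(2)[OF ad] adapted_cross[OF ad]] by (simp add: ccross_scale_left)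
qed

text \<open>\<open>H\<close> and \<open>K\<close> are holomorphic, so in the antiholomorphic
  direction only the Gram-Schmidt coefficient is differentiated, which leaves a multiple of
  \<open>H\<close>.\<close>

lemma wdv_second:
  obtains x y where "wdv 1 c (e (-2)) q = wdv 1 c K q + x *s wdv 1 c H q + y *s H q"
    and "\<exists>z. wdv (-1) c (e (-2)) q = z *s H q"
proof -
  let ?a = "\<lambda>q. - 1 * (herm (K q) (H q) / herm (H q) (H q))"
  have "smooth_map \<A> U ?a"
    by (intro smooth_map_mult smooth_map_const smooth_map_divide smooth_herm smooth_HK[OF ad] U_open)
      (simp add: adapted_H0[OF ad])
  then have da: "diff_at c ?a q" by (rule smooth_map_diff_at[OF _ q c])
  have "wdv s c (e (-2)) q = wdv s c (\<lambda>q. K q + ?a q *s H q) q" for s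
    by (rule wdv_frame_local) (simp only: local_frame_values(2)[OF ad] second_def)
  then have "wdv s c (e (-2)) q = wdv s c K q + (wd s c ?a q *s H q + ?a q *s wdv s c H q)" for s
    unfolding wdv_add[OF c diffv_HK(2) diffv_at_scale[OF c da diffv_HK(1)]] wdv_scale[OF c da diffv_HK(1)] .
  from this[of 1] this[of "-1"] show ?thesis
    by (intro that[of "?a q" "wd 1 c ?a q"]) (auto simp: wdv_antiholomorphic add_ac)
qed

lemma frame_low: "e (-3) q = H q" "e (-2) q = second H K q" "e (-1) q = G" "e 0 q = B" "e j q = frame j"
  by (simp_all add: local_frame_def frame_def)

lemma K_decompose: "\<exists>x. K q = second H K q + x *s H q"
  by (intro exI[of _ "herm (K q) (H q) / herm (H q) (H q)"]) (simp add: second_def vec_eq_iff)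

lemma wdv_low_annihilated:
  assumes "j \<in> {-3, -2}"
  shows "ccross (H q) (wdv 1 c (e j) q) = 0"
proof (cases "j = -3")
  case True
  have "wdv 1 c (e (-3)) q = wdv 1 c H q"
    by (rule wdv_frame_local) (rule local_frame_values(1)[OF ad])
  moreover obtain a where "wdv 1 c H q = a *s K q" using adaptedD(7)[OF ad c(1) q c(2)] by blast
  ultimately show ?thesis using True HKq by (simp add: ccross_scale_right)
next
  case False
  obtain x y where "wdv 1 c (e (-2)) q = wdv 1 c K q + x *s wdv 1 c H q + y *s H q"
    using wdv_second by blast
  moreover obtain a where "wdv 1 c H q = a *s K q" using adaptedD(7)[OF ad c(1) q c(2)] by blast
  ultimately show ?thesis
    using False assms wdv_K_annihilated HKq by (simp add: ccross_add_right ccross_scale_right)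
qed

lemma wdv_minus_3: "wdv 1 c (e (-3)) q = wdv 1 c H q"
  by (rule wdv_frame_local) (rule local_frame_values(1)[OF ad])

lemma pairing_low: "j \<in> {-3, -2} \<Longrightarrow> k \<in> {-3, -2, -1, 0} \<Longrightarrow> b j k = 0"
  using annihilator_frame[OF wdv_low_annihilated] by (simp add: frame_low)

text \<open>The derivative of \<open>H\<close> stays in the span of the vectors of index -3 and -2,
  neither of which pairs with index 1.\<close>

lemma pairing_minus_3_1: "b (-3) 1 = 0"
proof -
  obtain a where "wdv 1 c H q = a *s K q" using adaptedD(7)[OF ad c(1) q c(2)] by blast
  moreover obtain x where "K q = second H K q + x *s H q" using K_decompose by blast
  moreover have "cdot (frame (-2)) (frame 1) = 0" "cdot (frame (-3)) (frame 1) = 0"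
    by (rule frame_orth; simp)+
  ultimately show ?thesis
    by (simp add: wdv_minus_3 cdot_scale_left cdot_add_left frame_low(5)[of 1])
      (simp add: frame_def)
qed

text \<open>\<open>e 3\<close> is the conjugate of the holomorphic section \<open>H\<close>, so its
  derivative in direction 1 vanishes.\<close>

lemma pairing_3: "b 3 k = 0"
proof -
  have "wdv (-1) c (e (-3)) q = wdv (-1) c H q"
    by (rule wdv_frame_local) (rule local_frame_values(1)[OF ad])
  then show ?thesis
    using wdv_frame_conj[of 1 "-3"] by (simp add: wdv_antiholomorphic)
qed

text \<open>By conjugation the derivative of \<open>e 2\<close> is a multiple of \<open>e 3\<close>,
  which pairs only with index -3.\<close>

lemma pairing_2: "k \<noteq> -3 \<Longrightarrow> b 2 k = 0"
proof -
  assume k: "k \<noteq> -3"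
  obtain z where "wdv (-1) c (e (-2)) q = z *s H q"
    using wdv_second by blast
  then have "wdv 1 c (e 2) q = cnj z *s e 3 q"
    using wdv_frame_conj[of 1 "-2"] conj_frame[of "-3"]
    by (simp add: conj_vec_scale frame_low(5)[of 3]) (simp add: frame_def)
  moreover have "cdot (e 3 q) (e k q) = 0"
    using k by (intro local_frame_orth(1)[OF ad q]) simp
  ultimately show ?thesis by (simp add: cdot_scale_left)
qed

lemma cross_frame_minus_1: "r \<in> U \<Longrightarrow> ccross (H r) (e (-1) r) = 0"
proof -
  assume r: "r \<in> U"
  interpret r: g2_pair "H r" "second H K r" by (rule adapted_pair[OF ad r])
  show ?thesis using r.HG by (simp add: local_frame_def r.frame_def)
qed

text \<open>\<open>ccross H\<close> kills \<open>e (-1)\<close>, and as \<open>H\<close> is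
  holomorphic it also kills the antiholomorphic derivative of \<open>e (-1)\<close>, which is
  therefore orthogonal to the real vector \<open>B\<close>. Conjugation gives the claim.\<close>

lemma pairing_1_0: "b 1 0 = 0"
proof -
  have "ccross (H q) (wdv (-1) c (e (-1)) q) = 0"
    using annihilate_derivative[OF smooth_local_frame[OF ad] cross_frame_minus_1, of "-1"]
    by (simp add: wdv_antiholomorphic)
  from annihilator_B[OF this] have "cdot (wdv (-1) c (e (-1)) q) (conj_vec B) = 0"
    by (simp add: B_real)
  then show ?thesis
    using wdv_frame_conj[of 1 "-1"] cdot_conj_left[of "wdv (-1) c (e (-1)) q" B]
    by (simp add: frame_low(4))
qed

text \<open>Skew symmetry yields the transposes of the direct cases and the pairs
  \<open>j = k\<close>. What remains are the arrows, \<open>j + k = -1\<close>, and for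
  \<open>j \<noteq> 0\<close> the components \<open>j + k = 0\<close>, which depend on the scaling
  of the frame.\<close>

lemma pairing_zero:
  assumes "j + k \<noteq> 0 \<or> j = 0" "j + k \<noteq> -1"
  shows "b j k = 0"
proof -
  let ?d = "\<lambda>j k::int. j = 3 \<or> j = 2 \<and> k \<noteq> -3 \<or> j = 1 \<and> k = 0 \<or>
    (j = -3 \<or> j = -2) \<and> -3 \<le> k \<and> k \<le> 0 \<or> j = -3 \<and> k = 1 \<or> k < -3 \<or> 3 < k"
  have direct: "b j k = 0" if d: "?d j k" for j k
  proof -
    consider "j = 3" | "j = 2" "k \<noteq> -3" | "j = 1" "k = 0" | "j = -3 \<or> j = -2" "-3 \<le> k" "k \<le> 0"
      | "j = -3" "k = 1" | "\<bar>k\<bar> > 3"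
      using d by linarith
    then show ?thesis
    proof cases
      case 4
      then have "j \<in> {-3, -2}" "k \<in> {-3, -2, -1, 0}" by auto
      then show ?thesis by (rule pairing_low)
    qed (simp_all add: pairing_3 pairing_2 pairing_1_0 pairing_minus_3_1 local_frame_values(6)[OF ad q])
  qed
  show ?thesis
  proof (cases "j = 0 \<and> k = 0")
    case True
    then show ?thesis using pairing_0_0 by simp
  next
    case False
    then have jk: "j + k \<noteq> 0" using assms by auto
    then have "?d j k \<or> ?d k j \<or> j = k"
      using assms(2) by presburger
    then show ?thesis
      using direct[of j k] direct[of k j] pairing_skew[OF jk] by auto
  qed
qed

lemma frame_derivative_zero:
  assumes "s \<in> {1, -1}" "k \<noteq> j" "k \<noteq> j + s"
  shows "herm (wdv s c (e j) q) (e k q) = 0"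
proof (cases "s = 1")
  case True
  then show ?thesis
    using assms pairing_zero[of j "- k"] by (simp add: local_frame_orth(2)[OF ad q])
next
  case False
  then have s: "s = -1" using assms by simp
  have "wdv (-1) c (e j) q = conj_vec (wdv 1 c (e (- j)) q)"
    using wdv_frame_conj[of "-1" "- j"] by simp
  moreover have "b (- j) k = 0"
    using assms s by (intro pairing_zero) auto
  ultimately show ?thesis
    using s by (simp add: herm_def cdot_conj)
qed

context
  assumes nz: "wdv 1 c H q \<noteq> 0" "wdv 1 c K q \<noteq> 0"
begin

text \<open>The derivative of \<open>H\<close> is a non-zero multiple of \<open>K\<close>, whose
  coefficient at \<open>e (-2)\<close> is 1.\<close>

lemma pairing_minus_3_2: "b (-3) 2 \<noteq> 0"
proof -
  obtain a where a: "wdv 1 c H q = a *s K q" using adaptedD(7)[OF ad c(1) q c(2)] by blast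
  then have "a \<noteq> 0" using nz by auto
  obtain x where x: "K q = second H K q + x *s H q" using K_decompose by blast
  have "cdot (frame (-2)) (frame 2) \<noteq> 0" "cdot (frame (-3)) (frame 2) = 0"
    using frame_self[of "-2"] frame_orth[of "-3" 2] by auto
  then show ?thesis
    using \<open>a \<noteq> 0\<close> unfolding wdv_minus_3 a x
    by (simp add: cdot_scale_left cdot_add_left frame_low(5)[of 2])
      (simp add: frame_def)
qed

text \<open>Differentiating \<open>ccross H (e (-1)) = 0\<close> gives a non-zero multiple of
  \<open>ccross E G\<close>. Its pairing with the conjugate of \<open>H\<close> is non-zero by
  \<open>E_cross_G\<close> and, by cyclic symmetry, proportional to the pairing with
  \<open>B\<close>.\<close>

lemma pairing_minus_1_0: "b (-1) 0 \<noteq> 0"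
proof -
  obtain a where a: "wdv 1 c H q = a *s K q" using adaptedD(7)[OF ad c(1) q c(2)] by blast
  then have "a \<noteq> 0" using nz by auto
  obtain x where x: "K q = second H K q + x *s H q" using K_decompose by blast
  have "ccross (H q) (wdv 1 c (e (-1)) q) = - ccross (wdv 1 c H q) (e (-1) q)"
    by (rule annihilate_derivative[OF smooth_local_frame[OF ad] cross_frame_minus_1])
  also have "\<dots> = - (a *s ccross (second H K q) G)"
    unfolding a frame_low(3) by (subst x) (simp add: ccross_scale_left ccross_add_left HG)
  finally have *: "cdot (conj_vec (H q)) (ccross (H q) (wdv 1 c (e (-1)) q)) \<noteq> 0"
    using \<open>a \<noteq> 0\<close> H0 E0 by (simp add: cdot_minus_right cdot_scale_right E_cross_G)
  have "b (-1) 0 = (\<i> / complex_of_real ((norm (H q))\<^sup>2)) *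
      cdot (wdv 1 c (e (-1)) q) (ccross (conj_vec (H q)) (H q))"
    by (simp add: frame_low(4) B_def bryant_vec_def cdot_scale_right)
  also have "cdot (wdv 1 c (e (-1)) q) (ccross (conj_vec (H q)) (H q)) =
      cdot (conj_vec (H q)) (ccross (H q) (wdv 1 c (e (-1)) q))"
    by (rule cdot_ccross_rotate)
  finally show ?thesis using * H0 by simp
qed

text \<open>Otherwise the derivative of \<open>K\<close> would lie in the span of \<open>H\<close>
  and \<open>K\<close>. Its coordinates \<open>k\<close> and \<open>l\<close> vanish because those
  of \<open>K\<close> are constant, and the normalisation of \<open>H\<close> and \<open>K\<close>
  then makes it zero.\<close>

lemma pairing_minus_2_1: "b (-2) 1 \<noteq> 0"
proof
  assume 0: "b (-2) 1 = 0"
  obtain a where a: "wdv 1 c H q = a *s K q" using adaptedD(7)[OF ad c(1) q c(2)] by blast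
  obtain x y where E: "wdv 1 c (e (-2)) q = wdv 1 c K q + x *s wdv 1 c H q + y *s H q"
    using wdv_second by blast
  have "e 1 q = conj_vec G" by (simp add: frame_low(5)) (simp add: frame_def)
  then obtain u v where "wdv 1 c (e (-2)) q = u *s H q + v *s second H K q"
    using annihilator_plane[OF wdv_low_annihilated, of "-2"] 0 by auto
  moreover obtain z where "K q = second H K q + z *s H q" using K_decompose by blast
  ultimately have K': "wdv 1 c K q = (u - v * z - y) *s H q + (v - x * a) *s K q"
    using E a by (simp add: vec_eq_iff algebra_simps)
  obtain k l where kl: "k \<noteq> l" "\<And>r. r \<in> U \<Longrightarrow> H r $ k = 1 \<and> K r $ k = 0 \<and> K r $ l = 1"
    using adaptedD(6)[OF ad] by blast
  have "wd 1 c (\<lambda>r. K r $ k) q = wd 1 c (\<lambda>r. 0) q" "wd 1 c (\<lambda>r. K r $ l) q = wd 1 c (\<lambda>r. 1) q"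
    by (rule wd_local[OF c U_open q]; simp add: kl)+
  then have "wdv 1 c K q $ k = 0" "wdv 1 c K q $ l = 0"
    by (simp_all add: wdv_def wd_const)
  then have 0: "u - v * z - y = 0" "v - x * a = 0"
    using kl(2)[OF q] unfolding K' by auto
  have "wdv 1 c K q = 0" unfolding K' 0 by simp
  then show False using nz by simp
qed

lemma pairing_nonzero:
  assumes "j \<in> ix" "k \<in> ix" "j + k = -1"
  shows "b j k \<noteq> 0"
proof -
  have "j \<in> {-3, -2, -1} \<or> k \<in> {-3, -2, -1}" "b j k = - b k j"
    using assms pairing_skew[of j k] by (auto simp: ix_def)
  moreover have "b j (- 1 - j) \<noteq> 0" if "j \<in> {-3, -2, -1}" for j
    using that pairing_minus_3_2 pairing_minus_2_1 pairing_minus_1_0 by auto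
  moreover have "k = - 1 - j" "j = - 1 - k" using assms(3) by auto
  ultimately show ?thesis by force
qed

lemma frame_derivative_nonzero:
  assumes "s \<in> {1, -1}" "j \<in> ix" "j + s \<in> ix"
  shows "herm (wdv s c (e j) q) (e (j + s) q) \<noteq> 0"
proof (cases "s = 1")
  case True
  then show ?thesis
    using assms pairing_nonzero[of j "- (j + 1)"] by (simp add: local_frame_orth(2)[OF ad q] ix_def)
next
  case False
  then have s: "s = -1" using assms by simp
  have "wdv (-1) c (e j) q = conj_vec (wdv 1 c (e (- j)) q)"
    using wdv_frame_conj[of "-1" "- j"] by simp
  moreover have "b (- j) (j - 1) \<noteq> 0"
    using assms s by (intro pairing_nonzero) (auto simp: ix_def)
  ultimately show ?thesis
    using s by (simp add: herm_def cdot_conj)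
qed

end

end

text \<open>Both pairs span the same flag: the first sections span \<open>h\<close>, and away from
  \<open>p'\<close> the derivative of \<open>H'\<close> shows that \<open>K'\<close> lies in the
  span of \<open>H\<close> and \<open>K\<close>. Then \<open>line_proj_frame_eq\<close>
  applies.\<close>

lemma adapted_overlap:
  assumes ad: "adapted p U H K" and ad': "adapted p' U' H' K'" and q: "q \<in> U" "q \<in> U'"
  shows "line_proj (local_frame H' K' j q) = line_proj (local_frame H K j q)"
proof -
  note A = adaptedD[OF ad] and A' = adaptedD[OF ad']
  let ?V = "U \<inter> U'"
  have V: "open ?V" using A(1) A'(1) by blast
  obtain k l where kl: "k \<noteq> l" "\<And>r. r \<in> U \<Longrightarrow> H r $ k = 1 \<and> K r $ k = 0 \<and> K r $ l = 1"
    using A(6) by blast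
  have H': "H' r = (H' r $ k) *s H r" if r: "r \<in> ?V" for r
  proof -
    have "h r = vec.span {H r}"
      using r A(5) adapted_H0[OF ad] by (intro quadric5_span h_quadric) (auto simp: local_section_def)
    then obtain a where a: "H' r = a *s H r"
      using r A'(5) by (auto simp: local_section_def vec.span_singleton)
    moreover have "H' r $ k = a" using a kl(2)[of r] r by simp
    ultimately show ?thesis by simp
  qed
  have sm: "smooth_map \<A> ?V H" "smooth_map \<A> ?V K" "smooth_map \<A> ?V H'" "smooth_map \<A> ?V K'"
    using smooth_HK[OF ad] smooth_HK[OF ad'] smooth_map_mono by blast+
  have comp: "smooth_map \<A> ?V (\<lambda>r. v r $ i)" if "smooth_map \<A> ?V v" for v :: "'m \<Rightarrow> complex^7" and i
    using that unfolding smooth_map_vec[OF V] by blast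
  \<comment> \<open>The coefficients are read off from the coordinates \<open>k\<close> and
    \<open>l\<close> in which \<open>H\<close> and \<open>K\<close> are normalised, so they are
    smooth at \<open>p'\<close> as well and continuity settles that point.\<close>
  let ?R = "\<lambda>r. (K' r $ k) *s H r + (K' r $ l + - 1 * (K' r $ k * H r $ l)) *s K r"
  have K': "K' r = ?R r" if r: "r \<in> ?V" "r \<noteq> p'" for r
  proof -
    obtain d where d: "d \<in> \<A>" "U' \<subseteq> fst d" "wdv 1 d H' r \<noteq> 0" using A'(8) r by blast
    have rd: "r \<in> fst d" using d r by blast
    obtain a' where a': "wdv 1 d H' r = a' *s K' r" using A'(7)[OF d(1) _ rd] r by blast
    obtain a where a: "wdv 1 d H r = a *s K r" using A(7)[OF d(1) _ rd] r by blast
    have "wdv 1 d H' r = wdv 1 d (\<lambda>r. (H' r $ k) *s H r) r"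
      by (rule wdv_local[OF d(1) rd V r(1) H'])
    also have "\<dots> = wd 1 d (\<lambda>r. H' r $ k) r *s H r + (H' r $ k * a) *s K r"
      using wdv_scale[OF d(1) rd smooth_map_diff_at[OF comp[OF sm(3)] r(1) d(1) rd]
          smooth_map_diffv_at[OF V sm(1) r(1) d(1) rd]] a
      by (simp add: vector_smult_assoc)
    finally have "a' *s K' r = wd 1 d (\<lambda>r. H' r $ k) r *s H r + (H' r $ k * a) *s K r"
      using a' by simp
    then have "(1 / a') *s (a' *s K' r) = (1 / a') *s (wd 1 d (\<lambda>r. H' r $ k) r *s H r + (H' r $ k * a) *s K r)"
      by simp
    moreover have "a' \<noteq> 0" using a' d(3) by auto
    ultimately obtain x y where xy: "K' r = x *s H r + y *s K r"
      by (simp add: vector_smult_assoc vector_add_ldistrib)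
    have "K' r $ k = x" "K' r $ l = x * H r $ l + y"
      using kl(2)[of r] r unfolding xy by simp_all
    then show ?thesis using xy by simp
  qed
  have smR: "smooth_map \<A> ?V ?R"
    by (intro smooth_map_add smooth_scale smooth_map_mult smooth_map_const comp sm V)
  have "K' q = ?R q"
  proof (cases "q = p'")
    case True
    show ?thesis
      by (rule smooth_map_eq_punctured[OF V _ sm(4) smR]) (use q K' True in auto)
  next
    case False
    then show ?thesis using q K' by blast
  qed
  then obtain x y where xy: "K' q = x *s H q + y *s K q" by blast
  have a: "H' q = (H' q $ k) *s H q" using H' q by blast
  have "\<exists>u v. second H' K' q = u *s H q + v *s second H K q"
  proof -
    let ?w = "herm (K q) (H q) / herm (H q) (H q)" and ?w' = "herm (K' q) (H' q) / herm (H' q) (H' q)"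
    have "second H' K' q = K' q - (?w' * (H' q $ k)) *s H q"
      unfolding second_def by (subst a) (simp add: vec_eq_iff mult.assoc)
    also have "\<dots> = (x + y * ?w - ?w' * (H' q $ k)) *s H q + y *s second H K q"
      unfolding xy second_def by (simp add: vec_eq_iff algebra_simps)
    finally show ?thesis by blast
  qed
  then obtain u v where uv: "second H' K' q = u *s H q + v *s second H K q" by blast
  show ?thesis
    unfolding local_frame_def
    by (rule g2_pair.line_proj_frame_eq[OF adapted_pair[OF ad q(1)] adapted_pair[OF ad' q(2)] a uv])
qed

end

section \<open>The global grading\<close>

context bryant_setup
begin

definition chosen :: "'m \<Rightarrow> 'm set \<times> ('m \<Rightarrow> complex^7) \<times> ('m \<Rightarrow> complex^7)" where
  "chosen p = (SOME x. adapted p (fst x) (fst (snd x)) (snd (snd x)))"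

definition nbhd :: "'m \<Rightarrow> 'm set" where "nbhd p = fst (chosen p)"
definition Hsec :: "'m \<Rightarrow> 'm \<Rightarrow> complex^7" where "Hsec p = fst (snd (chosen p))"
definition Ksec :: "'m \<Rightarrow> 'm \<Rightarrow> complex^7" where "Ksec p = snd (snd (chosen p))"

lemma chosen_adapted: "adapted p (nbhd p) (Hsec p) (Ksec p)"
proof -
  have "\<exists>x. adapted p (fst x) (fst (snd x)) (snd (snd x))"
    using adapted_exists[of p] by simp
  from someI_ex[OF this] show ?thesis
    by (simp add: nbhd_def Hsec_def Ksec_def chosen_def)
qed

text \<open>Every point uses its own chosen frame; by \<open>adapted_overlap\<close> the result is
  given by one smooth frame on each \<open>nbhd p\<close>.\<close>

definition Pmat :: "int \<Rightarrow> 'm \<Rightarrow> complex^7^7" where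
  "Pmat j p = line_proj (local_frame (Hsec p) (Ksec p) j p)"

lemma in_nbhd: "p \<in> nbhd p" and open_nbhd: "open (nbhd p)"
  using adaptedD(1,2)[OF chosen_adapted] by blast+

lemma Pmat_local: "r \<in> nbhd p \<Longrightarrow> Pmat j r = line_proj (local_frame (Hsec p) (Ksec p) j r)"
  unfolding Pmat_def by (rule adapted_overlap[OF chosen_adapted chosen_adapted _ in_nbhd])

lemma local_frame_herm:
  assumes "adapted p U H K" "q \<in> U" "j \<noteq> k"
  shows "herm (local_frame H K j q) (local_frame H K k q) = 0"
  using local_frame_orth(1,2)[OF assms(1,2)] assms(3) by simp

sublocale graded \<A> Pmat
proof
  fix j k l s :: int and p v w c
  let ?e = "\<lambda>j. local_frame (Hsec p) (Ksec p) j"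
  note ad = chosen_adapted[of p]
  show "smooth_map \<A> UNIV (Pmat j)"
  proof (rule smooth_map_local)
    fix p
    note ad = chosen_adapted[of p]
    have "smooth_map \<A> (nbhd p) (Pmat j)"
    proof (cases "j \<in> ix")
      case True
      have "smooth_map \<A> (nbhd p) (\<lambda>q. line_proj (local_frame (Hsec p) (Ksec p) j q))"
        by (rule smooth_line_proj[OF open_nbhd smooth_local_frame[OF ad]])
          (use local_frame_orth(3)[OF ad] True in blast)
      then show ?thesis
        by (rule smooth_map_cong[OF open_nbhd]) (simp add: Pmat_local)
    next
      case False
      have "Pmat j q = 0" if "q \<in> nbhd p" for q
        using local_frame_orth(3)[OF ad that, of j] False by (simp add: Pmat_local[OF that] line_proj_0)
      then show ?thesis
        by (intro smooth_map_cong[OF open_nbhd smooth_map_const[of _ 0]]) simp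
    qed
    then show "\<exists>V. open V \<and> p \<in> V \<and> smooth_map \<A> V (Pmat j)"
      using open_nbhd in_nbhd by blast
  qed
  show "herm (Pmat j p *v v) w = herm v (Pmat j p *v w)"
    by (simp add: Pmat_def line_proj_herm)
  show "Pmat j p *v (Pmat k p *v v) = (if j = k then Pmat j p *v v else 0)"
    using local_frame_herm[OF ad in_nbhd, of k j] by (simp add: Pmat_def line_proj_idem line_proj_orth)
  show "j \<notin> ix \<Longrightarrow> Pmat j p = 0"
    using local_frame_orth(3)[OF ad in_nbhd, of j] by (simp add: Pmat_def line_proj_0)
  show "(\<Sum>k\<in>ix. Pmat k p *v v) = v"
    unfolding Pmat_def using local_frame_orth(3)[OF ad in_nbhd] local_frame_herm[OF ad in_nbhd]
    by (intro line_proj_complete) blast+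
  show "\<exists>e. e \<noteq> 0 \<and> Pmat j p *v e = e \<and> (\<forall>v. \<exists>a. Pmat j p *v v = a *s e)" if "j \<in> ix"
    using local_frame_orth(3)[OF ad in_nbhd, of j] that
    by (intro exI[of _ "?e j p"]) (auto simp: Pmat_def line_proj_self line_proj_mv)
  assume c: "c \<in> \<A>" "p \<in> fst c" and s: "s \<in> {1, - 1}" and kl: "k \<noteq> l + s"
  show "Pmat k p *v (wdm s c (Pmat j) p *v (Pmat l p *v v)) = 0"
    by (rule frame_degree(1)[OF c open_nbhd in_nbhd smooth_local_frame[OF ad] local_frame_orth(3)[OF ad]
          local_frame_herm[OF ad] Pmat_local frame_derivative_zero[OF ad c in_nbhd s] kl])
qed

text \<open>In \<open>nbhd p\<close> the derivatives of both adapted sections vanish at most at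
  \<open>p\<close>, so all other points there are nondegenerate.\<close>

lemma nondegenerate: "\<not> p islimpt {q. \<not> (\<exists>c. nondegenerate_at c q)}"
proof -
  note ad = chosen_adapted[of p]
  obtain d where d: "d \<in> \<A>" "nbhd p \<subseteq> fst d"
    "\<And>q. q \<in> nbhd p - {p} \<Longrightarrow> wdv 1 d (Hsec p) q \<noteq> 0 \<and> wdv 1 d (Ksec p) q \<noteq> 0"
    using adaptedD(8)[OF ad] by blast
  have "nondegenerate_at d q" if "q \<in> nbhd p" "q \<noteq> p" for q
    unfolding nondegenerate_at_def
  proof (intro conjI ballI impI d(1))
    show qd: "q \<in> fst d" using d(2) that by blast
    have nz: "wdv 1 d (Hsec p) q \<noteq> 0" "wdv 1 d (Ksec p) q \<noteq> 0" using d(3) that by blast+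
    fix s l :: int assume s: "s \<in> {1, - 1}" and l: "l \<in> ix" "l + s \<in> ix"
    have "Pmat (l + s) q *v (wdm s d (Pmat l) q *v (Pmat l q *v local_frame (Hsec p) (Ksec p) l q)) \<noteq> 0"
      by (rule frame_degree(2)[OF d(1) qd open_nbhd that(1) smooth_local_frame[OF ad] local_frame_orth(3)[OF ad]
          local_frame_herm[OF ad] Pmat_local frame_derivative_zero[OF ad d(1) qd that(1) s] _
          frame_derivative_nonzero[OF ad d(1) qd that(1) nz s l]])
        (use s in auto)
    then show "\<exists>v. Pmat (l + s) q *v (wdm s d (Pmat l) q *v (Pmat l q *v v)) \<noteq> 0" by blast
  qed
  then show ?thesis
    unfolding islimpt_def using open_nbhd in_nbhd by blast
qed

lemma sub_span: "sub S p = vec.span ((\<lambda>j. local_frame (Hsec p) (Ksec p) j p) ` (S \<inter> ix))"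
proof
  let ?e = "\<lambda>j. local_frame (Hsec p) (Ksec p) j p"
  note ad = chosen_adapted[of p]
  have "?e j \<in> sub S p" if "j \<in> S" for j
  proof -
    have "herm (?e j) (?e k) = 0" if "k \<notin> S" for k
      using \<open>j \<in> S\<close> that by (intro local_frame_herm[OF ad in_nbhd]) blast
    then show ?thesis by (simp add: sub_def Pmat_def line_proj_mv)
  qed
  then show "vec.span (?e ` (S \<inter> ix)) \<subseteq> sub S p"
    by (intro vec.span_minimal subspace_sub) blast
  show "sub S p \<subseteq> vec.span (?e ` (S \<inter> ix))"
  proof
    fix v assume "v \<in> sub S p"
    then have "v = (\<Sum>j\<in>S \<inter> ix. Pmat j p *v v)"
      by (simp add: mem_sub PS_mv)
    also have "\<dots> \<in> vec.span (?e ` (S \<inter> ix))"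
      unfolding Pmat_def line_proj_mv
      by (intro vec.span_sum vec.span_scale vec.span_base) blast
    finally show "v \<in> vec.span (?e ` (S \<inter> ix))" .
  qed
qed

context
  fixes F :: "'m \<Rightarrow> real^7"
  assumes F: "bryant_map \<A> h F"
begin

lemma cvec_F: "cvec (F p) = local_frame (Hsec p) (Ksec p) 0 p"
proof -
  note ad = chosen_adapted[of p]
  have "cvec (F p) = bryant_vec (Hsec p p)"
    using F adaptedD(1,2,5)[OF ad] smooth_HK(1)[OF ad] adapted_H0[OF ad]
    unfolding bryant_map_def bryant_vec_def by blast
  then show ?thesis by (simp add: local_frame_values(4)[OF ad in_nbhd])
qed

lemma sub_0: "sub {0} p = vec.span {cvec (F p)}"
  by (simp add: sub_span cvec_F ix_def)

lemma sub_G2_SO4: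
  assumes i: "i \<in> {1, 2, 3 :: nat}"
  shows "sub {- int i, 0, int i} p \<in> G2_SO4"
proof -
  let ?e = "\<lambda>j. local_frame (Hsec p) (Ksec p) j p"
  note ad = chosen_adapted[of p]
  interpret g2_pair "Hsec p p" "second (Hsec p) (Ksec p) p"
    by (rule adapted_pair[OF ad in_nbhd])
  \<comment> \<open>The eigenvalue is \<open>- \<i>\<close> for the indices -1 and -2 but
    \<open>\<i>\<close> for -3, whence the sign \<open>s\<close>.\<close>
  have "\<exists>s. s\<^sup>2 = 1 \<and> ccross B (frame (- int i)) = (complex_of_real s * \<i>) *s frame (- int i)"
  proof -
    consider "i = 1" | "i = 2" | "i = 3" using i by auto
    then show ?thesis
    proof cases
      case 1
      then show ?thesis using BG by (intro exI[of _ "-1"]) (simp add: frame_def)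
    next
      case 2
      then show ?thesis using BE by (intro exI[of _ "-1"]) (simp add: frame_def)
    next
      case 3
      then show ?thesis using BH by (intro exI[of _ 1]) (simp add: frame_def)
    qed
  qed
  moreover have "cvec (F p) = B"
    by (simp add: cvec_F local_frame_def frame_def)
  moreover have "frame (- int i) \<noteq> 0"
    using i by (auto simp: frame_eq_0_iff)
  ultimately have "vec.span {conj_vec (frame (- int i)), cvec (F p), frame (- int i)} \<in> G2_SO4"
    using span_eigenvector_in_G2_SO4 by metis
  moreover have "{- int i, 0, int i} \<inter> ix = {int i, 0, - int i}"
    using i by (auto simp: ix_def)
  ultimately show ?thesis
    by (simp add: sub_span conj_frame cvec_F local_frame_def)
qed

end

end

theorem proposition5p14:
  fixes \<A> :: "'m::t2_space chart set"
    and h f :: "'m \<Rightarrow> (complex^7) set"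
    and F :: "'m \<Rightarrow> real^7"
    and \<phi> :: "nat \<Rightarrow> 'm \<Rightarrow> (complex^7) set"
  assumes "riemann_surface \<A>"
    and "holomorphic_to_quadric \<A> h"
    and "full_map h"
    and "superhorizontal \<A> h"
    and "bryant_map \<A> h F"
    and f_def: "f = (\<lambda>p. vec.span {cvec (F p)})"
    and phi_def: "\<And>i. \<phi> i = bundle_sum3 ((gauss2 \<A> ^^ i) f) f ((gauss1 \<A> ^^ i) f)"
  shows "(\<forall>i\<in>{1,2,3}. harmonic_into \<A> G2_SO4 (\<phi> i) \<and>
                       nonconstant (\<phi> i) \<and> nilconformal \<A> (\<phi> i)) \<and>
         (\<forall>i\<in>{1,3}. strongly_conformal \<A> (\<phi> i) \<and> s_number \<A> (\<phi> i) = 1) \<and>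
         s_number \<A> (\<phi> 2) = 3"
proof -
  interpret bryant_setup \<A> h
    by unfold_locales (use assms in auto)
  \<comment> \<open>The vector \<open>F\<close> is the frame vector of index 0, so the iterated
    Gauss bundles of \<open>f\<close> are obtained by shifting {0}.\<close>
  have "f = sub {0}"
    unfolding f_def by (simp add: fun_eq_iff sub_0[OF assms(5)])
  then show ?thesis
    by (intro graded_conclusion nondegenerate sub_G2_SO4[OF assms(5)]) (simp_all add: phi_def)
qed

end
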